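(* There is an absolute constant $C>0$ and, for every $n\ge2$ and $\delta\in(0,0.1]$, an algorithm $\mathcal{A}^*_{n,\delta}$ for the $n$-armed bandit model such that for every instance whose arms, after relabeling, satisfy $\theta_1>\theta_2\ge\cdots\ge\theta_n$ (ordering unknown to the algorithm): (i) with probability at least $1-\delta$ the algorithm outputs the best arm; and (ii) its expected sample complexity is at most $$C\sum_{i=1}^n\Big(\frac{\sigma_i^2}{\Delta_i^2}+\frac{1}{\Delta_i}\Big)\big(\ln\delta^{-1}+\mathrm{LL}(\Delta_i^{-1})\big).$$
   Context: Bandit model: there are $n\ge2$ arms; each time arm $i$ is sampled, one observes an independent draw from an unknown distribution $\mathcal{D}_i$ supported on $[0,1]$ with mean $\theta_i$ and variance $\sigma_i^2$. An algorithm adaptively chooses (possibly using internal randomness) which arm to sample next based on all past observations, and eventually stops and outputs an arm; its sample complexity is the total number of samples taken. For an instance with $\theta_1>\theta_2\ge\cdots\ge\theta_n$ we write $\Delta_i=\theta_1-\theta_i$ for $i\ge2$ and $\Delta_1=\Delta_2$. For $x\ge1$, $\mathrm{LL}(x):=\ln(e+\ln x)$. *)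

theory Defs
  imports "HOL-Probability.Probability"
begin

datatype action = Sample nat | Stop nat

text \<open>A (randomized) policy maps the internal random seed and the history of
  observations (list of (arm, observed value)) to the next action.\<close>
type_synonym policy = "real \<Rightarrow> (nat \<times> real) list \<Rightarrow> action"

definition valid_policy :: "nat \<Rightarrow> policy \<Rightarrow> bool" where
  "valid_policy n pol \<longleftrightarrow> (\<forall>s h i. (pol s h = Sample i \<or> pol s h = Stop i) \<longrightarrow> i < n)"

text \<open>Reward-table model: X (i,k) is the value observed at the (k+1)-th sample of arm i.
  hist pol s X t is the history after t rounds.\<close>
primrec hist :: "policy \<Rightarrow> real \<Rightarrow> (nat \<times> nat \<Rightarrow> real) \<Rightarrow> nat \<Rightarrow> (nat \<times> real) list" where
  "hist pol s X 0 = []"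
| "hist pol s X (Suc t) =
     (let h = hist pol s X t in
      case pol s h of
        Sample i \<Rightarrow> h @ [(i, X (i, length (filter (\<lambda>p. fst p = i) h)))]
      | Stop i \<Rightarrow> h)"

definition is_stop :: "action \<Rightarrow> bool" where
  "is_stop a = (case a of Stop _ \<Rightarrow> True | Sample _ \<Rightarrow> False)"

definition stops :: "policy \<Rightarrow> real \<Rightarrow> (nat \<times> nat \<Rightarrow> real) \<Rightarrow> bool" where
  "stops pol s X \<longleftrightarrow> (\<exists>t. is_stop (pol s (hist pol s X t)))"

definition stop_round :: "policy \<Rightarrow> real \<Rightarrow> (nat \<times> nat \<Rightarrow> real) \<Rightarrow> nat" where
  "stop_round pol s X = (LEAST t. is_stop (pol s (hist pol s X t)))"

definition sample_complexity :: "policy \<Rightarrow> real \<Rightarrow> (nat \<times> nat \<Rightarrow> real) \<Rightarrow> ennreal" where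
  "sample_complexity pol s X =
     (if stops pol s X then ennreal (real (stop_round pol s X)) else \<infinity>)"

definition output_arm :: "policy \<Rightarrow> real \<Rightarrow> (nat \<times> nat \<Rightarrow> real) \<Rightarrow> nat option" where
  "output_arm pol s X =
     (if stops pol s X then
        (case pol s (hist pol s X (stop_round pol s X)) of Stop i \<Rightarrow> Some i | Sample i \<Rightarrow> None)
      else None)"

text \<open>Underlying probability space: uniform seed in [0,1] (internal randomness) times
  independent reward table, X(i,k) ~ D i independently.\<close>
definition bandit_space :: "nat \<Rightarrow> (nat \<Rightarrow> real measure) \<Rightarrow> (real \<times> (nat \<times> nat \<Rightarrow> real)) measure" where
  "bandit_space n D =
     uniform_measure lborel {0..1} \<Otimes>\<^sub>M (\<Pi>\<^sub>M p\<in>{..<n} \<times> (UNIV::nat set). D (fst p))"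

definition arm_mean :: "real measure \<Rightarrow> real" where
  "arm_mean Di = (\<integral>x. x \<partial>Di)"

definition arm_var :: "real measure \<Rightarrow> real" where
  "arm_var Di = (\<integral>x. (x - arm_mean Di)\<^sup>2 \<partial>Di)"

text \<open>Valid instance with n arms, distributions on [0,1], and unique best arm b.
  (Relabeling arms so that b is arm 1 gives theta_1 > theta_2 >= ... >= theta_n.)\<close>
definition bandit_instance :: "nat \<Rightarrow> (nat \<Rightarrow> real measure) \<Rightarrow> nat \<Rightarrow> bool" where
  "bandit_instance n D b \<longleftrightarrow> b < n \<and>
     (\<forall>i<n. prob_space (D i) \<and> sets (D i) = sets borel \<and> (AE x in D i. 0 \<le> x \<and> x \<le> 1)) \<and>
     (\<forall>i<n. i \<noteq> b \<longrightarrow> arm_mean (D i) < arm_mean (D b))"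

definition gap :: "nat \<Rightarrow> (nat \<Rightarrow> real measure) \<Rightarrow> nat \<Rightarrow> nat \<Rightarrow> real" where
  "gap n D b i =
     (if i = b then Min {arm_mean (D b) - arm_mean (D j) | j. j < n \<and> j \<noteq> b}
      else arm_mean (D b) - arm_mean (D i))"

definition LL :: "real \<Rightarrow> real" where
  "LL x = ln (exp 1 + ln x)"

end

theory Submission
  imports Defs "HOL-Library.Discrete_Functions"
begin

text \<open>
  Guess and verify, with doubling budgets \<open>M = n * 2 ^ k\<close>. A round first runs a UCB rule at constant
  confidence for \<open>2 * M\<close> steps and takes as candidate the arm that received most of the samples.
  Only the upper bound of the best arm has to be valid throughout; another arm \<open>i\<close> may be unlucky, but
  the samples it then absorbs have expectation of the order of its own hardness
  \<open>\<sigma> i ^ 2 / \<Delta> i ^ 2 + 1 / \<Delta> i\<close>, so no union bound over the arms, hence no \<open>ln n\<close>, is needed. Fresh samples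
  then certify the candidate \<open>a\<close>: a lower bound for \<open>a\<close> from \<open>M\<close> samples is compared with upper bounds
  of the other arms. A wrong candidate passes only if the bound of \<open>a\<close> or that of the best arm fails,
  again without a union bound. Once \<open>M\<close> exceeds the total hardness a round fails with probability at
  most 1/4, against a growth factor 2 of its length, so the expected length is geometric.

  Confidence bounds adapt to the variance through the self-normalized inequality
  \<open>E (exp (\<mu> * Y - 2 * \<mu> ^ 2 * Y ^ 2)) \<le> 1\<close> for centred \<open>Y\<close>, over a dyadic grid of \<open>\<mu>\<close>, and are updated only when
  a sample count reaches a power of 2. Independence of the rounds is a Markov property of
  the reward table: replacing the unread cells by a fresh table preserves the product measure.
\<close>

section \<open>Concentration for rewards in a table\<close>

text \<open>The reward table removes the interaction between policy and data: whether the upper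
  bound of arm \<open>i\<close> computed from its first \<open>2 ^ j\<close> samples is too large is
  an event of row \<open>i\<close> alone, whatever the policy does. The samples absorbed by unlucky
  arms are therefore majorised by a random sum that does not mention the policy, and linearity of
  expectation with Markov's inequality handles all arms at once, without a joint event over them.
  The only union bounds left are over dyadic sample counts and over the grid of \<mu>; the logarithm
  of a dyadic index is what becomes the \<open>LL\<close> term. Rewards lie in [0,1] only almost
  everywhere. The statistics use clipped values, so that the deterministic inequalities hold on
  every table and the null set enters only where integrals of \<open>clip\<close> are identified
  with the mean and the variance.\<close>

definition clip :: "real \<Rightarrow> real" where
  "clip x = max 0 (min 1 x)"

lemma clip_bounds [simp]: "0 \<le> clip x" "clip x \<le> 1"
  by (auto simp: clip_def)

lemma clip_id: "0 \<le> x \<Longrightarrow> x \<le> 1 \<Longrightarrow> clip x = x"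
  by (auto simp: clip_def)

lemma clip_measurable [measurable]: "clip \<in> borel_measurable borel"
  unfolding clip_def by measurable

text \<open>Pointwise source of the self-normalized inequality: with y = \<mu> * Y and Y centred,
  the right-hand side has expectation 1.\<close>

lemma exp_diff_square_le:
  fixes y :: real
  assumes "\<bar>y\<bar> \<le> 1/2"
  shows "exp (y - 2 * y\<^sup>2) \<le> 1 + y"
proof -
  have "\<bar>ln (1 + y) - y\<bar> \<le> 2 * y\<^sup>2"
    using abs_ln_one_plus_x_minus_x_bound[OF assms] .
  then have "y - 2 * y\<^sup>2 \<le> ln (1 + y)" by linarith
  then have "exp (y - 2 * y\<^sup>2) \<le> exp (ln (1 + y))" by simp
  also have "\<dots> = 1 + y" using assms by (intro exp_ln) linarith
  finally show ?thesis .
qed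

text \<open>For y = -z < 0 it suffices that (1 - z + z^2) * exp z is at least 1, and this already
  holds with exp z replaced by its quadratic Taylor polynomial.\<close>

lemma exp_le_quadratic:
  fixes y :: real
  assumes "\<bar>y\<bar> \<le> 1"
  shows "exp y \<le> 1 + y + y\<^sup>2"
proof (cases "0 \<le> y")
  case True
  then show ?thesis using assms exp_bound[of y] by auto
next
  case False
  define z where "z = - y"
  have z: "0 \<le> z" "z \<le> 1" using False assms by (auto simp: z_def)
  have pos: "0 \<le> 1 - z + z\<^sup>2" using z by simp
  have "(1 - z + z\<^sup>2) * (1 + z + z\<^sup>2 / 2) = 1 + (z ^ 2 + z ^ 3 + z ^ 4) / 2"
    by (simp add: power2_eq_square power3_eq_cube power4_eq_xxxx field_simps)
  then have "1 \<le> (1 - z + z\<^sup>2) * (1 + z + z\<^sup>2 / 2)"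
    using z by simp
  also have "\<dots> \<le> (1 - z + z\<^sup>2) * exp z"
    using exp_lower_Taylor_quadratic[OF z(1)] pos by (intro mult_left_mono) auto
  finally have "exp (- z) \<le> 1 - z + z\<^sup>2"
    by (simp add: exp_minus field_simps)
  then show ?thesis by (simp add: z_def)
qed

lemma exp_le_linear:
  fixes z :: real
  assumes "0 \<le> z" "z \<le> 1"
  shows "exp z \<le> 1 + 2 * z"
proof -
  have "z\<^sup>2 \<le> z" using assms by (simp add: power2_eq_square mult_left_le)
  then show ?thesis using exp_bound[of z] assms by linarith
qed

definition reward_table :: "nat \<Rightarrow> (nat \<Rightarrow> real measure) \<Rightarrow> (nat \<times> nat \<Rightarrow> real) measure" where
  "reward_table n D = (\<Pi>\<^sub>M p\<in>{..<n} \<times> (UNIV::nat set). D (fst p))"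

locale arms =
  fixes n :: nat and D :: "nat \<Rightarrow> real measure"
  assumes arm_prob: "i < n \<Longrightarrow> prob_space (D i)"
    and sets_arm: "i < n \<Longrightarrow> sets (D i) = sets borel"
    and arm_bounded: "i < n \<Longrightarrow> AE x in D i. 0 \<le> x \<and> x \<le> 1"
begin

abbreviation "T \<equiv> reward_table n D"

lemma prob_space_T: "prob_space T"
  unfolding reward_table_def by (intro prob_space_PiM) (auto intro: arm_prob)

sublocale P: prob_space T by (rule prob_space_T)

lemma borel_measurable_arm: "i < n \<Longrightarrow> borel_measurable (D i) = borel_measurable borel"
  using sets_arm by (intro measurable_cong_sets) auto

lemma measurable_arm_eq: "i < n \<Longrightarrow> M \<rightarrow>\<^sub>M D i = borel_measurable M"
  using sets_arm by (intro measurable_cong_sets) auto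

lemma cell_measurable_arm: "i < n \<Longrightarrow> (\<lambda>X. X (i, j)) \<in> T \<rightarrow>\<^sub>M D i"
  unfolding reward_table_def
  using measurable_component_singleton[of "(i, j)" "{..<n} \<times> UNIV" "\<lambda>p. D (fst p)"] by auto

lemma cell_measurable: "i < n \<Longrightarrow> (\<lambda>X. X (i, j)) \<in> borel_measurable T"
  using cell_measurable_arm by (auto simp: measurable_arm_eq)

lemma distr_cell: "i < n \<Longrightarrow> distr T (D i) (\<lambda>X. X (i, j)) = D i"
  unfolding reward_table_def
  using distr_PiM_component[of "{..<n} \<times> (UNIV::nat set)" "\<lambda>p. D (fst p)" "(i, j)"] arm_prob
  by auto

text \<open>Reindexing along j to (i, j) shows that row \<open>i\<close> of the product measure is
  again a product, and having the product of the marginals as joint law characterises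
  independence.\<close>

lemma indep_cells:
  assumes "i < n"
  shows "P.indep_vars (\<lambda>_. borel) (\<lambda>j X. X (i, j)) UNIV"
proof -
  have eq: "distr T (D i) (\<lambda>X. X (i, j)) = D i" for j
    by (rule distr_cell[OF assms])
  have 1: "distr T (\<Pi>\<^sub>M j\<in>(UNIV::nat set). D (fst (i, j))) (\<lambda>X. \<lambda>j\<in>UNIV. X (i, j))
      = (\<Pi>\<^sub>M j\<in>(UNIV::nat set). D (fst (i, j)))"
    unfolding reward_table_def
    using distr_PiM_reindex[of "{..<n} \<times> (UNIV::nat set)" "\<lambda>p. D (fst p)" "\<lambda>j. (i, j)" UNIV]
      assms arm_prob by (auto simp: inj_on_def)
  have "P.indep_vars (\<lambda>_. D i) (\<lambda>j X. X (i, j)) UNIV"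
  proof (subst P.indep_vars_iff_distr_eq_PiM)
    show "P.random_variable (D i) (\<lambda>X. X (i, j))" for j
      by (rule cell_measurable_arm[OF assms])
    show "distr T (\<Pi>\<^sub>M j\<in>UNIV. D i) (\<lambda>X. \<lambda>j\<in>UNIV. X (i, j)) =
      (\<Pi>\<^sub>M j\<in>UNIV. distr T (D i) (\<lambda>X. X (i, j)))"
      using 1 unfolding eq by simp
  qed auto
  then have "P.indep_vars (\<lambda>_. borel) (\<lambda>j X. (\<lambda>x. x) (X (i, j))) UNIV"
    by (rule P.indep_vars_compose2) (use assms in \<open>auto simp: borel_measurable_arm\<close>)
  then show ?thesis by simp
qed

text \<open>Exponential Markov inequality and independence. Working with nonnegative integrals asks
  for no integrability, and stating the one-cell bound as exp c covers both the self-normalized case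
  c = 0 and Bernstein-type bounds with c proportional to the variance.\<close>

lemma chernoff:
  fixes g :: "real \<Rightarrow> real"
  assumes i: "i < n" and g [measurable]: "g \<in> borel_measurable borel"
    and mgf: "(\<integral>\<^sup>+ x. ennreal (exp (g x)) \<partial>D i) \<le> ennreal (exp c)"
  shows "P.prob {X \<in> space T. s \<le> (\<Sum>j<t. g (X (i, j)))} \<le> exp (real t * c - s)"
proof -
  note [measurable] = cell_measurable[OF i]
  have ind: "P.indep_vars (\<lambda>_. borel) (\<lambda>j X. ennreal (exp (g (X (i, j))))) {..<t}"
    by (rule P.indep_vars_compose2[OF P.indep_vars_subset[OF indep_cells[OF i]],
          where Y = "\<lambda>_ x. ennreal (exp (g x))"]) auto
  have cell: "(\<integral>\<^sup>+ X. ennreal (exp (g (X (i, j)))) \<partial>T) = (\<integral>\<^sup>+ x. ennreal (exp (g x)) \<partial>D i)" for j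
  proof -
    have "(\<integral>\<^sup>+ x. ennreal (exp (g x)) \<partial>D i)
        = (\<integral>\<^sup>+ x. ennreal (exp (g x)) \<partial>distr T (D i) (\<lambda>X. X (i, j)))"
      by (simp add: distr_cell[OF i])
    also have "\<dots> = (\<integral>\<^sup>+ X. ennreal (exp (g (X (i, j)))) \<partial>T)"
      using cell_measurable_arm[OF i]
      by (intro nn_integral_distr) (auto simp: borel_measurable_arm[OF i])
    finally show ?thesis by simp
  qed
  have "emeasure T {X \<in> space T. s \<le> (\<Sum>j<t. g (X (i, j)))}
      = emeasure T ({X \<in> space T. 1 \<le> ennreal (exp (- s)) * (\<Prod>j<t. ennreal (exp (g (X (i, j)))))})"
  proof (intro arg_cong[where f = "emeasure T"] Collect_cong conj_cong refl)
    fix X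
    have "ennreal (exp (- s)) * (\<Prod>j<t. ennreal (exp (g (X (i, j)))))
      = ennreal (exp ((\<Sum>j<t. g (X (i, j))) - s))"
      by (simp add: prod_ennreal exp_sum[symmetric] ennreal_mult[symmetric] exp_add[symmetric])
    then show "(s \<le> (\<Sum>j<t. g (X (i, j)))) =
      (1 \<le> ennreal (exp (- s)) * (\<Prod>j<t. ennreal (exp (g (X (i, j))))))"
      by (simp add: ennreal_1[symmetric] del: ennreal_1)
  qed
  also have "\<dots> \<le> ennreal (exp (- s)) * (\<integral>\<^sup>+ X. (\<Prod>j<t. ennreal (exp (g (X (i, j))))) * indicator (space T) X \<partial>T)"
    by (rule nn_integral_Markov_inequality) simp_all
  also have "(\<integral>\<^sup>+ X. (\<Prod>j<t. ennreal (exp (g (X (i, j))))) * indicator (space T) X \<partial>T)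
    = (\<integral>\<^sup>+ X. (\<Prod>j<t. ennreal (exp (g (X (i, j))))) \<partial>T)"
    by (intro nn_integral_cong) simp
  also have "\<dots> = (\<Prod>j<t. \<integral>\<^sup>+ X. ennreal (exp (g (X (i, j)))) \<partial>T)"
    by (rule P.indep_vars_nn_integral) (use ind in auto)
  also have "ennreal (exp (- s)) * \<dots> \<le> ennreal (exp (- s)) * (\<Prod>j<t. ennreal (exp c))"
    unfolding cell by (intro mult_left_mono prod_mono_ennreal mgf) auto
  also have "\<dots> = ennreal (exp (- s)) * ennreal (exp (real t * c))"
    by (simp add: ennreal_power exp_of_nat_mult)
  also have "\<dots> = ennreal (exp (real t * c - s))"
    by (simp add: ennreal_mult[symmetric] exp_add[symmetric])
  finally show ?thesis
    by (simp add: P.emeasure_eq_measure)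
qed

end

section \<open>Empirical mean, empirical variance and the adaptive confidence radius\<close>

definition smean :: "real list \<Rightarrow> real" where
  "smean xs = sum_list (map clip xs) / length xs"

definition svar :: "real list \<Rightarrow> real" where
  "svar xs = sum_list (map (\<lambda>x. (clip x - smean xs)\<^sup>2) xs) / length xs"

text \<open>One factor j + 1 pays for the union over the j + 1 grid points of \<open>rad\<close>;
  the remaining (j + 1) * (j + 2) makes the failure probabilities telescope over the dyadic counts
  to at most \<eta>.\<close>

definition lev :: "real \<Rightarrow> nat \<Rightarrow> real" where
  "lev \<eta> j = ln ((real j + 1)\<^sup>2 * (real j + 2) / \<eta>)"

text \<open>An empirical Bernstein radius, of order sqrt (V * l / t) + l / t, kept as a minimum over
  \<mu> = 1/4, 1/8, ... down to about 1 / (4 t) instead of being optimised in closed form. Validity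
  is proved for every \<mu> of the grid, while an upper bound on the radius may use whichever \<mu>
  suits the unknown variance and gap.\<close>

definition rad :: "real \<Rightarrow> real list \<Rightarrow> real" where
  "rad \<eta> xs = (let j = floor_log (length xs) in
     Min ((\<lambda>m. 2 * (2 * (1 / 2 ^ (m + 2)) * svar xs
               + lev \<eta> j / ((1 / 2 ^ (m + 2)) * length xs))) ` {..j}))"

lemma borel_measurable_sum_list_map:
  fixes f :: "'k \<Rightarrow> 'w \<Rightarrow> real"
  assumes "\<And>k. k \<in> set ks \<Longrightarrow> f k \<in> borel_measurable M"
  shows "(\<lambda>\<omega>. sum_list (map (\<lambda>k. f k \<omega>) ks)) \<in> borel_measurable M"
  using assms by (induction ks) auto

lemma smean_measurable:
  assumes "\<And>k. k \<in> set ks \<Longrightarrow> v k \<in> borel_measurable M"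
  shows "(\<lambda>\<omega>. smean (map (\<lambda>k. v k \<omega>) ks)) \<in> borel_measurable M"
proof -
  have "(\<lambda>\<omega>. sum_list (map (\<lambda>k. clip (v k \<omega>)) ks)) \<in> borel_measurable M"
    by (rule borel_measurable_sum_list_map) (use assms in measurable)
  then show ?thesis unfolding smean_def by (simp add: comp_def)
qed

lemma svar_measurable:
  assumes "\<And>k. k \<in> set ks \<Longrightarrow> v k \<in> borel_measurable M"
  shows "(\<lambda>\<omega>. svar (map (\<lambda>k. v k \<omega>) ks)) \<in> borel_measurable M"
proof -
  note smean_measurable[OF assms, measurable]
  have "(\<lambda>\<omega>. sum_list (map (\<lambda>k. (clip (v k \<omega>) - smean (map (\<lambda>k. v k \<omega>) ks))\<^sup>2) ks)) \<in> borel_measurable M"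
    by (rule borel_measurable_sum_list_map) (use assms in measurable)
  then show ?thesis unfolding svar_def by (simp add: comp_def)
qed

lemma rad_measurable:
  assumes "\<And>k. k \<in> set ks \<Longrightarrow> v k \<in> borel_measurable M"
  shows "(\<lambda>\<omega>. rad \<eta> (map (\<lambda>k. v k \<omega>) ks)) \<in> borel_measurable M"
proof -
  note svar_measurable[OF assms, measurable]
  show ?thesis unfolding rad_def Let_def length_map by measurable
qed

lemma rad_le:
  assumes "m \<le> floor_log (length xs)"
  shows "rad \<eta> xs \<le> 2 * (2 * (1 / 2 ^ (m + 2)) * svar xs
               + lev \<eta> (floor_log (length xs)) / ((1 / 2 ^ (m + 2)) * length xs))"
  unfolding rad_def Let_def using assms by (intro Min_le) auto

lemma rad_attained:
  obtains m where "m \<le> floor_log (length xs)"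
    "rad \<eta> xs = 2 * (2 * (1 / 2 ^ (m + 2)) * svar xs
               + lev \<eta> (floor_log (length xs)) / ((1 / 2 ^ (m + 2)) * length xs))"
proof -
  have "rad \<eta> xs \<in> (\<lambda>m. 2 * (2 * (1 / 2 ^ (m + 2)) * svar xs
               + lev \<eta> (floor_log (length xs)) / ((1 / 2 ^ (m + 2)) * length xs))) ` {..floor_log (length xs)}"
    unfolding rad_def Let_def by (intro Min_in) auto
  then show ?thesis using that by auto
qed

lemma svar_nonneg: "0 \<le> svar xs"
  unfolding svar_def by (intro divide_nonneg_nonneg sum_list_nonneg) auto

lemma smean_bounds: "0 \<le> smean xs" "smean xs \<le> 1"
proof -
  show "0 \<le> smean xs"
    unfolding smean_def by (intro divide_nonneg_nonneg sum_list_nonneg) auto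
  have "sum_list (map clip xs) \<le> sum_list (map (\<lambda>_. 1) xs)"
    by (intro sum_list_mono) auto
  then show "smean xs \<le> 1"
    unfolding smean_def by (auto simp: sum_list_triv divide_le_eq_1)
qed

lemma sum_clip_diff:
  assumes "xs \<noteq> []"
  shows "sum_list (map (\<lambda>x. clip x - \<theta>) xs) = length xs * (smean xs - \<theta>)"
  using assms by (simp add: sum_list_subtractf sum_list_triv smean_def field_simps)

text \<open>Needed because the tail bound involves squares about the unknown true mean, whereas the
  radius may only use squares about the empirical mean.\<close>

lemma sum_clip_diff_square:
  assumes "xs \<noteq> []"
  shows "sum_list (map (\<lambda>x. (clip x - \<theta>)\<^sup>2) xs) = length xs * (svar xs + (smean xs - \<theta>)\<^sup>2)"
proof -
  have "sum_list (map (\<lambda>x. (clip x - \<theta>)\<^sup>2) xs)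
      = sum_list (map (\<lambda>x. (clip x - smean xs)\<^sup>2
          + (2 * (smean xs - \<theta>) * (clip x - smean xs) + (smean xs - \<theta>)\<^sup>2)) xs)"
    by (intro arg_cong[where f = sum_list] map_cong) (auto simp: power2_eq_square algebra_simps)
  also have "\<dots> = length xs * svar xs + 2 * (smean xs - \<theta>) * (length xs * (smean xs - smean xs))
      + length xs * (smean xs - \<theta>)\<^sup>2"
    using assms unfolding sum_list_addf sum_list_const_mult sum_clip_diff[OF assms, symmetric]
    by (simp add: sum_list_triv svar_def)
  finally show ?thesis by (simp add: algebra_simps)
qed

lemma sum_list_linear_square:
  "sum_list (map (\<lambda>x. a * (clip x - \<theta>) - b * (clip x - \<theta>)\<^sup>2) xs)
    = a * sum_list (map (\<lambda>x. clip x - \<theta>) xs) - b * sum_list (map (\<lambda>x. (clip x - \<theta>)\<^sup>2) xs)"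
  by (induction xs) (auto simp: algebra_simps)

lemma lev_nonneg:
  assumes "0 < \<eta>" "\<eta> \<le> 1"
  shows "0 \<le> lev \<eta> j"
proof -
  have "1 * 1 \<le> (real j + 1)\<^sup>2 * (real j + 2)" by (intro mult_mono) auto
  then show ?thesis unfolding lev_def using assms by (intro ln_ge_zero) (auto simp: field_simps)
qed

lemma exp_minus_lev:
  assumes "0 < \<eta>"
  shows "(real j + 1) * exp (- lev \<eta> j) = \<eta> / ((real j + 1) * (real j + 2))"
proof -
  have "exp (- lev \<eta> j) = \<eta> / ((real j + 1)\<^sup>2 * (real j + 2))"
    unfolding lev_def exp_minus using assms by (subst exp_ln) auto
  then show ?thesis by (simp add: power2_eq_square)
qed

text \<open>The term d^2 left over from recentring is harmless: \<mu> \<le> 1/4 and |d| \<le> 1 give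
  2 * \<mu> * d^2 \<le> d / 2, which is moved to the left-hand side. This is the origin of the outer
  factor 2 in \<open>rad\<close>.\<close>

lemma deviation_absorb:
  fixes d V \<mu> t l :: real
  assumes "0 < \<mu>" "\<mu> \<le> 1/4" "\<bar>d\<bar> \<le> 1" "0 \<le> V" "0 < t" "0 \<le> l"
    and "\<mu> * (t * d) - 2 * \<mu>\<^sup>2 * (t * (V + d\<^sup>2)) < l"
  shows "d < 2 * (2 * \<mu> * V + l / (\<mu> * t)) \<or> d \<le> 0"
proof (cases "d \<le> 0")
  case False
  have "2 * \<mu> * d\<^sup>2 \<le> d / 2"
  proof -
    have "\<mu> * d \<le> 1/4 * 1" using assms False by (intro mult_mono) auto
    then have "(\<mu> * d) * (2 * d) \<le> 1/4 * (2 * d)" using False by (intro mult_right_mono) auto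
    then show ?thesis by (simp add: power2_eq_square algebra_simps)
  qed
  moreover have "(d - 2 * \<mu> * (V + d\<^sup>2)) * (\<mu> * t) < l"
    using assms(7) by (simp add: power2_eq_square algebra_simps)
  then have "d - 2 * \<mu> * (V + d\<^sup>2) < l / (\<mu> * t)"
    using assms by (subst pos_less_divide_eq) auto
  moreover define q where "q = l / (\<mu> * t)"
  ultimately show ?thesis unfolding q_def[symmetric] by (simp add: algebra_simps)
qed simp

text \<open>Take the largest \<mu> = 1 / 2^(m + 2) with \<mu> * v \<le> \<Delta> / 128. If m > 0,
  the scale before it fails the condition, which bounds 1 / \<mu> by twice 128 * v /
  \<Delta>.\<close>

lemma dyadic_scale:
  fixes v \<Delta> :: real
  assumes "0 \<le> v" "0 < \<Delta>"
  obtains m :: nat where "v / 2 ^ (m + 2) \<le> \<Delta> / 128" "2 ^ (m + 2) \<le> 4 + 256 * (v / \<Delta>)"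
proof -
  define Q where "Q m \<longleftrightarrow> v / 2 ^ (m + 2) \<le> \<Delta> / 128" for m :: nat
  obtain k where k: "128 * v / \<Delta> < 2 ^ k" using real_arch_pow[of 2 "128 * v / \<Delta>"] by auto
  have "(2::real) ^ k \<le> 2 ^ (k + 2)" by (intro power_increasing) auto
  with k have "128 * v / \<Delta> < 2 ^ (k + 2)" by linarith
  then have "Q k" unfolding Q_def using assms by (simp add: field_simps)
  define m where "m = (LEAST m. Q m)"
  have Qm: "Q m" unfolding m_def by (rule LeastI) fact
  have "2 ^ (m + 2) \<le> 4 + 256 * (v / \<Delta>)"
  proof (cases m)
    case 0
    then show ?thesis using assms by simp
  next
    case (Suc m')
    then have "\<not> Q m'" unfolding m_def using not_less_Least by (metis lessI)
    then have "2 ^ (m' + 2) < 128 * (v / \<Delta>)"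
      unfolding Q_def using assms by (simp add: field_simps)
    then show ?thesis unfolding Suc by simp
  qed
  then show ?thesis using that Qm unfolding Q_def by blast
qed

section \<open>Tail bounds and confidence bounds for a single arm\<close>

context arms
begin

abbreviation "\<theta> i \<equiv> arm_mean (D i)"
abbreviation "v i \<equiv> arm_var (D i)"

abbreviation draws :: "nat \<Rightarrow> nat \<Rightarrow> (nat \<times> nat \<Rightarrow> real) \<Rightarrow> real list" where
  "draws i t X \<equiv> map (\<lambda>j. X (i, j)) [0..<t]"

lemma clip_AE: "i < n \<Longrightarrow> AE x in D i. clip x = x"
  using arm_bounded by (rule AE_mp) (auto simp: clip_id)

lemma
  assumes "i < n"
  shows integrable_arm: "integrable (D i) clip"
    and integral_clip: "(\<integral>x. clip x \<partial>D i) = \<theta> i"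
    and integrable_arm_square: "integrable (D i) (\<lambda>x. (clip x - \<theta> i)\<^sup>2)"
    and integral_square_clip: "(\<integral>x. (clip x - \<theta> i)\<^sup>2 \<partial>D i) = v i"
    and arm_mean_bounds: "0 \<le> \<theta> i" "\<theta> i \<le> 1"
    and arm_var_bounds: "0 \<le> v i" "v i \<le> 1"
proof -
  interpret A: prob_space "D i" by (rule arm_prob[OF assms])
  note [simp] = borel_measurable_arm[OF assms]
  show int: "integrable (D i) clip"
    by (rule A.integrable_const_bound[where B = 1]) auto
  show eq: "(\<integral>x. clip x \<partial>D i) = \<theta> i"
    unfolding arm_mean_def using clip_AE[OF assms] by (intro integral_cong_AE) auto
  show b: "0 \<le> \<theta> i" "\<theta> i \<le> 1"
    unfolding eq[symmetric] by (auto intro!: A.integral_ge_const A.integral_le_const int)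
  have bd: "(clip x - \<theta> i)\<^sup>2 \<le> 1" for x
    using b clip_bounds[of x] by (intro abs_square_le_1[THEN iffD2]) (smt (verit))
  show int2: "integrable (D i) (\<lambda>x. (clip x - \<theta> i)\<^sup>2)"
    by (rule A.integrable_const_bound[where B = 1]) (use bd in auto)
  show eq2: "(\<integral>x. (clip x - \<theta> i)\<^sup>2 \<partial>D i) = v i"
    unfolding arm_var_def using clip_AE[OF assms] by (intro integral_cong_AE) auto
  show "0 \<le> v i" "v i \<le> 1"
    unfolding eq2[symmetric] using bd by (auto intro!: A.integral_ge_const A.integral_le_const int2)
qed

text \<open>Under the expectation the linear term vanishes and the square becomes the variance, so
  each of the next three tail bounds reduces to one pointwise inequality, with c = 0, \<mu>^2 and
  2.\<close>

lemma chernoff_quadratic: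
  assumes i: "i < n" and g [measurable]: "g \<in> borel_measurable borel" and "0 \<le> c"
    and le: "\<And>x. exp (g x) \<le> 1 + a * (clip x - \<theta> i) + c * (clip x - \<theta> i)\<^sup>2"
  shows "P.prob {X \<in> space T. s \<le> sum_list (map g (draws i t X))} \<le> exp (real t * (c * v i) - s)"
proof -
  interpret A: prob_space "D i" by (rule arm_prob[OF i])
  have int: "integrable (D i) (\<lambda>x. 1 + a * (clip x - \<theta> i) + c * (clip x - \<theta> i)\<^sup>2)"
    by (intro Bochner_Integration.integrable_add Bochner_Integration.integrable_diff integrable_mult_right A.integrable_const
        integrable_arm integrable_arm_square i)
  have "(\<integral>\<^sup>+ x. ennreal (exp (g x)) \<partial>D i)
      \<le> (\<integral>\<^sup>+ x. ennreal (1 + a * (clip x - \<theta> i) + c * (clip x - \<theta> i)\<^sup>2) \<partial>D i)"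
    by (intro nn_integral_mono ennreal_leI le)
  also have "\<dots> = ennreal (\<integral>x. 1 + a * (clip x - \<theta> i) + c * (clip x - \<theta> i)\<^sup>2 \<partial>D i)"
    by (intro nn_integral_eq_integral int AE_I2) (meson le exp_ge_zero order_trans)
  also have "(\<integral>x. 1 + a * (clip x - \<theta> i) + c * (clip x - \<theta> i)\<^sup>2 \<partial>D i)
      = (\<integral>x. 1 + a * (clip x - \<theta> i) \<partial>D i) + (\<integral>x. c * (clip x - \<theta> i)\<^sup>2 \<partial>D i)"
    by (intro Bochner_Integration.integral_add Bochner_Integration.integrable_add Bochner_Integration.integrable_diff
        integrable_mult_right A.integrable_const integrable_arm integrable_arm_square i)
  also have "\<dots> = 1 + c * v i"
    using integrable_arm[OF i] integral_clip[OF i] integral_square_clip[OF i] A.prob_space by simp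
  also have "ennreal (1 + c * v i) \<le> ennreal (exp (c * v i))"
    using exp_ge_add_one_self by (intro ennreal_leI) auto
  finally have "P.prob {X \<in> space T. s \<le> (\<Sum>j<t. g (X (i, j)))} \<le> exp (real t * (c * v i) - s)"
    by (rule chernoff[OF i g])
  then show ?thesis
    by (simp add: comp_def interv_sum_list_conv_sum_set_nat atLeast0LessThan)
qed

lemma clip_diff_abs_le: "i < n \<Longrightarrow> \<bar>clip x - \<theta> i\<bar> \<le> 1"
  using arm_mean_bounds[of i] clip_bounds[of x] by linarith

lemma self_normalized_tail:
  assumes i: "i < n" and "\<bar>\<mu>\<bar> \<le> 1/4"
  shows "P.prob {X \<in> space T. s \<le> sum_list (map (\<lambda>x. \<mu> * (clip x - \<theta> i) - 2 * \<mu>\<^sup>2 * (clip x - \<theta> i)\<^sup>2) (draws i t X))}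
    \<le> exp (- s)"
proof -
  have "exp (\<mu> * (clip x - \<theta> i) - 2 * \<mu>\<^sup>2 * (clip x - \<theta> i)\<^sup>2) \<le> 1 + \<mu> * (clip x - \<theta> i) + 0 * (clip x - \<theta> i)\<^sup>2" for x
  proof -
    have "\<bar>\<mu> * (clip x - \<theta> i)\<bar> \<le> 1/4 * 1"
      unfolding abs_mult using assms clip_diff_abs_le[OF i] by (intro mult_mono) auto
    then show ?thesis using exp_diff_square_le[of "\<mu> * (clip x - \<theta> i)"] by (simp add: power_mult_distrib mult.assoc)
  qed
  then show ?thesis using chernoff_quadratic[OF i, of "\<lambda>x. \<mu> * (clip x - \<theta> i) - 2 * \<mu>\<^sup>2 * (clip x - \<theta> i)\<^sup>2" 0 \<mu> s t] by simp
qed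

lemma bernstein_tail:
  assumes i: "i < n" and "\<bar>\<mu>\<bar> \<le> 1"
  shows "P.prob {X \<in> space T. s \<le> sum_list (map (\<lambda>x. \<mu> * (clip x - \<theta> i)) (draws i t X))}
    \<le> exp (real t * (\<mu>\<^sup>2 * v i) - s)"
proof (rule chernoff_quadratic[OF i])
  fix x
  have "\<bar>\<mu> * (clip x - \<theta> i)\<bar> \<le> 1 * 1"
    unfolding abs_mult using assms clip_diff_abs_le[OF i] by (intro mult_mono) auto
  then show "exp (\<mu> * (clip x - \<theta> i)) \<le> 1 + \<mu> * (clip x - \<theta> i) + \<mu>\<^sup>2 * (clip x - \<theta> i)\<^sup>2"
    using exp_le_quadratic[of "\<mu> * (clip x - \<theta> i)"] by (simp add: power_mult_distrib)
qed auto

text \<open>Keeps the empirical variance below about twice the true one, which in turn bounds the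
  random radius.\<close>

lemma square_tail:
  assumes i: "i < n"
  shows "P.prob {X \<in> space T. s \<le> sum_list (map (\<lambda>x. (clip x - \<theta> i)\<^sup>2) (draws i t X))}
    \<le> exp (real t * (2 * v i) - s)"
proof (rule chernoff_quadratic[OF i, where a = 0])
  fix x
  have "(clip x - \<theta> i)\<^sup>2 \<le> 1"
    using clip_diff_abs_le[OF i] abs_square_le_1 by blast
  then show "exp ((clip x - \<theta> i)\<^sup>2) \<le> 1 + 0 * (clip x - \<theta> i) + 2 * (clip x - \<theta> i)\<^sup>2"
    using exp_le_linear[of "(clip x - \<theta> i)\<^sup>2"] by simp
qed auto

lemma draws_stat_measurable:
  assumes "i < n"
  shows "(\<lambda>X. smean (draws i t X)) \<in> borel_measurable T"
    "(\<lambda>X. svar (draws i t X)) \<in> borel_measurable T"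
    "(\<lambda>X. rad \<eta> (draws i t X)) \<in> borel_measurable T"
  using cell_measurable[OF assms]
  by (auto intro: smean_measurable svar_measurable rad_measurable)

lemma sum_draws_measurable:
  assumes "i < n" "f \<in> borel_measurable borel"
  shows "(\<lambda>X. sum_list (map f (draws i t X)) :: real) \<in> borel_measurable T"
proof -
  have "(\<lambda>X. sum_list (map (\<lambda>j. f (X (i, j))) [0..<t])) \<in> borel_measurable T"
    by (rule borel_measurable_sum_list_map) (rule measurable_compose[OF cell_measurable assms(2)], rule assms)
  then show ?thesis by (simp add: comp_def)
qed

text \<open>The sign \<open>\<epsilon>\<close> treats the lower and the upper confidence bound together.\<close>

lemma confidence_bound:
  assumes i: "i < n" and t: "0 < t" and \<eta>: "0 < \<eta>" "\<eta> \<le> 1" and \<epsilon>: "\<bar>\<epsilon>\<bar> = 1"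
  shows "P.prob {X \<in> space T. rad \<eta> (draws i t X) < \<epsilon> * (smean (draws i t X) - \<theta> i)}
    \<le> \<eta> / ((real (floor_log t) + 1) * (real (floor_log t) + 2))"
proof -
  define j where "j = floor_log t"
  define l where "l = lev \<eta> j"
  define g where "g m = (\<lambda>x. \<epsilon> / 2 ^ (m + 2) * (clip x - \<theta> i) - 2 * (\<epsilon> / 2 ^ (m + 2))\<^sup>2 * (clip x - \<theta> i)\<^sup>2)" for m :: nat
  define E where "E m = {X \<in> space T. l \<le> sum_list (map (g m) (draws i t X))}" for m
  have gm: "g m \<in> borel_measurable borel" for m unfolding g_def by measurable
  note [measurable] = sum_draws_measurable[OF i gm]
  have Em [measurable]: "E m \<in> sets T" for m unfolding E_def by measurable
  have lam: "1 / 2 ^ (m + 2) \<le> (1/4 :: real)" for m :: nat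
    by (simp add: field_simps)
  have l0: "0 \<le> l" unfolding l_def by (rule lev_nonneg[OF \<eta>])
  have \<epsilon>2: "\<epsilon>\<^sup>2 = 1" using \<epsilon> by (metis abs_1 power2_abs one_power2)
  \<comment> \<open>The minimum in \<open>rad\<close> is attained at some grid point, so a deviation
    beyond it violates the self-normalized bound for that \<mu>; one event per grid point
    suffices.\<close>
  have "{X \<in> space T. rad \<eta> (draws i t X) < \<epsilon> * (smean (draws i t X) - \<theta> i)} \<subseteq> (\<Union>m\<in>{..j}. E m)"
  proof (rule ccontr)
    assume "\<not> ?thesis"
    then obtain X where X: "X \<in> space T" "rad \<eta> (draws i t X) < \<epsilon> * (smean (draws i t X) - \<theta> i)"
      and nE: "\<And>m. m \<le> j \<Longrightarrow> X \<notin> E m" by auto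
    define xs where "xs = draws i t X"
    have xs: "length xs = t" "xs \<noteq> []" using t by (auto simp: xs_def)
    obtain m where m: "m \<le> j" "rad \<eta> xs = 2 * (2 * (1 / 2 ^ (m + 2)) * svar xs
               + lev \<eta> j / ((1 / 2 ^ (m + 2)) * length xs))"
      using rad_attained[of xs \<eta>] unfolding xs j_def by metis
    define \<mu> :: real where "\<mu> = 1 / 2 ^ (m + 2)"
    define d where "d = \<epsilon> * (smean xs - \<theta> i)"
    have d2: "d\<^sup>2 = (smean xs - \<theta> i)\<^sup>2" unfolding d_def by (simp add: power_mult_distrib \<epsilon>2)
    have "\<bar>d\<bar> \<le> 1" unfolding d_def abs_mult \<epsilon>
      using smean_bounds[of xs] arm_mean_bounds[OF i] by (auto simp: abs_le_iff)
    moreover have "sum_list (map (g m) xs) < l"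
      using nE[OF m(1)] X(1) unfolding E_def xs_def by auto
    then have "\<mu> * (t * d) - 2 * \<mu>\<^sup>2 * (t * (svar xs + d\<^sup>2)) < l"
      unfolding g_def sum_list_linear_square sum_clip_diff[OF xs(2)]
        sum_clip_diff_square[OF xs(2)] d2
      by (simp add: d_def \<mu>_def xs(1) power_divide \<epsilon>2 algebra_simps diff_divide_distrib)
    moreover have "0 < \<mu>" "\<mu> \<le> 1/4" using lam by (auto simp: \<mu>_def)
    ultimately have "d < 2 * (2 * \<mu> * svar xs + l / (\<mu> * t)) \<or> d \<le> 0"
      using t l0 svar_nonneg by (intro deviation_absorb) auto
    moreover have rr: "rad \<eta> xs = 2 * (2 * \<mu> * svar xs + l / (\<mu> * t))"
      using m(2) by (simp add: \<mu>_def l_def xs)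
    moreover have "0 \<le> rad \<eta> xs" unfolding rr using l0 svar_nonneg \<open>0 < \<mu>\<close> by simp
    ultimately show False using X(2) unfolding xs_def[symmetric] d_def by linarith
  qed
  then have "P.prob {X \<in> space T. rad \<eta> (draws i t X) < \<epsilon> * (smean (draws i t X) - \<theta> i)}
      \<le> P.prob (\<Union>m\<in>{..j}. E m)"
    by (intro P.finite_measure_mono) auto
  also have "\<dots> \<le> (\<Sum>m\<in>{..j}. P.prob (E m))"
    by (intro P.finite_measure_subadditive_finite) auto
  also have "\<dots> \<le> (\<Sum>m\<in>{..j}. exp (- l))"
  proof (intro sum_mono)
    fix m
    show "P.prob (E m) \<le> exp (- l)"
      unfolding E_def g_def using self_normalized_tail[OF i, of "\<epsilon> / 2 ^ (m + 2)"] lam[of m] \<epsilon> by simp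
  qed
  also have "\<dots> = (real j + 1) * exp (- l)" by simp
  also have "\<dots> = \<eta> / ((real j + 1) * (real j + 2))" unfolding l_def by (rule exp_minus_lev[OF \<eta>(1)])
  finally show ?thesis unfolding j_def .
qed

text \<open>Once \<open>t\<close> is of order N * lev, the radius resolves the gap. At the scale
  \<mu> from \<open>dyadic_scale\<close>, where 1 / (\<mu> * \<Delta>) \<le> 256 * N, two events
  suffice: one keeps the deviation of the mean below \<Delta> / 4, the other keeps the empirical
  variance, hence the radius, so small that it is below \<Delta> / 4 too.\<close>

lemma separation_bound:
  fixes \<Delta> \<epsilon> :: real
  assumes i: "i < n" and \<Delta>: "0 < \<Delta>" "\<Delta> \<le> 1" and \<epsilon>: "\<bar>\<epsilon>\<bar> = 1"
    and N: "N = v i / \<Delta>\<^sup>2 + 1 / \<Delta>"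
    and lev: "1 \<le> lev \<eta> (floor_log t)" and t: "8192 * N * lev \<eta> (floor_log t) \<le> real t"
  shows "P.prob {X \<in> space T. \<Delta> / 2 \<le> \<epsilon> * (smean (draws i t X) - \<theta> i) + rad \<eta> (draws i t X)}
    \<le> 2 * exp (- (t / (2048 * N)))"
proof -
  define l where "l = lev \<eta> (floor_log t)"
  have v0: "0 \<le> v i" by (rule arm_var_bounds[OF i])
  obtain m :: nat where m: "v i / 2 ^ (m + 2) \<le> \<Delta> / 128" "2 ^ (m + 2) \<le> 4 + 256 * (v i / \<Delta>)"
    using dyadic_scale[OF v0 \<Delta>(1)] by metis
  define \<mu> :: real where "\<mu> = 1 / 2 ^ (m + 2)"
  have \<mu>: "0 < \<mu>" "\<mu> \<le> 1/4" by (auto simp: \<mu>_def field_simps)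
  have \<mu>v: "\<mu> * v i \<le> \<Delta> / 128" using m(1) by (simp add: \<mu>_def)
  have "1 \<le> 1 / \<Delta>" using \<Delta> by simp
  then have N1: "1 \<le> N" unfolding N using v0 by (smt (verit) divide_nonneg_nonneg zero_le_power2)
  have "1 / \<mu> \<le> 4 + 256 * (v i / \<Delta>)" using m(2) by (simp add: \<mu>_def)
  then have "1 / \<mu> / \<Delta> \<le> (4 + 256 * (v i / \<Delta>)) / \<Delta>" using \<Delta> by (intro divide_right_mono) auto
  also have "\<dots> \<le> 256 * N" unfolding N using \<Delta> by (simp add: field_simps power2_eq_square)
  finally have \<mu>\<Delta>: "1 / (\<mu> * \<Delta>) \<le> 256 * N" by simp
  then have \<mu>\<Delta>': "1 \<le> 256 * N * (\<mu> * \<Delta>)" using \<mu> \<Delta> by (simp add: pos_divide_le_eq)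
  have "8192 * N * 1 \<le> 8192 * N * lev \<eta> (floor_log t)" using N1 lev by (intro mult_left_mono) auto
  with t have tN: "8192 * N \<le> real t" by linarith
  then have t0: "0 < t" using N1 by (cases t) auto
  \<comment> \<open>The chosen scale has to belong to the grid over which \<open>rad\<close>
    minimises, that is 2^m \<le> t.\<close>
  have "(2::real) ^ m \<le> 2 ^ (m + 2)" by (intro power_increasing) auto
  also have "\<dots> \<le> 256 * (N * \<Delta>)"
  proof -
    have "N * \<Delta> = v i / \<Delta> + 1" unfolding N using \<Delta> by (simp add: field_simps power2_eq_square)
    then show ?thesis using m(2) by simp
  qed
  also have "\<dots> \<le> 256 * (N * 1)" using N1 \<Delta> by (intro mult_left_mono) auto
  also have "\<dots> \<le> real t" using tN N1 by linarith
  finally have "2 ^ m \<le> t" by (metis of_nat_le_iff of_nat_numeral of_nat_power)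
  then have mj: "m \<le> floor_log t" using floor_log_le_iff[of "2 ^ m" t] by simp
  \<comment> \<open>Both thresholds leave at least t * \<mu> * \<Delta> / 8 in the exponent after
    the variance term is subtracted; with 1 / (\<mu> * \<Delta>) \<le> 256 * N this gives the 2048 =
    8 * 256 of the conclusion.\<close>
  define A where "A = {X \<in> space T. t * (\<mu> * \<Delta> / 4) \<le> sum_list (map (\<lambda>x. (\<epsilon> * \<mu>) * (clip x - \<theta> i)) (draws i t X))}"
  define B where "B = {X \<in> space T. t * (2 * v i + \<mu> * \<Delta> / 8) \<le> sum_list (map (\<lambda>x. (clip x - \<theta> i)\<^sup>2) (draws i t X))}"
  have "(\<lambda>x. (\<epsilon> * \<mu>) * (clip x - \<theta> i)) \<in> borel_measurable borel" "(\<lambda>x. (clip x - \<theta> i)\<^sup>2) \<in> borel_measurable borel"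
    by measurable
  note [measurable] = this[THEN sum_draws_measurable[OF i]]
  have AB [measurable]: "A \<in> sets T" "B \<in> sets T" unfolding A_def B_def by measurable
  have \<epsilon>2: "\<epsilon>\<^sup>2 = 1" using \<epsilon> by (metis abs_1 power2_abs one_power2)
  have exps: "t * (\<mu> * \<Delta> / 8) \<ge> t / (2048 * N)"
  proof -
    have "1 / (2048 * N) \<le> \<mu> * \<Delta> / 8" using \<mu>\<Delta>' N1 by (simp add: field_simps)
    then have "t * (1 / (2048 * N)) \<le> t * (\<mu> * \<Delta> / 8)" by (intro mult_left_mono) auto
    then show ?thesis by simp
  qed
  have "P.prob A \<le> exp (real t * ((\<epsilon> * \<mu>)\<^sup>2 * v i) - t * (\<mu> * \<Delta> / 4))"
    unfolding A_def by (rule bernstein_tail[OF i]) (use \<epsilon> \<mu> in \<open>simp add: abs_mult\<close>)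
  also have "\<dots> \<le> exp (- (t / (2048 * N)))"
  proof -
    have "\<mu> * (\<mu> * v i) \<le> \<mu> * (\<Delta> / 128)" using \<mu>v \<mu> by (intro mult_left_mono) auto
    then have "\<mu>\<^sup>2 * v i - \<mu> * \<Delta> / 4 \<le> - (\<mu> * \<Delta> / 8)"
      using mult_pos_pos[OF \<mu>(1) \<Delta>(1)] unfolding power2_eq_square mult.assoc by argo
    then have "t * (\<mu>\<^sup>2 * v i - \<mu> * \<Delta> / 4) \<le> t * (- (\<mu> * \<Delta> / 8))" by (intro mult_left_mono) auto
    then show ?thesis using exps by (simp add: power_mult_distrib \<epsilon>2 algebra_simps)
  qed
  finally have pA: "P.prob A \<le> exp (- (t / (2048 * N)))" .
  have "P.prob B \<le> exp (real t * (2 * v i) - t * (2 * v i + \<mu> * \<Delta> / 8))"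
    unfolding B_def by (rule square_tail[OF i])
  also have "\<dots> \<le> exp (- (t / (2048 * N)))" using exps by (simp add: algebra_simps)
  finally have pB: "P.prob B \<le> exp (- (t / (2048 * N)))" .
  have "{X \<in> space T. \<Delta> / 2 \<le> \<epsilon> * (smean (draws i t X) - \<theta> i) + rad \<eta> (draws i t X)} \<subseteq> A \<union> B"
  proof (rule ccontr)
    assume "\<not> ?thesis"
    then obtain X where X: "X \<in> space T" "\<Delta> / 2 \<le> \<epsilon> * (smean (draws i t X) - \<theta> i) + rad \<eta> (draws i t X)"
      "X \<notin> A" "X \<notin> B" by auto
    define xs where "xs = draws i t X"
    have xs: "length xs = t" "xs \<noteq> []" using t0 by (auto simp: xs_def)
    have "sum_list (map (\<lambda>x. (\<epsilon> * \<mu>) * (clip x - \<theta> i)) xs) < t * (\<mu> * \<Delta> / 4)"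
      using X(1,3) unfolding A_def xs_def by (simp only: mem_Collect_eq simp_thms not_le)
    then have "(\<epsilon> * \<mu>) * (t * (smean xs - \<theta> i)) < t * (\<mu> * \<Delta> / 4)"
      unfolding sum_list_const_mult sum_clip_diff[OF xs(2)] xs(1) .
    then have "(t * \<mu>) * (\<epsilon> * (smean xs - \<theta> i)) < (t * \<mu>) * (\<Delta> / 4)" by (simp add: algebra_simps)
    then have d: "\<epsilon> * (smean xs - \<theta> i) < \<Delta> / 4" using \<mu> t0 by (subst (asm) mult_less_cancel_left_pos) auto
    have "sum_list (map (\<lambda>x. (clip x - \<theta> i)\<^sup>2) xs) < t * (2 * v i + \<mu> * \<Delta> / 8)"
      using X(1,4) unfolding B_def xs_def by (simp only: mem_Collect_eq simp_thms not_le)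
    then have "t * (svar xs + (smean xs - \<theta> i)\<^sup>2) < t * (2 * v i + \<mu> * \<Delta> / 8)"
      unfolding sum_clip_diff_square[OF xs(2)] xs(1) .
    then have "svar xs + (smean xs - \<theta> i)\<^sup>2 < 2 * v i + \<mu> * \<Delta> / 8" using t0 by simp
    then have V: "svar xs \<le> 2 * v i + \<mu> * \<Delta> / 8" using zero_le_power2[of "smean xs - \<theta> i"] by linarith
    have "rad \<eta> xs \<le> 2 * (2 * \<mu> * svar xs + l / (\<mu> * t))"
      using rad_le[of m xs \<eta>] mj unfolding xs(1) \<mu>_def l_def by simp
    then have "rad \<eta> xs \<le> 4 * (\<mu> * svar xs) + 2 * (l / (\<mu> * t))" by simp
    moreover have "\<mu> * svar xs \<le> \<mu> * (2 * v i + \<mu> * \<Delta> / 8)" using V \<mu> by (intro mult_left_mono) auto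
    then have "\<mu> * svar xs \<le> 2 * (\<mu> * v i) + \<mu> * (\<mu> * \<Delta>) / 8" by (simp add: algebra_simps)
    moreover have "\<mu> * (\<mu> * \<Delta>) \<le> 1/4 * (1/4 * \<Delta>)" using \<mu> \<Delta> by (intro mult_mono) auto
    \<comment> \<open>Here 8192 = 32 * 256 is used. In total the radius is at most 4 * (\<Delta> /
      64 + \<Delta> / 128) + 2 * \<Delta> / 32 = 5 * \<Delta> / 32.\<close>
    moreover have "l / (\<mu> * t) \<le> \<Delta> / 32"
    proof -
      have "32 * l * 1 \<le> 32 * l * (256 * N * (\<mu> * \<Delta>))"
        using lev \<mu>\<Delta>' unfolding l_def by (intro mult_left_mono) auto
      also have "\<dots> = (8192 * N * l) * (\<mu> * \<Delta>)" by simp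
      also have "\<dots> \<le> t * (\<mu> * \<Delta>)" using t \<mu> \<Delta> unfolding l_def by (intro mult_right_mono) auto
      finally show ?thesis using \<mu> t0 by (simp add: field_simps)
    qed
    ultimately have "rad \<eta> xs < \<Delta> / 4" using \<mu>v \<Delta> by linarith
    with d X(2) show False unfolding xs_def[symmetric] by linarith
  qed
  then have "P.prob {X \<in> space T. \<Delta> / 2 \<le> \<epsilon> * (smean (draws i t X) - \<theta> i) + rad \<eta> (draws i t X)} \<le> P.prob (A \<union> B)"
    by (intro P.finite_measure_mono) auto
  also have "\<dots> \<le> P.prob A + P.prob B" by (intro measure_Un_le) auto
  finally show ?thesis using pA pB by linarith
qed

end

section \<open>Markov property of the reward table\<close>

abbreviation run :: "((nat \<times> real) list \<Rightarrow> action) \<Rightarrow> (nat \<times> nat \<Rightarrow> real) \<Rightarrow> nat \<Rightarrow> (nat \<times> real) list" where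
  "run p X t \<equiv> hist (\<lambda>_. p) 0 X t"

definition obs :: "nat \<Rightarrow> (nat \<times> real) list \<Rightarrow> real list" where
  "obs i h = map snd (filter (\<lambda>q. fst q = i) h)"

lemma obs_simps [simp]:
  "obs i [] = []"
  "obs i (g @ h) = obs i g @ obs i h"
  "obs i [(j, x)] = (if j = i then [x] else [])"
  by (auto simp: obs_def)

lemma run_Suc:
  "run p X (Suc t) = (case p (run p X t) of
     Sample i \<Rightarrow> run p X t @ [(i, X (i, length (obs i (run p X t))))]
   | Stop i \<Rightarrow> run p X t)"
  by (simp add: Let_def obs_def split: action.split)

declare hist.simps(2) [simp del]

lemma hist_seed: "hist (\<lambda>_. p) s X t = run p X t"
  by (induction t) (auto simp: hist.simps(2) Let_def split: action.split)

lemma length_obs_run_mono: "length (obs i (run p X t)) \<le> length (obs i (run p X (Suc t)))"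
  by (auto simp: run_Suc split: action.split)

lemma run_cong:
  assumes "\<And>i j. j < length (obs i (run p X t)) \<Longrightarrow> Y (i, j) = X (i, j)"
  shows "run p Y t = run p X t"
  using assms
proof (induction t)
  case (Suc t)
  have "run p Y t = run p X t"
  proof (rule Suc.IH)
    fix i j assume "j < length (obs i (run p X t))"
    then have "j < length (obs i (run p X (Suc t)))"
      using length_obs_run_mono[of i p X t] by linarith
    then show "Y (i, j) = X (i, j)" by (rule Suc.prems)
  qed
  moreover have "Y (i, length (obs i (run p X t))) = X (i, length (obs i (run p X t)))"
    if "p (run p X t) = Sample i" for i
    by (rule Suc.prems) (simp add: run_Suc that)
  ultimately show ?case by (simp add: run_Suc split: action.split)
qed simp

text \<open>Splices past and future: row \<open>i\<close> keeps the \<open>c i\<close> cells already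
  read and then continues with \<open>Y\<close> from its first cell. The shift makes the
  continuation an ordinary run on \<open>Y\<close>.\<close>

definition graft :: "(nat \<Rightarrow> nat) \<Rightarrow> (nat \<times> nat \<Rightarrow> real) \<Rightarrow> (nat \<times> nat \<Rightarrow> real) \<Rightarrow> nat \<times> nat \<Rightarrow> real" where
  "graft c X Y = (\<lambda>(i, j). if j < c i then X (i, j) else Y (i, j - c i))"

lemma run_graft:
  assumes "h = run p X s"
  shows "run p (graft (\<lambda>i. length (obs i h)) X Y) (s + t) = h @ run (\<lambda>g. p (h @ g)) Y t"
proof (induction t)
  case 0
  have "run p (graft (\<lambda>i. length (obs i h)) X Y) s = run p X s"
    by (rule run_cong) (simp add: graft_def assms)
  then show ?case using assms by simp
next
  case (Suc t)
  then show ?case by (simp add: run_Suc graft_def split: action.split)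
qed

text \<open>Separates a history into a discrete part, the sequence of arms, and the values read. For
  a fixed sequence the history is a fixed selection of cells, and there are only countably many
  sequences.\<close>

definition hist_of :: "nat list \<Rightarrow> (nat \<times> nat \<Rightarrow> real) \<Rightarrow> (nat \<times> real) list" where
  "hist_of \<alpha> X = map (\<lambda>k. (\<alpha> ! k, X (\<alpha> ! k, length (filter (\<lambda>a. a = \<alpha> ! k) (take k \<alpha>))))) [0..<length \<alpha>]"

lemma hist_of_snoc:
  "hist_of (\<alpha> @ [i]) X = hist_of \<alpha> X @ [(i, X (i, length (filter (\<lambda>a. a = i) \<alpha>)))]"
  by (auto simp: hist_of_def nth_append)

lemma length_obs_fst: "length (obs i h) = length (filter (\<lambda>a. a = i) (map fst h))"
  by (induction h) (auto simp: obs_def)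

lemma run_eq_hist_of: "run p X t = hist_of (map fst (run p X t)) X"
proof (induction t)
  case (Suc t)
  then show ?case
    by (auto simp: run_Suc hist_of_snoc length_obs_fst split: action.split)
qed (simp add: hist_of_def)

text \<open>Histories carry no \<open>\<sigma>\<close>-algebra, so measurability of a function of histories is expressed
  with the sequence of sampled arms held fixed and only the observed values varying.\<close>

definition hist_measurable :: "'b measure \<Rightarrow> ((nat \<times> real) list \<Rightarrow> 'b) \<Rightarrow> bool" where
  "hist_measurable N F \<longleftrightarrow> (\<forall>(M :: (nat \<times> nat \<Rightarrow> real) measure) \<alpha> v.
     (\<forall>k. v k \<in> borel_measurable M) \<longrightarrow>
     (\<lambda>\<omega>. F (map (\<lambda>k. (\<alpha> ! k, v k \<omega>)) [0..<length \<alpha>])) \<in> M \<rightarrow>\<^sub>M N)"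

lemma hist_measurableD:
  fixes M :: "(nat \<times> nat \<Rightarrow> real) measure"
  assumes "hist_measurable N F" "\<And>k. v k \<in> borel_measurable M"
  shows "(\<lambda>\<omega>. F (map (\<lambda>k. (\<alpha> ! k, v k \<omega>)) [0..<length \<alpha>])) \<in> M \<rightarrow>\<^sub>M N"
  using assms unfolding hist_measurable_def by blast

context arms
begin

text \<open>Points of the product space are extensional, so cells of nonexistent arms are constantly
  \<open>undefined\<close>. Measurability of runs thus needs no proof that the policy picks legal
  arms.\<close>

lemma cell_measurable_all: "(\<lambda>X. X (i, j)) \<in> borel_measurable T"
proof (cases "i < n")
  case False
  then have "X (i, j) = undefined" if "X \<in> space T" for X
    using that by (auto simp: reward_table_def space_PiM PiE_iff extensional_def)
  then have "(\<lambda>X. X (i, j)) \<in> borel_measurable T \<longleftrightarrow> (\<lambda>X. undefined :: real) \<in> borel_measurable T"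
    by (intro measurable_cong) auto
  then show ?thesis by simp
qed (rule cell_measurable)

lemma hist_of_measurable:
  assumes "hist_measurable N F"
  shows "(\<lambda>X. F (hist_of \<alpha> X)) \<in> T \<rightarrow>\<^sub>M N"
  unfolding hist_of_def by (rule hist_measurableD[OF assms cell_measurable_all])

lemma run_measurable_aux:
  assumes "(\<lambda>X. map fst (run p X t)) \<in> T \<rightarrow>\<^sub>M count_space UNIV" "hist_measurable N F"
  shows "(\<lambda>X. F (run p X t)) \<in> T \<rightarrow>\<^sub>M N"
proof -
  have "(\<lambda>X. F (hist_of (map fst (run p X t)) X)) \<in> T \<rightarrow>\<^sub>M N"
    by (rule measurable_compose_countable[OF hist_of_measurable[OF assms(2)] assms(1)])
  then show ?thesis using run_eq_hist_of[of p _ t] by simp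
qed

lemma countable_action: "countable (UNIV :: action set)"
proof (rule countable_subset)
  show "UNIV \<subseteq> range Sample \<union> range Stop"
  proof
    fix a show "a \<in> range Sample \<union> range Stop" by (cases a) auto
  qed
qed auto

text \<open>Measurability of the arms up to time \<open>t\<close> gives that of every function of
  the history (split by arm sequence), in particular of the next action, hence of the arms up to
  \<open>Suc t\<close>.\<close>

lemma arms_measurable:
  assumes p: "hist_measurable (count_space UNIV) p"
  shows "(\<lambda>X. map fst (run p X t)) \<in> T \<rightarrow>\<^sub>M count_space UNIV"
proof (induction t)
  case (Suc t)
  have "(\<lambda>X. (\<lambda>a X. map fst (run p X t) @ (case a of Sample i \<Rightarrow> [i] | Stop i \<Rightarrow> [])) (p (run p X t)) X)
      \<in> T \<rightarrow>\<^sub>M count_space UNIV"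
  proof (rule measurable_compose_countable'[where I = UNIV and g = "\<lambda>X. p (run p X t)" and
      f = "\<lambda>a X. map fst (run p X t) @ (case a of Sample i \<Rightarrow> [i] | Stop i \<Rightarrow> [])"])
    show "(\<lambda>X. p (run p X t)) \<in> T \<rightarrow>\<^sub>M count_space UNIV" by (rule run_measurable_aux[OF Suc.IH p])
    show "(\<lambda>X. map fst (run p X t) @ (case a of Sample i \<Rightarrow> [i] | Stop i \<Rightarrow> [])) \<in> T \<rightarrow>\<^sub>M count_space UNIV" for a
      by (rule measurable_compose[OF Suc.IH]) simp
  qed (rule countable_action)
  moreover have "map fst (run p X (Suc t)) = map fst (run p X t) @ (case p (run p X t) of Sample i \<Rightarrow> [i] | Stop i \<Rightarrow> [])" for X
    by (auto simp: run_Suc split: action.split)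
  ultimately show ?case by simp
qed simp

lemma run_measurable:
  assumes "hist_measurable (count_space UNIV) p" "hist_measurable N F"
  shows "(\<lambda>X. F (run p X t)) \<in> T \<rightarrow>\<^sub>M N"
  by (rule run_measurable_aux[OF arms_measurable]) fact+

section \<open>Grafting preserves the product measure; the Markov property\<close>

lemma graft_measurable: "(\<lambda>(X, Y). graft c X Y) \<in> T \<Otimes>\<^sub>M T \<rightarrow>\<^sub>M T"
proof -
  have "(\<lambda>w. \<lambda>q\<in>{..<n} \<times> UNIV. graft c (fst w) (snd w) q) \<in> T \<Otimes>\<^sub>M T \<rightarrow>\<^sub>M (\<Pi>\<^sub>M q\<in>{..<n} \<times> UNIV. D (fst q))"
  proof (rule measurable_restrict)
    fix q :: "nat \<times> nat" assume "q \<in> {..<n} \<times> UNIV"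
    then obtain i j where q: "q = (i, j)" "i < n" by (cases q) auto
    have "(\<lambda>w. (fst w) (i, j)) \<in> T \<Otimes>\<^sub>M T \<rightarrow>\<^sub>M D i" "(\<lambda>w. (snd w) (i, j - c i)) \<in> T \<Otimes>\<^sub>M T \<rightarrow>\<^sub>M D i"
      using cell_measurable_arm[OF q(2)] by (auto intro: measurable_compose[OF measurable_fst] measurable_compose[OF measurable_snd])
    then show "(\<lambda>w. graft c (fst w) (snd w) q) \<in> T \<Otimes>\<^sub>M T \<rightarrow>\<^sub>M D (fst q)"
      by (cases "j < c i") (auto simp: graft_def q)
  qed
  then have "(\<lambda>w. \<lambda>q\<in>{..<n} \<times> UNIV. graft c (fst w) (snd w) q) \<in> T \<Otimes>\<^sub>M T \<rightarrow>\<^sub>M T"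
    unfolding reward_table_def .
  also have "?this \<longleftrightarrow> ?thesis"
  proof (rule measurable_cong)
    fix w assume "w \<in> space (T \<Otimes>\<^sub>M T)"
    then have "fst w \<in> extensional ({..<n} \<times> UNIV)" "snd w \<in> extensional ({..<n} \<times> UNIV)"
      by (auto simp: space_pair_measure reward_table_def space_PiM PiE_iff)
    then show "(\<lambda>q\<in>{..<n} \<times> UNIV. graft c (fst w) (snd w) q) = (case w of (X, Y) \<Rightarrow> graft c X Y)"
      by (auto simp: fun_eq_iff graft_def split_beta extensional_def)
  qed
  finally show ?thesis .
qed

text \<open>A cylinder over J pulls back to a product of a cylinder in X, over the cells below
  \<open>c\<close>, and a cylinder in Y, over the shifted other cells. The shift is injective, so no
  cell of Y is used twice and the two measures multiply to the original product. The counts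
  \<open>c\<close> are constants here; \<open>markov_run\<close> deals with random ones.\<close>

lemma distr_graft: "distr (T \<Otimes>\<^sub>M T) T (\<lambda>(X, Y). graft c X Y) = T"
proof -
  let ?I = "{..<n} \<times> (UNIV :: nat set)"
  let ?D = "\<lambda>q. D (fst q)"
  have pr: "prob_space (?D q)" if "q \<in> ?I" for q using that arm_prob by auto
  have "T = distr (T \<Otimes>\<^sub>M T) T (\<lambda>(X, Y). graft c X Y)"
  proof (rule measure_eqI_PiM_infinite[of _ ?I ?D])
    show "sets T = sets (Pi\<^sub>M ?I ?D)" by (simp add: reward_table_def)
    show "sets (distr (T \<Otimes>\<^sub>M T) T (\<lambda>(X, Y). graft c X Y)) = sets (Pi\<^sub>M ?I ?D)"
      by (simp add: reward_table_def)
    show "finite_measure T" by unfold_locales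
    fix A :: "nat \<times> nat \<Rightarrow> real set" and J :: "(nat \<times> nat) set"
    assume J: "finite J" "J \<subseteq> ?I" and AJ: "\<And>q. q \<in> J \<Longrightarrow> A q \<in> sets (?D q)"
    define J1 where "J1 = {q \<in> J. snd q < c (fst q)}"
    define J2 where "J2 = {q \<in> J. \<not> snd q < c (fst q)}"
    define f where "f = (\<lambda>q :: nat \<times> nat. (fst q, snd q - c (fst q)))"
    define g where "g = (\<lambda>q :: nat \<times> nat. (fst q, snd q + c (fst q)))"
    have fst_f: "fst (f q) = fst q" for q by (simp add: f_def)
    have gf: "q \<in> J2 \<Longrightarrow> g (f q) = q" for q by (auto simp: g_def f_def J2_def)
    have inj: "inj_on f J2" by (rule inj_on_inverseI[of _ g]) (rule gf)
    have sub: "J1 \<subseteq> ?I" "f ` J2 \<subseteq> ?I" "finite J1" "finite (f ` J2)"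
      using J by (auto simp: J1_def J2_def f_def)
    define A1 where "A1 = prod_emb ?I ?D J1 (Pi\<^sub>E J1 A)"
    define A2 where "A2 = prod_emb ?I ?D (f ` J2) (Pi\<^sub>E (f ` J2) (\<lambda>q. A (g q)))"
    have A2g: "q \<in> f ` J2 \<Longrightarrow> A (g q) \<in> sets (?D q)" for q
      using AJ gf fst_f by (metis (no_types, lifting) J2_def imageE mem_Collect_eq)
    have A1s: "A1 \<in> sets T" unfolding A1_def reward_table_def
      using sub AJ by (intro sets_PiM_I) (auto simp: J1_def)
    have A2s: "A2 \<in> sets T" unfolding A2_def reward_table_def
      using sub A2g by (intro sets_PiM_I) auto
    have "emeasure T A1 = (\<Prod>q\<in>J1. emeasure (?D q) (A q))"
      unfolding A1_def reward_table_def using sub AJ by (intro emeasure_PiM_emb pr) (auto simp: J1_def)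
    moreover have "emeasure T A2 = (\<Prod>q\<in>f ` J2. emeasure (?D q) (A (g q)))"
      unfolding A2_def reward_table_def using sub A2g by (intro emeasure_PiM_emb pr) auto
    moreover have "\<dots> = (\<Prod>q\<in>J2. emeasure (?D q) (A q))"
      unfolding prod.reindex[OF inj] comp_def by (rule prod.cong) (simp_all add: gf fst_f)
    moreover have "(\<Prod>q\<in>J. emeasure (?D q) (A q)) = (\<Prod>q\<in>J1. emeasure (?D q) (A q)) * (\<Prod>q\<in>J2. emeasure (?D q) (A q))"
    proof -
      have eq: "J = J1 \<union> J2" and disj: "J1 \<inter> J2 = {}" and fin: "finite J1" "finite J2"
        using J(1) by (auto simp: J1_def J2_def)
      show ?thesis unfolding eq by (rule prod.union_disjoint[OF fin disj])
    qed
    moreover have "emeasure T (prod_emb ?I ?D J (Pi\<^sub>E J A)) = (\<Prod>q\<in>J. emeasure (?D q) (A q))"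
      unfolding reward_table_def using J AJ by (intro emeasure_PiM_emb pr) auto
    moreover have "emeasure (distr (T \<Otimes>\<^sub>M T) T (\<lambda>(X, Y). graft c X Y)) (prod_emb ?I ?D J (Pi\<^sub>E J A))
      = emeasure (T \<Otimes>\<^sub>M T) (A1 \<times> A2)"
    proof (subst emeasure_distr[OF graft_measurable])
      show "prod_emb ?I ?D J (Pi\<^sub>E J A) \<in> sets T"
        unfolding reward_table_def using J AJ by (intro sets_PiM_I) auto
      have "w \<in> (\<lambda>(X, Y). graft c X Y) -` prod_emb ?I ?D J (Pi\<^sub>E J A) \<inter> space (T \<Otimes>\<^sub>M T) \<longleftrightarrow> w \<in> A1 \<times> A2" for w
      proof -
        obtain X Y where w: "w = (X, Y)" by (cases w)
        have sp: "Z \<in> space T \<longleftrightarrow> Z \<in> (\<Pi>\<^sub>E q\<in>?I. space (?D q))" for Z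
          by (simp add: reward_table_def space_PiM)
        have emb: "Z \<in> prod_emb ?I ?D K (Pi\<^sub>E K B) \<longleftrightarrow> Z \<in> space T \<and> (\<forall>q\<in>K. Z q \<in> B q)"
          if "K \<subseteq> ?I" for Z K B
          using that by (auto simp: prod_emb_def sp)
        have spl: "graft c X Y \<in> space T" if "X \<in> space T" "Y \<in> space T"
          using measurable_space[OF graft_measurable[of c], of "(X, Y)"] that
          by (simp add: space_pair_measure)
        have "(\<forall>q\<in>J. graft c X Y q \<in> A q) \<longleftrightarrow> (\<forall>q\<in>J1. X q \<in> A q) \<and> (\<forall>q\<in>J2. Y (f q) \<in> A q)"
          by (auto simp: J1_def J2_def graft_def f_def split: if_splits)
        moreover have "(\<forall>q\<in>J2. Y (f q) \<in> A q) \<longleftrightarrow> (\<forall>q\<in>f ` J2. Y q \<in> A (g q))"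
          by (auto simp: gf)
        ultimately show ?thesis
          unfolding w A1_def A2_def using emb[OF J(2)] emb[OF sub(1)] emb[OF sub(2)] spl
          by (auto simp: space_pair_measure)
      qed
      then show "emeasure (T \<Otimes>\<^sub>M T) ((\<lambda>(X, Y). graft c X Y) -` prod_emb ?I ?D J (Pi\<^sub>E J A) \<inter> space (T \<Otimes>\<^sub>M T))
        = emeasure (T \<Otimes>\<^sub>M T) (A1 \<times> A2)" by (intro arg_cong[where f = "emeasure (T \<Otimes>\<^sub>M T)"]) blast
    qed
    moreover have "emeasure (T \<Otimes>\<^sub>M T) (A1 \<times> A2) = emeasure T A1 * emeasure T A2"
      by (rule P.emeasure_pair_measure_Times[OF A1s A2s])
    ultimately show "emeasure T (prod_emb ?I ?D J (Pi\<^sub>E J A))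
        = emeasure (distr (T \<Otimes>\<^sub>M T) T (\<lambda>(X, Y). graft c X Y)) (prod_emb ?I ?D J (Pi\<^sub>E J A))"
      by simp
  qed
  then show ?thesis by simp
qed

text \<open>Fix the sequence \<alpha> of arms sampled up to time \<open>s\<close>; then the counts
  are constants, and by \<open>distr_graft\<close> the cells beyond them may be replaced by a fresh
  table Y. The event \<open>A\<close> depends on X alone, and for fixed X the future is a run on Y,
  to which the bound applies by Fubini. Summing over \<alpha> restores the full event.\<close>

lemma markov_run:
  assumes p: "hist_measurable (count_space UNIV) p"
    and G: "hist_measurable (count_space UNIV) G" and R: "hist_measurable (count_space UNIV) R"
    and q: "0 \<le> q"
    and bound: "\<And>h. G h \<Longrightarrow> length h \<le> s \<Longrightarrow> P.prob {Y \<in> space T. R (h @ run (\<lambda>g. p (h @ g)) Y t)} \<le> q"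
  shows "P.prob {X \<in> space T. G (run p X s) \<and> R (run p X (s + t))} \<le> q * P.prob {X \<in> space T. G (run p X s)}"
proof -
  define A where "A \<alpha> = {X \<in> space T. map fst (run p X s) = \<alpha> \<and> G (run p X s)}" for \<alpha>
  define B where "B \<alpha> = {X \<in> space T. map fst (run p X s) = \<alpha> \<and> G (run p X s) \<and> R (run p X (s + t))}" for \<alpha>
  note [measurable] = arms_measurable[OF p] run_measurable[OF p G] run_measurable[OF p R]
  have As [measurable]: "A \<alpha> \<in> sets T" for \<alpha> unfolding A_def by measurable
  have Bs [measurable]: "B \<alpha> \<in> sets T" for \<alpha> unfolding B_def by measurable
  have len: "length (run p X s) \<le> s" for X
    by (induction s) (auto simp: run_Suc split: action.split)
  have "emeasure T (B \<alpha>) \<le> ennreal q * emeasure T (A \<alpha>)" for \<alpha>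
  proof -
    define c where "c i = length (filter (\<lambda>a. a = i) \<alpha>)" for i
    have "emeasure T (B \<alpha>) = emeasure (distr (T \<Otimes>\<^sub>M T) T (\<lambda>(X, Y). graft c X Y)) (B \<alpha>)"
      by (simp add: distr_graft)
    also have "\<dots> = emeasure (T \<Otimes>\<^sub>M T) ((\<lambda>(X, Y). graft c X Y) -` B \<alpha> \<inter> space (T \<Otimes>\<^sub>M T))"
      by (rule emeasure_distr[OF graft_measurable Bs])
    also have "\<dots> = (\<integral>\<^sup>+X. emeasure T (Pair X -` ((\<lambda>(X, Y). graft c X Y) -` B \<alpha> \<inter> space (T \<Otimes>\<^sub>M T))) \<partial>T)"
      by (rule P.emeasure_pair_measure_alt) (rule measurable_sets[OF graft_measurable Bs])
    also have "\<dots> \<le> (\<integral>\<^sup>+X. ennreal q * indicator (A \<alpha>) X \<partial>T)"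
    proof (rule nn_integral_mono)
      fix X assume X: "X \<in> space T"
      define h where "h = run p X s"
      define S where "S = Pair X -` ((\<lambda>(X, Y). graft c X Y) -` B \<alpha> \<inter> space (T \<Otimes>\<^sub>M T))"
      have S: "X \<in> A \<alpha> \<and> R (h @ run (\<lambda>g. p (h @ g)) Y t) \<and> Y \<in> space T" if "Y \<in> S" for Y
      proof -
        have Y: "Y \<in> space T" "graft c X Y \<in> B \<alpha>"
          using that X unfolding S_def by (auto simp: space_pair_measure)
        have cs: "length (obs i (run p (graft c X Y) s)) = c i" for i
          using Y(2) unfolding B_def c_def length_obs_fst by auto
        \<comment> \<open>On the grafted table the counts at time \<open>s\<close> are
          \<open>c\<close>, so that run has read only cells copied from X and coincides with the run
          on X.\<close>
        have eq: "run p X s = run p (graft c X Y) s"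
          by (rule run_cong) (simp add: cs, simp add: graft_def)
        have ch: "c = (\<lambda>i. length (obs i h))" unfolding h_def eq using cs by auto
        have "run p (graft c X Y) (s + t) = h @ run (\<lambda>g. p (h @ g)) Y t"
          unfolding ch by (rule run_graft) (simp add: h_def)
        then show ?thesis using X Y eq unfolding A_def B_def by auto
      qed
      show "emeasure T S \<le> ennreal q * indicator (A \<alpha>) X"
      proof (cases "X \<in> A \<alpha>")
        case False
        then have "S = {}" using S by blast
        then show ?thesis by simp
      next
        case True
        let ?R = "{Y \<in> space T. R (h @ run (\<lambda>g. p (h @ g)) Y t)}"
        have "?R = {Y \<in> space T. R (run p (graft (\<lambda>i. length (obs i h)) X Y) (s + t))}"
          using run_graft[of h p X s] by (simp add: h_def)
        moreover have "(\<lambda>Y. graft (\<lambda>i. length (obs i h)) X Y) \<in> T \<rightarrow>\<^sub>M T"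
          using measurable_compose[OF measurable_Pair1'[OF X] graft_measurable] by simp
        ultimately have Rs: "?R \<in> sets T"
          by simp
        have "emeasure T S \<le> emeasure T ?R"
          using S Rs by (intro emeasure_mono) auto
        also have "\<dots> \<le> ennreal q"
          unfolding P.emeasure_eq_measure using True len by (intro ennreal_leI bound) (auto simp: A_def h_def)
        finally show ?thesis using True by simp
      qed
    qed
    also have "\<dots> = ennreal q * emeasure T (A \<alpha>)"
      by (simp add: nn_integral_cmult_indicator)
    finally show ?thesis .
  qed
  \<comment> \<open>The slices are disjoint and indexed by the countable type of lists over nat, so
    integration against the counting measure reassembles both events.\<close>
  then have "(\<integral>\<^sup>+\<alpha>. emeasure T (B \<alpha>) \<partial>count_space UNIV) \<le> (\<integral>\<^sup>+\<alpha>. ennreal q * emeasure T (A \<alpha>) \<partial>count_space UNIV)"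
    by (intro nn_integral_mono) auto
  also have "\<dots> = ennreal q * (\<integral>\<^sup>+\<alpha>. emeasure T (A \<alpha>) \<partial>count_space UNIV)"
    by (rule nn_integral_cmult) simp
  also have "(\<integral>\<^sup>+\<alpha>. emeasure T (A \<alpha>) \<partial>count_space UNIV) = emeasure T (\<Union>\<alpha>. A \<alpha>)"
    by (rule emeasure_UN_countable[symmetric]) (auto simp: disjoint_family_on_def A_def)
  also have "(\<Union>\<alpha>. A \<alpha>) = {X \<in> space T. G (run p X s)}" by (auto simp: A_def)
  also have "(\<integral>\<^sup>+\<alpha>. emeasure T (B \<alpha>) \<partial>count_space UNIV) = emeasure T (\<Union>\<alpha>. B \<alpha>)"
    by (rule emeasure_UN_countable[symmetric]) (auto simp: disjoint_family_on_def B_def)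
  also have "(\<Union>\<alpha>. B \<alpha>) = {X \<in> space T. G (run p X s) \<and> R (run p X (s + t))}" by (auto simp: B_def)
  finally show ?thesis
    using q by (simp add: P.emeasure_eq_measure ennreal_mult[symmetric])
qed

end

section \<open>Expected number of samples of a suboptimal arm\<close>

text \<open>Turns 2^j * exp (- 2^j / c) into at most c^2 / 2^j, so that the resolved scales form a
  convergent geometric series.\<close>

lemma square_le_exp:
  fixes x :: real
  assumes "0 \<le> x"
  shows "x\<^sup>2 \<le> exp x"
proof -
  have "x \<le> (1 + x / 4)\<^sup>2" using zero_le_power2[of "1 - x / 4"] by (simp add: power2_eq_square algebra_simps)
  also have "\<dots> \<le> (exp (x / 4))\<^sup>2" using assms exp_ge_add_one_self[of "x / 4"] by (intro power_mono) auto
  also have "\<dots> = exp (x / 2)" by (simp add: exp_double[symmetric] power2_eq_square exp_add[symmetric])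
  finally have "x\<^sup>2 \<le> (exp (x / 2))\<^sup>2" using assms by (intro power_mono) auto
  then show ?thesis by (simp add: power2_eq_square exp_add[symmetric])
qed

text \<open>S is an arbitrary finite set: the resolved and the unresolved scales are not shown to be
  intervals. The largest member, and in the next lemma the smallest, dominates the sum.\<close>

lemma sum_powers_below:
  fixes y :: real
  assumes "finite S" "\<And>j. j \<in> S \<Longrightarrow> 2 ^ j \<le> y" "0 \<le> y"
  shows "(\<Sum>j\<in>S. (2::real) ^ j) \<le> 2 * y"
proof (cases "S = {}")
  case False
  define k where "k = Max S"
  have k: "k \<in> S" "S \<subseteq> {..k}" unfolding k_def using assms(1) False by auto
  have "(\<Sum>j\<in>S. (2::real) ^ j) \<le> (\<Sum>j\<le>k. 2 ^ j)" using k(2) by (intro sum_mono2) auto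
  also have "\<dots> = 2 ^ Suc k - 1" by (induction k) auto
  also have "\<dots> \<le> 2 * y" using assms(2)[OF k(1)] by simp
  finally show ?thesis .
qed (use assms in auto)

lemma sum_inverse_powers_above:
  fixes y :: real
  assumes "finite S" "\<And>j. j \<in> S \<Longrightarrow> y \<le> 2 ^ j" "0 < y"
  shows "(\<Sum>j\<in>S. 1 / (2::real) ^ j) \<le> 2 / y"
proof (cases "S = {}")
  case False
  define k where "k = Min S"
  define l where "l = Max S"
  have k: "k \<in> S" "S \<subseteq> {k..l}" unfolding k_def l_def using assms(1) False by auto
  have geo: "(\<Sum>j = k..l. 1 / (2::real) ^ j) \<le> 2 / 2 ^ k"
  proof (cases "k \<le> l")
    case True
    then have "(\<Sum>j = k..l. 1 / (2::real) ^ j) = 2 / 2 ^ k - 1 / 2 ^ l"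
    proof (induction rule: dec_induct)
      case (step m)
      have "(\<Sum>j = k..Suc m. 1 / (2::real) ^ j) = 2 / 2 ^ k - 1 / 2 ^ m + 1 / 2 ^ Suc m"
        using step by simp
      also have "\<dots> = 2 / 2 ^ k - 1 / 2 ^ Suc m" by simp
      finally show ?case .
    qed simp
    then show ?thesis by simp
  qed simp
  have "(\<Sum>j\<in>S. 1 / (2::real) ^ j) \<le> (\<Sum>j = k..l. 1 / 2 ^ j)" using k(2) by (intro sum_mono2) auto
  also note geo
  also have "2 / 2 ^ k \<le> 2 / y" using assms(2)[OF k(1)] assms(3) by (intro divide_left_mono) auto
  finally show ?thesis .
qed (use assms in auto)

lemma LL_ge_1: "1 \<le> x \<Longrightarrow> 1 \<le> LL x"
proof -
  assume "1 \<le> x"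
  then have "exp 1 \<le> exp 1 + ln x" by simp
  then have "ln (exp 1) \<le> ln (exp 1 + ln x)" using exp_gt_zero[of "1::real"] by (subst ln_le_cancel_iff) (auto intro: add_pos_nonneg)
  then show ?thesis by (simp add: LL_def)
qed

lemma two_le_exp_1: "(2::real) \<le> exp 1"
  using exp_ge_add_one_self[of 1] by simp

text \<open>The hypothesis is implicit in j: it forces j to be logarithmic in 1 / \<Delta>, so the
  logarithm of j is doubly logarithmic. The constant 2^60 is a common upper bound for the constants
  of both applications.\<close>

lemma ln_index_le_LL:
  fixes \<Delta> :: real
  assumes \<Delta>: "0 < \<Delta>" "\<Delta> \<le> 1" and le: "2 ^ j \<le> (2 ^ 60 / \<Delta>\<^sup>2) * ln (real j + 2)"
  shows "ln (real j + 2) \<le> 8 * LL (1 / \<Delta>)"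
proof -
  define A where "A = 2 ^ 60 / \<Delta>\<^sup>2"
  define y where "y = ln (1 / \<Delta>)"
  have y0: "0 \<le> y" unfolding y_def using \<Delta> by simp
  have A0: "0 < A" using \<Delta> by (simp add: A_def)
  have lnsq: "(ln (real j + 2))\<^sup>2 \<le> 8 * 2 ^ j"
  proof -
    have "ln (sqrt (real j + 2)) \<le> sqrt (real j + 2) - 1" by (intro ln_le_minus_one) auto
    then have "ln (real j + 2) \<le> 2 * sqrt (real j + 2)" by (simp add: ln_sqrt)
    then have "(ln (real j + 2))\<^sup>2 \<le> (2 * sqrt (real j + 2))\<^sup>2" by (intro power_mono) auto
    also have "\<dots> = 4 * (real j + 2)" by (simp add: power_mult_distrib)
    also have "real j + 2 \<le> 2 * 2 ^ j"
    proof (induction j)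
      case (Suc j)
      have "(1::real) \<le> 2 ^ j" by simp
      with Suc show ?case by simp
    qed simp
    finally show ?thesis by simp
  qed
  \<comment> \<open>Squaring and bounding the squared logarithm by 8 * 2^j cancels one factor 2^j
    and makes the inequality explicit.\<close>
  have "(2 ^ j)\<^sup>2 \<le> (A * ln (real j + 2))\<^sup>2" using le unfolding A_def by (intro power_mono) auto
  also have "\<dots> \<le> A\<^sup>2 * (8 * 2 ^ j)" unfolding power_mult_distrib using lnsq by (intro mult_left_mono) auto
  finally have "2 ^ j \<le> 8 * A\<^sup>2" by (simp add: power2_eq_square)
  then have "ln (2 ^ j) \<le> ln (8 * A\<^sup>2)" by (intro ln_mono) auto
  also have "ln (8 * A\<^sup>2) = ln 8 + 2 * ln A" using A0 by (simp add: ln_mult ln_realpow)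
  also have "ln A = 60 * ln 2 + 2 * y"
  proof -
    have "ln A = ln (2 ^ 60) - ln (\<Delta>\<^sup>2)" unfolding A_def using \<Delta> by (subst ln_div) auto
    moreover have "ln ((2::real) ^ 60) = 60 * ln 2" by (metis ln_realpow of_nat_numeral zero_less_numeral)
    moreover have "ln (\<Delta>\<^sup>2) = - (2 * y)" unfolding y_def using \<Delta> by (simp add: ln_realpow ln_div)
    ultimately show ?thesis by simp
  qed
  also have "ln (8::real) = 3 * ln 2" using ln_realpow[of "2::real" 3] by simp
  finally have "real j * ln 2 \<le> 123 * ln 2 + 4 * y" by (simp add: ln_realpow)
  then have "(real j - 123) * ln 2 \<le> 4 * y" by (simp add: algebra_simps)
  moreover have "(real j - 123) * (1/2) \<le> (real j - 123) * ln 2" if "123 \<le> real j"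
    using ln2_ge_two_thirds that by (intro mult_left_mono) auto
  ultimately have "(real j - 123) * (1/2) \<le> 4 * y \<or> real j < 123" by linarith
  then have j: "real j + 2 \<le> 125 + 8 * y" using y0 by auto
  \<comment> \<open>A bound linear in y is weakened to the eighth power of exp 1 + y, whose
    logarithm is 8 * LL (1 / \<Delta>).\<close>
  have "exp 1 + y \<ge> 2 + y" using two_le_exp_1 by simp
  then have "(2 + y) ^ 8 \<le> (exp 1 + y) ^ 8" using y0 by (intro power_mono) auto
  moreover have "125 + 8 * y \<le> (2 + y) ^ 8"
  proof -
    have "(2 + y) ^ 8 = (2 + y) ^ 7 * (2 + y)" by (simp add: eval_nat_numeral)
    also have "\<dots> \<ge> 2 ^ 7 * (2 + y)" using y0 by (intro mult_right_mono power_mono) auto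
    finally show ?thesis using y0 by simp
  qed
  ultimately have "real j + 2 \<le> (exp 1 + y) ^ 8" using j by linarith
  then have "ln (real j + 2) \<le> ln ((exp 1 + y) ^ 8)" by (intro ln_mono) auto
  also have "\<dots> = 8 * ln (exp 1 + y)" using y0 by (subst ln_realpow) (auto intro: add_pos_nonneg)
  finally show ?thesis unfolding LL_def y_def .
qed

lemma lev_le: "0 < \<eta> \<Longrightarrow> lev \<eta> j \<le> ln (1 / \<eta>) + 3 * ln (real j + 2)"
proof -
  assume \<eta>: "0 < \<eta>"
  have "lev \<eta> j = 2 * ln (real j + 1) + ln (real j + 2) + ln (1 / \<eta>)"
    unfolding lev_def using \<eta> by (simp add: ln_div ln_mult ln_realpow)
  moreover have "ln (real j + 1) \<le> ln (real j + 2)" by simp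
  ultimately show ?thesis by linarith
qed

lemma ln_inverse_ge_1: "0 < (\<eta> :: real) \<Longrightarrow> \<eta> \<le> 1/16 \<Longrightarrow> 1 \<le> ln (1 / \<eta>)"
proof -
  assume \<eta>: "0 < \<eta>" "\<eta> \<le> 1/16"
  have "exp 1 \<le> (3::real)" by (rule exp_le)
  also have "3 \<le> 1 / \<eta>" using \<eta> by (simp add: field_simps)
  finally show ?thesis using \<eta> by (subst ln_ge_iff) auto
qed

lemma lev_ge_1:
  assumes "0 < \<eta>" "\<eta> \<le> 1/16"
  shows "1 \<le> lev \<eta> j"
proof -
  have "1 * 1 \<le> (real j + 1)\<^sup>2 * (real j + 2)" by (intro mult_mono) auto
  then have "ln (1 / \<eta>) \<le> lev \<eta> j"
    unfolding lev_def using assms by (intro ln_mono divide_right_mono) auto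
  then show ?thesis using ln_inverse_ge_1[OF assms] by linarith
qed

text \<open>Removes j from the right-hand side by comparing the two parts of \<open>lev\<close>. If
  the confidence part dominates, doubling it is enough; otherwise \<open>ln_index_le_LL\<close>
  applies, and 48 = 6 * 8.\<close>

lemma unresolved_scale_le:
  fixes \<Delta> N :: real
  assumes \<Delta>: "0 < \<Delta>" "\<Delta> \<le> 1" and N: "1 \<le> N" "N \<le> 2 / \<Delta>\<^sup>2" and \<eta>: "0 < \<eta>" "\<eta> \<le> 1/16"
    and lt: "2 ^ j < 8192 * N * lev \<eta> j"
  shows "2 ^ j \<le> 8192 * N * (2 * ln (1 / \<eta>) + 48 * LL (1 / \<Delta>))"
proof -
  have L: "1 \<le> ln (1 / \<eta>)" by (rule ln_inverse_ge_1[OF \<eta>])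
  have LL1: "1 \<le> LL (1 / \<Delta>)" using \<Delta> by (intro LL_ge_1) auto
  have "8192 * N * lev \<eta> j \<le> 8192 * N * (ln (1 / \<eta>) + 3 * ln (real j + 2))"
    using N lev_le[OF \<eta>(1)] by (intro mult_left_mono) auto
  with lt have 1: "2 ^ j \<le> 8192 * N * (ln (1 / \<eta>) + 3 * ln (real j + 2))" by linarith
  show ?thesis
  proof (cases "3 * ln (real j + 2) \<le> ln (1 / \<eta>)")
    case True
    then have "8192 * N * (ln (1 / \<eta>) + 3 * ln (real j + 2)) \<le> 8192 * N * (2 * ln (1 / \<eta>) + 48 * LL (1 / \<Delta>))"
      using N LL1 by (intro mult_left_mono) auto
    with 1 show ?thesis by linarith
  next
    case False
    then have "8192 * N * (ln (1 / \<eta>) + 3 * ln (real j + 2)) \<le> 8192 * N * (6 * ln (real j + 2))"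
      using N by (intro mult_left_mono) auto
    with 1 have 2: "2 ^ j \<le> 8192 * N * (6 * ln (real j + 2))" by linarith
    also have "\<dots> \<le> 8192 * (2 / \<Delta>\<^sup>2) * (6 * ln (real j + 2))"
      using N by (intro mult_right_mono mult_left_mono) auto
    also have "\<dots> = (98304 / \<Delta>\<^sup>2) * ln (real j + 2)" by simp
    also have "\<dots> \<le> (2 ^ 60 / \<Delta>\<^sup>2) * ln (real j + 2)"
      by (intro mult_right_mono divide_right_mono) auto
    finally have "ln (real j + 2) \<le> 8 * LL (1 / \<Delta>)" by (rule ln_index_le_LL[OF \<Delta>])
    then have "8192 * N * (6 * ln (real j + 2)) \<le> 8192 * N * (2 * ln (1 / \<eta>) + 48 * LL (1 / \<Delta>))"
      using N L by (intro mult_left_mono) auto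
    with 2 show ?thesis by linarith
  qed
qed

text \<open>Contrapositive of \<open>unresolved_scale_le\<close> at the scale of t; passing from
  2^floor_log t to t costs a factor 2.\<close>

lemma resolved_threshold:
  fixes \<Delta> N :: real
  assumes \<Delta>: "0 < \<Delta>" "\<Delta> \<le> 1" and N: "1 \<le> N" "N \<le> 2 / \<Delta>\<^sup>2" and \<eta>: "0 < \<eta>" "\<eta> \<le> 1/16"
    and t: "0 < t" "2 ^ 20 * (N * (ln (1 / \<eta>) + LL (1 / \<Delta>))) \<le> real t"
  shows "8192 * N * lev \<eta> (floor_log t) \<le> real t"
proof (rule ccontr)
  assume neg: "\<not> ?thesis"
  define L where "L = ln (1 / \<eta>)"
  define L' where "L' = LL (1 / \<Delta>)"
  have "2 ^ floor_log t \<le> t" using floor_log_exp2_le t by auto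
  then have "2 ^ floor_log t \<le> real t" using of_nat_le_iff[of "2 ^ floor_log t" t, where 'a = real] by simp
  with neg have "2 ^ floor_log t < 8192 * N * lev \<eta> (floor_log t)" by linarith
  from unresolved_scale_le[OF \<Delta> N \<eta> this] have "2 ^ floor_log t \<le> 8192 * N * (2 * L + 48 * L')"
    unfolding L_def L'_def .
  moreover have "real t < 2 * 2 ^ floor_log t"
    using floor_log_exp2_gt[of t, THEN of_nat_less_iff[THEN iffD2]] by simp
  moreover have "2 * (8192 * N * (2 * L + 48 * L')) \<le> 2 ^ 20 * (N * (L + L'))"
  proof -
    have "1 \<le> L" unfolding L_def by (rule ln_inverse_ge_1[OF \<eta>])
    moreover have "1 \<le> L'" unfolding L'_def using \<Delta> by (intro LL_ge_1) auto
    ultimately have "0 \<le> N * L" "0 \<le> N * L'" using N by auto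
    then show ?thesis by (simp add: algebra_simps)
  qed
  ultimately show False using t(2) unfolding L_def L'_def by linarith
qed

section \<open>Instances with their best arm; loads of the other arms\<close>

locale best_arm = arms +
  fixes b :: nat
  assumes two_arms: "2 \<le> n" and b: "b < n"
    and best: "i < n \<Longrightarrow> i \<noteq> b \<Longrightarrow> arm_mean (D i) < arm_mean (D b)"
begin

abbreviation "\<Delta> i \<equiv> gap n D b i"

definition H :: "nat \<Rightarrow> real" where
  "H i = v i / (\<Delta> i)\<^sup>2 + 1 / \<Delta> i"

lemma gap_other: "i \<noteq> b \<Longrightarrow> \<Delta> i = \<theta> b - \<theta> i"
  by (simp add: gap_def)

lemma gap_best_in: "\<Delta> b \<in> {\<theta> b - \<theta> j | j. j < n \<and> j \<noteq> b}"
proof -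
  let ?S = "{\<theta> b - \<theta> j | j. j < n \<and> j \<noteq> b}"
  have "(if b = 0 then 1 else 0) < n \<and> (if b = 0 then 1 else 0) \<noteq> b" using two_arms by auto
  then have "?S \<noteq> {}" by blast
  moreover have "finite ?S" by simp
  ultimately have "Min ?S \<in> ?S" by (rule Min_in[rotated])
  moreover have "\<Delta> b = Min ?S" by (simp add: gap_def)
  ultimately show ?thesis by (simp only:)
qed

lemma gap_best_le: "i < n \<Longrightarrow> \<Delta> b \<le> \<Delta> i"
  by (cases "i = b") (auto simp: gap_def intro!: Min_le)

lemma gap_bounds:
  assumes "i < n"
  shows "0 < \<Delta> i" "\<Delta> i \<le> 1"
proof -
  have "\<exists>j<n. j \<noteq> b \<and> \<Delta> i = \<theta> b - \<theta> j"
    using gap_best_in gap_other[of i] assms by (cases "i = b") auto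
  then show "0 < \<Delta> i" "\<Delta> i \<le> 1"
    using best arm_mean_bounds b by (auto, smt (verit))
qed

lemma H_bounds:
  assumes "i < n"
  shows "1 \<le> H i" "H i \<le> 2 / (\<Delta> i)\<^sup>2"
proof -
  note g = gap_bounds[OF assms] and v = arm_var_bounds[OF assms]
  have "1 \<le> 1 / \<Delta> i" using g by simp
  moreover have "0 \<le> v i / (\<Delta> i)\<^sup>2" using v by simp
  ultimately show "1 \<le> H i" unfolding H_def by linarith
  have "v i / (\<Delta> i)\<^sup>2 \<le> 1 / (\<Delta> i)\<^sup>2" using v by (intro divide_right_mono) auto
  moreover have "1 / \<Delta> i \<le> 1 / (\<Delta> i)\<^sup>2" using g by (simp add: field_simps power2_eq_square)
  ultimately show "H i \<le> 2 / (\<Delta> i)\<^sup>2" unfolding H_def by simp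
qed

text \<open>Half the gap is the level that serves both phases: a sampled suboptimal arm must have an
  upper bound at least that high. The event mentions row \<open>i\<close> only, not the
  policy.\<close>

definition Bad :: "real \<Rightarrow> nat \<Rightarrow> nat \<Rightarrow> (nat \<times> nat \<Rightarrow> real) set" where
  "Bad \<eta> i j = {X \<in> space T. \<Delta> i / 2 \<le> smean (draws i (2 ^ j) X) - \<theta> i + rad \<eta> (draws i (2 ^ j) X)}"

text \<open>The 1 stands for the sample taken while the arm still has its default index; 2^j is the
  number of counts c with \<open>floor_log\<close> c = j, during which the bound of scale j is in
  force. K truncates the sum at a time horizon.\<close>

definition load :: "real \<Rightarrow> nat \<Rightarrow> nat \<Rightarrow> (nat \<times> nat \<Rightarrow> real) \<Rightarrow> real" where
  "load \<eta> K i X = 1 + (\<Sum>j\<le>K. 2 ^ j * indicator (Bad \<eta> i j) X)"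

lemma Bad_sets [measurable]: "i < n \<Longrightarrow> Bad \<eta> i j \<in> sets T"
proof -
  assume "i < n"
  note [measurable] = draws_stat_measurable[OF this]
  show ?thesis unfolding Bad_def by measurable
qed

lemma load_integrable: "i < n \<Longrightarrow> integrable T (load \<eta> K i)"
  unfolding load_def
  by (intro Bochner_Integration.integrable_add Bochner_Integration.integrable_sum integrable_mult_right
      P.integrable_const integrable_real_indicator) (auto simp: P.emeasure_eq_measure)

text \<open>At unresolved scales the probability is bounded by 1 and the powers of 2 sum to twice
  the largest. At resolved scales 2^j times the probability is at most a multiple of N^2 / 2^j, and
  since these scales start at 8192 * N they contribute only O(N).\<close>

lemma expected_load:
  assumes i: "i < n" and \<eta>: "0 < \<eta>" "\<eta> \<le> 1/16"
  shows "(\<integral>X. load \<eta> K i X \<partial>T) \<le> 2 ^ 20 * (H i * (ln (1 / \<eta>) + LL (1 / \<Delta> i)))"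
proof -
  define N where "N = H i"
  define L where "L = ln (1 / \<eta>)"
  define L' where "L' = LL (1 / \<Delta> i)"
  note g = gap_bounds[OF i]
  have N: "1 \<le> N" "N \<le> 2 / (\<Delta> i)\<^sup>2" unfolding N_def by (rule H_bounds[OF i])+
  have L: "1 \<le> L" unfolding L_def by (rule ln_inverse_ge_1[OF \<eta>])
  have L': "1 \<le> L'" unfolding L'_def using g by (intro LL_ge_1) auto
  define S where "S = {j. j \<le> K \<and> 8192 * N * lev \<eta> j \<le> 2 ^ j}"
  define R where "R = {j. j \<le> K \<and> \<not> 8192 * N * lev \<eta> j \<le> 2 ^ j}"
  define Y where "Y = 8192 * N * (2 * L + 48 * L')"
  have fin: "finite S" "finite R" by (auto simp: S_def R_def)
  have "(\<integral>X. load \<eta> K i X \<partial>T) = 1 + (\<Sum>j\<le>K. 2 ^ j * P.prob (Bad \<eta> i j))"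
  proof -
    have int: "integrable T (\<lambda>X. 2 ^ j * indicator (Bad \<eta> i j) X :: real)" for j
      using Bad_sets[OF i] by (intro integrable_mult_right integrable_real_indicator) (auto simp: P.emeasure_eq_measure)
    have "(\<integral>X. load \<eta> K i X \<partial>T) = (\<integral>X. (1::real) \<partial>T) + (\<integral>X. (\<Sum>j\<le>K. (2::real) ^ j * indicator (Bad \<eta> i j) X) \<partial>T)"
      unfolding load_def by (intro Bochner_Integration.integral_add Bochner_Integration.integrable_sum int P.integrable_const)
    also have "(\<integral>X. (\<Sum>j\<le>K. (2::real) ^ j * indicator (Bad \<eta> i j) X) \<partial>T) = (\<Sum>j\<le>K. \<integral>X. (2::real) ^ j * indicator (Bad \<eta> i j) X \<partial>T)"
      by (intro Bochner_Integration.integral_sum int)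
    also have "\<dots> = (\<Sum>j\<le>K. 2 ^ j * P.prob (Bad \<eta> i j))"
      using Bad_sets[OF i] by (intro sum.cong) auto
    finally show ?thesis by (simp add: P.prob_space)
  qed
  also have "(\<Sum>j\<le>K. 2 ^ j * P.prob (Bad \<eta> i j)) = (\<Sum>j\<in>S. 2 ^ j * P.prob (Bad \<eta> i j)) + (\<Sum>j\<in>R. 2 ^ j * P.prob (Bad \<eta> i j))"
  proof -
    have "{..K} = S \<union> R" "S \<inter> R = {}" by (auto simp: S_def R_def)
    then show ?thesis using fin by (simp add: sum.union_disjoint)
  qed
  also have "(\<Sum>j\<in>R. 2 ^ j * P.prob (Bad \<eta> i j)) \<le> (\<Sum>j\<in>R. 2 ^ j)"
    by (intro sum_mono) (simp add: mult_left_le)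
  also have "(\<Sum>j\<in>R. (2::real) ^ j) \<le> 2 * Y"
  proof (rule sum_powers_below[OF fin(2)])
    show "2 ^ j \<le> Y" if "j \<in> R" for j
      unfolding Y_def L_def L'_def using that
      by (intro unresolved_scale_le[OF g N \<eta>]) (auto simp: R_def)
    show "0 \<le> Y" unfolding Y_def using N L L' by auto
  qed
  also have "(\<Sum>j\<in>S. 2 ^ j * P.prob (Bad \<eta> i j)) \<le> (\<Sum>j\<in>S. 2 * (2048 * N)\<^sup>2 * (1 / 2 ^ j))"
  proof (rule sum_mono)
    fix j assume j: "j \<in> S"
    define x :: real where "x = 2 ^ j / (2048 * N)"
    have x: "0 < x" unfolding x_def using N by simp
    have "Bad \<eta> i j = {X \<in> space T. \<Delta> i / 2 \<le> 1 * (smean (draws i (2 ^ j) X) - \<theta> i) + rad \<eta> (draws i (2 ^ j) X)}"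
      by (simp add: Bad_def)
    also have "P.prob \<dots> \<le> 2 * exp (- (real (2 ^ j) / (2048 * N)))"
      by (rule separation_bound[OF i g]) (use j in \<open>auto simp: N_def H_def S_def lev_ge_1[OF \<eta>]\<close>)
    also have "\<dots> = 2 * exp (- x)" by (simp add: x_def)
    also have "exp (- x) \<le> 1 / x\<^sup>2"
      using square_le_exp[of x] x by (simp add: exp_minus field_simps)
    finally have "2 ^ j * P.prob (Bad \<eta> i j) \<le> 2 ^ j * (2 * (1 / x\<^sup>2))" by (intro mult_left_mono) auto
    also have "\<dots> = 2 * (2048 * N)\<^sup>2 * (1 / 2 ^ j)"
      unfolding x_def using N by (simp add: field_simps power2_eq_square)
    finally show "2 ^ j * P.prob (Bad \<eta> i j) \<le> 2 * (2048 * N)\<^sup>2 * (1 / 2 ^ j)" .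
  qed
  also have "\<dots> = 2 * (2048 * N)\<^sup>2 * (\<Sum>j\<in>S. 1 / 2 ^ j)" by (simp add: sum_distrib_left)
  also have "\<dots> \<le> 2 * (2048 * N)\<^sup>2 * (2 / (8192 * N))"
  proof (intro mult_left_mono sum_inverse_powers_above[OF fin(1)])
    fix j assume "j \<in> S"
    moreover have "8192 * N * 1 \<le> 8192 * N * lev \<eta> j" using N lev_ge_1[OF \<eta>] by (intro mult_left_mono) auto
    ultimately show "8192 * N \<le> 2 ^ j" by (simp add: S_def)
  qed (use N in auto)
  also have "\<dots> = 2048 * N" using N by (simp add: power2_eq_square)
  finally have "(\<integral>X. load \<eta> K i X \<partial>T) \<le> 1 + (2048 * N + 2 * Y)" by simp
  also have "\<dots> \<le> 2 ^ 20 * (N * (L + L'))"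
  proof -
    have "N * 1 \<le> N * L" "N * 1 \<le> N * L'" using N L L' by (auto intro!: mult_left_mono)
    moreover have "2 * Y = 32768 * (N * L) + 786432 * (N * L')" by (simp add: Y_def algebra_simps)
    moreover have "2 ^ 20 * (N * (L + L')) = 1048576 * (N * L) + 1048576 * (N * L')" by (simp add: algebra_simps)
    ultimately show ?thesis using N by linarith
  qed
  finally show ?thesis unfolding N_def L_def L'_def .
qed

text \<open>Markov's inequality for the sum of the loads; 2^24 = 16 * 2^20 gives 1/16. Only
  expectations are added, so the number of arms enters through the hardness alone.\<close>

lemma total_load_tail:
  assumes \<eta>: "0 < \<eta>" "\<eta> \<le> 1/16" and M: "0 < M"
    and budget: "2 ^ 24 * (\<Sum>i<n. H i * (ln (1 / \<eta>) + LL (1 / \<Delta> i))) \<le> M"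
  shows "P.prob {X \<in> space T. M \<le> (\<Sum>i\<in>{..<n} - {b}. load \<eta> K i X)} \<le> 1/16"
proof -
  let ?S = "{..<n} - {b}"
  have int: "integrable T (\<lambda>X. \<Sum>i\<in>?S. load \<eta> K i X)"
    by (intro Bochner_Integration.integrable_sum load_integrable) auto
  have pos: "0 \<le> H i * (ln (1 / \<eta>) + LL (1 / \<Delta> i))" if "i < n" for i
  proof -
    have "1 \<le> LL (1 / \<Delta> i)" using gap_bounds[OF that] by (intro LL_ge_1) auto
    then show ?thesis using H_bounds[OF that] ln_inverse_ge_1[OF \<eta>] by auto
  qed
  have "(\<integral>X. (\<Sum>i\<in>?S. load \<eta> K i X) \<partial>T) = (\<Sum>i\<in>?S. \<integral>X. load \<eta> K i X \<partial>T)"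
    by (intro Bochner_Integration.integral_sum load_integrable) auto
  also have "\<dots> \<le> (\<Sum>i\<in>?S. 2 ^ 20 * (H i * (ln (1 / \<eta>) + LL (1 / \<Delta> i))))"
    by (intro sum_mono expected_load \<eta>) auto
  also have "\<dots> \<le> (\<Sum>i<n. 2 ^ 20 * (H i * (ln (1 / \<eta>) + LL (1 / \<Delta> i))))"
    using pos by (intro sum_mono2) auto
  also have "\<dots> \<le> M / 16" using budget by (simp add: sum_distrib_left[symmetric])
  finally have E: "(\<integral>X. (\<Sum>i\<in>?S. load \<eta> K i X) \<partial>T) \<le> M / 16" .
  have "P.prob {X \<in> space T. M \<le> (\<Sum>i\<in>?S. load \<eta> K i X)} \<le> (\<integral>X. (\<Sum>i\<in>?S. load \<eta> K i X) \<partial>T) / M"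
    by (rule integral_Markov_inequality_measure[OF int, of "{}"])
       (use M in \<open>auto intro!: sum_nonneg add_nonneg_nonneg simp: load_def\<close>)
  also have "\<dots> \<le> 1/16" using E M by (simp add: field_simps)
  finally show ?thesis .
qed

end

section \<open>Candidate and certificate in one round\<close>

lemma run_prefix_cong:
  assumes "\<And>g. length g < t \<Longrightarrow> p g = q g"
  shows "run p X t = run q X t"
proof -
  have len: "length (run p X s) \<le> s" for s
    by (induction s) (auto simp: run_Suc split: action.split)
  have "s \<le> t \<Longrightarrow> run p X s = run q X s" for s
  proof (induction s)
    case (Suc s)
    then have "p (run p X s) = q (run p X s)" using len[of s] by (intro assms) linarith
    then show ?case using Suc by (simp add: run_Suc split: action.split)
  qed simp
  then show ?thesis by simp
qed

lemma obs_run: "obs i (run p X t) = map (\<lambda>j. X (i, j)) [0..<length (obs i (run p X t))]"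
  by (induction t) (auto simp: run_Suc split: action.split)

lemma length_run_Sample [simp]: "length (run (\<lambda>g. Sample (f g)) X t) = t"
  by (induction t) (auto simp: run_Suc)

lemma sum_length_obs:
  assumes "\<And>g. f g < n"
  shows "(\<Sum>i<n. length (obs i (run (\<lambda>g. Sample (f g)) X t))) = t"
proof (induction t)
  case (Suc t)
  let ?g = "run (\<lambda>g. Sample (f g)) X t"
  have "(\<Sum>i<n. length (obs i (run (\<lambda>g. Sample (f g)) X (Suc t))))
      = (\<Sum>i<n. length (obs i ?g) + (if f ?g = i then 1 else 0))"
    by (intro sum.cong) (auto simp: run_Suc)
  also have "\<dots> = Suc t" using Suc assms[of ?g] by (simp add: sum.distrib)
  finally show ?case .
qed simp

text \<open>Every positive count at which arm \<open>i\<close> was sampled again lies in a dyadic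
  block whose index satisfies B, and block j contains 2^j counts. The count 0 gives the summand
  1.\<close>

lemma length_obs_le_load:
  fixes B :: "nat \<Rightarrow> bool" and f :: "(nat \<times> real) list \<Rightarrow> nat" and X :: "nat \<times> nat \<Rightarrow> real"
  defines "r \<equiv> \<lambda>s. run (\<lambda>g. Sample (f g)) X s"
  assumes bad: "\<And>s. s < t \<Longrightarrow> f (r s) = i \<Longrightarrow> 0 < length (obs i (r s)) \<Longrightarrow> B (floor_log (length (obs i (r s))))"
    and K: "t \<le> K"
  shows "real (length (obs i (r t))) \<le> 1 + (\<Sum>j\<le>K. 2 ^ j * of_bool (B j))"
proof -
  have sampled: "s \<le> t \<Longrightarrow> 0 < c \<Longrightarrow> c < length (obs i (r s)) \<Longrightarrow> B (floor_log c)" for s c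
  proof (induction s)
    case (Suc s)
    show ?case
    proof (cases "c < length (obs i (r s))")
      case False
      then have "c = length (obs i (r s))" "f (r s) = i"
        using Suc.prems by (auto simp: r_def run_Suc split: if_splits)
      then show ?thesis using bad[of s] Suc.prems by auto
    qed (use Suc in auto)
  qed (simp add: r_def)
  have len: "length (obs i (r s)) \<le> s" for s
    by (induction s) (auto simp: r_def run_Suc)
  let ?m = "length (obs i (r t))"
  have "{1..<?m} \<subseteq> (\<Union>j\<in>{j. j \<le> K \<and> B j}. {2 ^ j..<2 ^ Suc j})"
  proof
    fix c assume c: "c \<in> {1..<?m}"
    then have "B (floor_log c)" using sampled[of t c] by auto
    moreover have lo: "2 ^ floor_log c \<le> c" "c < 2 ^ Suc (floor_log c)"
      using c floor_log_exp2_le[of c] floor_log_exp2_gt[of c] by auto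
    moreover have "floor_log c \<le> K"
    proof -
      have "floor_log c < 2 ^ floor_log c" by (rule less_exp)
      also note lo(1)
      also have "c < length (obs i (r t))" using c by simp
      finally show ?thesis using len[of t] K by linarith
    qed
    ultimately show "c \<in> (\<Union>j\<in>{j. j \<le> K \<and> B j}. {2 ^ j..<2 ^ Suc j})" by auto
  qed
  then have "card {1..<?m} \<le> card (\<Union>j\<in>{j. j \<le> K \<and> B j}. {2 ^ j..<2 ^ Suc j :: nat})"
    by (intro card_mono) auto
  also have "\<dots> \<le> (\<Sum>j\<in>{j. j \<le> K \<and> B j}. card {2 ^ j..<2 ^ Suc j :: nat})"
    by (intro card_UN_le) auto
  also have "\<dots> = (\<Sum>j\<in>{j. j \<le> K \<and> B j}. 2 ^ j)" by simp
  finally have "?m \<le> 1 + (\<Sum>j\<in>{j. j \<le> K \<and> B j}. 2 ^ j)" by simp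
  then have "real ?m \<le> real (1 + (\<Sum>j\<in>{j. j \<le> K \<and> B j}. 2 ^ j))" by (rule of_nat_mono)
  also have "\<dots> = 1 + (\<Sum>j\<in>{j. j \<le> K \<and> B j}. 2 ^ j)" by simp
  also have "(\<Sum>j\<in>{j. j \<le> K \<and> B j}. (2::real) ^ j) = (\<Sum>j\<le>K. 2 ^ j * of_bool (B j))"
    by (rule sum.mono_neutral_cong_left) auto
  finally show ?thesis .
qed

text \<open>An unsampled arm gets index 1, which is an upper bound for every mean.\<close>

definition ucb :: "real \<Rightarrow> real list \<Rightarrow> real" where
  "ucb \<eta> xs = (if xs = [] then 1 else
     (let ys = take (2 ^ floor_log (length xs)) xs in smean ys + rad \<eta> ys))"

definition lcb :: "real \<Rightarrow> real list \<Rightarrow> real" where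
  "lcb \<eta> xs = smean xs - rad \<eta> xs"

definition leader :: "nat \<Rightarrow> real \<Rightarrow> (nat \<times> real) list \<Rightarrow> nat" where
  "leader n \<eta> g = (LEAST i. i < n \<and> (\<forall>j<n. ucb \<eta> (obs j g) \<le> ucb \<eta> (obs i g)))"

text \<open>The default 0 only keeps the value a legal arm when no arm has a strict
  majority.\<close>

definition majority :: "nat \<Rightarrow> (nat \<times> real) list \<Rightarrow> nat" where
  "majority n g = (if \<exists>i<n. length g < 2 * length (obs i g)
     then LEAST i. i < n \<and> length g < 2 * length (obs i g) else 0)"

definition rival :: "nat \<Rightarrow> real \<Rightarrow> nat \<Rightarrow> nat \<Rightarrow> (nat \<times> real) list \<Rightarrow> nat \<Rightarrow> bool" where
  "rival n \<eta> M a g c \<longleftrightarrow> c < n \<and> c \<noteq> a \<and> lcb \<eta> (take M (obs a g)) \<le> ucb \<eta> (obs c g)"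

text \<open>Returning to \<open>a\<close> when no rival is left pads the phase to its fixed length,
  and makes more than M samples of \<open>a\<close> a witness of certification.\<close>

definition challenger :: "nat \<Rightarrow> real \<Rightarrow> nat \<Rightarrow> nat \<Rightarrow> (nat \<times> real) list \<Rightarrow> nat" where
  "challenger n \<eta> M a g = (if M \<le> length (obs a g) \<and> (\<exists>c. rival n \<eta> M a g c)
     then LEAST c. rival n \<eta> M a g c else a)"

definition certified :: "nat \<Rightarrow> real \<Rightarrow> nat \<Rightarrow> nat \<Rightarrow> (nat \<times> real) list \<Rightarrow> bool" where
  "certified n \<eta> M a g \<longleftrightarrow> (\<nexists>c. rival n \<eta> M a g c)"

lemma leader:
  assumes "0 < n"
  shows "leader n \<eta> g < n" "j < n \<Longrightarrow> ucb \<eta> (obs j g) \<le> ucb \<eta> (obs (leader n \<eta> g) g)"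
proof -
  let ?f = "\<lambda>i. ucb \<eta> (obs i g)"
  have "Max (?f ` {..<n}) \<in> ?f ` {..<n}" using assms by (intro Max_in) auto
  then obtain i where "i < n" "?f i = Max (?f ` {..<n})" by auto
  then have "i < n \<and> (\<forall>j<n. ?f j \<le> ?f i)" by auto
  from LeastI[of "\<lambda>i. i < n \<and> (\<forall>j<n. ?f j \<le> ?f i)", OF this]
  show "leader n \<eta> g < n" "j < n \<Longrightarrow> ?f j \<le> ?f (leader n \<eta> g)" by (auto simp: leader_def)
qed

lemma majority_less: "0 < n \<Longrightarrow> majority n g < n"
  using LeastI_ex[of "\<lambda>i. i < n \<and> length g < 2 * length (obs i g)"]
  unfolding majority_def by auto

lemma challenger_cases:
  "challenger n \<eta> M a g = a \<or>
    M \<le> length (obs a g) \<and> rival n \<eta> M a g (challenger n \<eta> M a g)"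
  unfolding challenger_def by (auto intro: LeastI_ex)

lemma challenger_less: "a < n \<Longrightarrow> challenger n \<eta> M a g < n"
  using challenger_cases[of n \<eta> M a g] by (auto simp: rival_def)

section \<open>Error probabilities of the two halves of a round\<close>

context best_arm
begin

definition underestimated :: "real \<Rightarrow> nat \<Rightarrow> (nat \<times> nat \<Rightarrow> real) set" where
  "underestimated \<eta> K = {X \<in> space T. \<exists>j\<le>K. rad \<eta> (draws b (2 ^ j) X) < \<theta> b - smean (draws b (2 ^ j) X)}"

lemma sum_telescope: "(\<Sum>j\<le>K. 1 / ((real j + 1) * (real j + 2))) = 1 - 1 / (real K + 2)"
proof (induction K)
  case (Suc K)
  have "1 / (real K + 2) - 1 / (real K + 3) = 1 / ((real K + 2) * (real K + 3))"
    by (simp add: field_simps)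
  then show ?case using Suc by (simp add: algebra_simps)
qed simp

text \<open>Union over dyadic counts with telescoping weights, hence a bound independent of K. As
  \<open>ucb\<close> uses dyadic prefixes only, this makes the bound of the best arm valid at all
  times up to K.\<close>

lemma underestimated:
  assumes \<eta>: "0 < \<eta>" "\<eta> \<le> 1"
  shows "underestimated \<eta> K \<in> sets T" "P.prob (underestimated \<eta> K) \<le> \<eta>"
proof -
  note [measurable] = draws_stat_measurable[OF b]
  define E where "E j = {X \<in> space T. rad \<eta> (draws b (2 ^ j) X) < - 1 * (smean (draws b (2 ^ j) X) - \<theta> b)}" for j
  have E: "E j \<in> sets T" for j unfolding E_def by measurable
  have eq: "underestimated \<eta> K = (\<Union>j\<le>K. E j)" by (auto simp: underestimated_def E_def)
  then show "underestimated \<eta> K \<in> sets T" using E by auto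
  have "P.prob (\<Union>j\<le>K. E j) \<le> (\<Sum>j\<le>K. P.prob (E j))"
    using E by (intro P.finite_measure_subadditive_finite) auto
  also have "\<dots> \<le> (\<Sum>j\<le>K. \<eta> * (1 / ((real j + 1) * (real j + 2))))"
  proof (rule sum_mono)
    fix j show "P.prob (E j) \<le> \<eta> * (1 / ((real j + 1) * (real j + 2)))"
      unfolding E_def using confidence_bound[OF b, of "2 ^ j" \<eta> "-1"] \<eta> by simp
  qed
  also have "\<dots> = \<eta> * (1 - 1 / (real K + 2))" unfolding sum_distrib_left[symmetric] sum_telescope ..
  also have "\<dots> \<le> \<eta>" using \<eta> by (simp add: mult_left_le)
  finally show "P.prob (underestimated \<eta> K) \<le> \<eta>" unfolding eq .
qed

lemma ucb_run:
  assumes "0 < length (obs i (run p X t))"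
  shows "ucb \<eta> (obs i (run p X t)) =
    (let j = floor_log (length (obs i (run p X t))) in smean (draws i (2 ^ j) X) + rad \<eta> (draws i (2 ^ j) X))"
proof -
  define c where "c = length (obs i (run p X t))"
  have "2 ^ floor_log c \<le> c" using assms unfolding c_def by (rule floor_log_exp2_le)
  then have "take (2 ^ floor_log c) (obs i (run p X t)) = draws i (2 ^ floor_log c) X"
    by (subst obs_run) (simp add: take_map c_def min_def)
  then show ?thesis using assms unfolding ucb_def Let_def c_def by auto
qed

lemma ucb_best_ge:
  assumes "X \<in> space T" "X \<notin> underestimated \<eta> K" "length (obs b (run p X t)) \<le> K"
  shows "\<theta> b \<le> ucb \<eta> (obs b (run p X t))"
proof (cases "obs b (run p X t) = []")
  case True
  then show ?thesis using arm_mean_bounds[OF b] by (simp add: ucb_def)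
next
  case False
  define j where "j = floor_log (length (obs b (run p X t)))"
  have "j < 2 ^ j" by (rule less_exp)
  also have "2 ^ j \<le> length (obs b (run p X t))" unfolding j_def using False by (intro floor_log_exp2_le) auto
  finally have "j \<le> K" using assms(3) by linarith
  then have "\<not> rad \<eta> (draws b (2 ^ j) X) < \<theta> b - smean (draws b (2 ^ j) X)"
    using assms(1,2) unfolding underestimated_def by auto
  then show ?thesis using False ucb_run[of b p X t \<eta>] by (simp add: j_def Let_def)
qed

lemma length_obs_le: "length (obs i (run p X t)) \<le> t"
  by (induction t) (auto simp: run_Suc split: action.split)

lemma load_eq: "X \<in> space T \<Longrightarrow> load \<eta> K i X = 1 + (\<Sum>j\<le>K. 2 ^ j * of_bool (X \<in> Bad \<eta> i j))"
  by (simp add: load_def indicator_def of_bool_def)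

text \<open>Interface between sampling rule and table: a rule that samples \<open>i\<close> only
  when its index is at least half a gap above its mean is charged to \<open>load\<close>. Both
  phases are used in this form.\<close>

lemma length_obs_le_loadI:
  assumes X: "X \<in> space T" and i: "i \<noteq> b"
    and high: "\<And>s g. s < t \<Longrightarrow> g = run (\<lambda>g. Sample (f g)) X s \<Longrightarrow> f g = i \<Longrightarrow> 0 < length (obs i g)
      \<Longrightarrow> \<theta> i + \<Delta> i / 2 \<le> ucb \<eta> (obs i g)"
  shows "real (length (obs i (run (\<lambda>g. Sample (f g)) X t))) \<le> load \<eta> t i X"
  unfolding load_eq[OF X]
proof (rule length_obs_le_load)
  let ?r = "\<lambda>s. run (\<lambda>g. Sample (f g)) X s"
  fix s assume s: "s < t" "f (?r s) = i" "0 < length (obs i (?r s))"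
  show "X \<in> Bad \<eta> i (floor_log (length (obs i (?r s))))"
    using high[OF s(1) refl s(2,3)] ucb_run[OF s(3), of \<eta>] X by (simp add: Bad_def Let_def)
qed simp

lemma sum_others:
  assumes "\<And>g. f g < n"
  shows "real t = length (obs b (run (\<lambda>g. Sample (f g)) X t))
    + (\<Sum>i\<in>{..<n} - {b}. real (length (obs i (run (\<lambda>g. Sample (f g)) X t))))"
proof -
  have "real t = real (\<Sum>i<n. length (obs i (run (\<lambda>g. Sample (f g)) X t)))"
    using sum_length_obs[OF assms] by simp
  then show ?thesis using b by (simp add: sum.remove[of "{..<n}" b])
qed

lemma overload_sets [measurable]:
  "{X \<in> space T. real M \<le> (\<Sum>i\<in>{..<n} - {b}. load \<eta> K i X)} \<in> sets T"
proof -
  have "load \<eta> K i \<in> borel_measurable T" if "i \<in> {..<n} - {b}" for i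
    using load_integrable[of i \<eta> K] that by auto
  note [measurable] = this
  show ?thesis by measurable
qed

text \<open>While the bound of the best arm is valid, a sampled arm \<open>i\<close> has index at
  least \<theta> b = \<theta> i + \<Delta> i. If moreover the loads total less than M, the other
  arms get fewer than M of the 2 * M samples, leaving a strict majority to b. Each of the two
  exceptions has probability at most 1/16.\<close>

lemma finder_error:
  fixes M :: nat
  assumes M: "0 < M" and budget: "2 ^ 24 * (\<Sum>i<n. H i * (ln (1 / (1/16)) + LL (1 / \<Delta> i))) \<le> real M"
  shows "P.prob {X \<in> space T. majority n (run (\<lambda>g. Sample (leader n (1/16) g)) X (2 * M)) \<noteq> b} \<le> 1/8"
proof -
  define \<eta> :: real where "\<eta> = 1/16"
  have \<eta>: "0 < \<eta>" "\<eta> \<le> 1/16" "\<eta> \<le> 1" by (auto simp: \<eta>_def)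
  let ?r = "run (\<lambda>g. Sample (leader n \<eta> g))"
  define E where "E = {X \<in> space T. real M \<le> (\<Sum>i\<in>{..<n} - {b}. load \<eta> (2 * M) i X)}"
  have E: "E \<in> sets T" unfolding E_def by (rule overload_sets)
  have "{X \<in> space T. majority n (?r X (2 * M)) \<noteq> b} \<subseteq> underestimated \<eta> (2 * M) \<union> E"
  proof (intro subsetI)
    fix X assume X: "X \<in> {X \<in> space T. majority n (?r X (2 * M)) \<noteq> b}"
    show "X \<in> underestimated \<eta> (2 * M) \<union> E"
    proof (rule ccontr)
      assume neg: "X \<notin> underestimated \<eta> (2 * M) \<union> E"
      have Xs: "X \<in> space T" using X by simp
      have "real (length (obs i (?r X (2 * M)))) \<le> load \<eta> (2 * M) i X" if i: "i \<in> {..<n} - {b}" for i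
      proof (rule length_obs_le_loadI[OF Xs])
        show "i \<noteq> b" using i by simp
        fix s g assume s: "s < 2 * M" and g: "g = ?r X s" and l: "leader n \<eta> g = i"
        have "\<theta> b \<le> ucb \<eta> (obs b g)"
          unfolding g
        proof (rule ucb_best_ge[OF Xs, of _ "2 * M"])
          show "length (obs b (?r X s)) \<le> 2 * M"
            using length_obs_le[of b "\<lambda>g. Sample (leader n \<eta> g)" X s] s by linarith
        qed (use neg in auto)
        also have "\<dots> \<le> ucb \<eta> (obs i g)" using leader(2)[of n b \<eta> g] b two_arms l by auto
        finally show "\<theta> i + \<Delta> i / 2 \<le> ucb \<eta> (obs i g)"
          using gap_other[of i] i gap_bounds[of i] by (simp add: field_simps)
      qed
      then have "(\<Sum>i\<in>{..<n} - {b}. real (length (obs i (?r X (2 * M))))) \<le> (\<Sum>i\<in>{..<n} - {b}. load \<eta> (2 * M) i X)"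
        by (rule sum_mono)
      also have "\<dots> < real M" using neg Xs unfolding E_def by auto
      finally have "real M < length (obs b (?r X (2 * M)))"
        using sum_others[of "leader n \<eta>" "2 * M" X] leader(1) two_arms by auto
      then have maj: "2 * M < 2 * length (obs b (?r X (2 * M)))" by simp
      have uniq: "i = b" if "i < n" "2 * M < 2 * length (obs i (?r X (2 * M)))" for i
      proof (rule ccontr)
        assume "i \<noteq> b"
        have "(\<Sum>j\<in>{i, b}. length (obs j (?r X (2 * M)))) \<le> (\<Sum>j<n. length (obs j (?r X (2 * M))))"
          using that b by (intro sum_mono2) auto
        then show False using \<open>i \<noteq> b\<close> that maj sum_length_obs[of "leader n \<eta>" n X "2 * M"] leader(1) two_arms by auto
      qed
      have "(LEAST i. i < n \<and> length (?r X (2 * M)) < 2 * length (obs i (?r X (2 * M)))) = b"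
      proof (rule Least_equality)
        show "b < n \<and> length (?r X (2 * M)) < 2 * length (obs b (?r X (2 * M)))" using maj b by simp
        show "b \<le> i" if "i < n \<and> length (?r X (2 * M)) < 2 * length (obs i (?r X (2 * M)))" for i
          using uniq[of i] that by simp
      qed
      then have "majority n (?r X (2 * M)) = b" unfolding majority_def using maj b by auto
      then show False using X by simp
    qed
  qed
  then have "P.prob {X \<in> space T. majority n (?r X (2 * M)) \<noteq> b} \<le> P.prob (underestimated \<eta> (2 * M) \<union> E)"
    using E underestimated(1)[OF \<eta>(1,3)] by (intro P.finite_measure_mono) auto
  also have "\<dots> \<le> P.prob (underestimated \<eta> (2 * M)) + P.prob E"
    using E underestimated(1)[OF \<eta>(1,3)] by (intro measure_Un_le) auto
  also have "P.prob (underestimated \<eta> (2 * M)) \<le> 1/16" using underestimated(2)[OF \<eta>(1,3)] by (simp add: \<eta>_def)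
  also have "P.prob E \<le> 1/16" unfolding E_def
    using budget M by (intro total_load_tail \<eta>) (auto simp: \<eta>_def)
  finally show ?thesis by (simp add: \<eta>_def)
qed

lemma take_obs_reference:
  assumes "M \<le> length (obs a (run p X t))"
  shows "take M (obs a (run p X t)) = draws a M X"
  using assms by (subst obs_run) (simp add: take_map min_def)

lemma challenger_reference:
  assumes "M \<le> t"
  shows "M \<le> length (obs a (run (\<lambda>g. Sample (challenger n \<eta> M a g)) X t))"
proof -
  let ?r = "run (\<lambda>g. Sample (challenger n \<eta> M a g)) X"
  have "min s M \<le> length (obs a (?r s))" for s
  proof (induction s)
    case (Suc s)
    show ?case
    proof (cases "M \<le> length (obs a (?r s))")
      case True
      then show ?thesis using length_obs_run_mono[of a _ X s] by (meson min.cobounded2 order_trans)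
    next
      case False
      then have "challenger n \<eta> M a (?r s) = a" by (simp add: challenger_def)
      then show ?thesis using Suc by (simp add: run_Suc)
    qed
  qed simp
  from this[of t] show ?thesis using assms by simp
qed

text \<open>A sample of \<open>a\<close> beyond the first M is taken only when no rival exists. From
  then on only \<open>a\<close> is sampled, while its first M values and the data of the other arms
  stay fixed, so certification is permanent.\<close>

lemma challenger_saturated:
  fixes M a \<eta> X defines "r \<equiv> run (\<lambda>g. Sample (challenger n \<eta> M a g)) X"
  shows "length (obs a (r t)) \<le> M \<or> M \<le> length (obs a (r t)) \<and> certified n \<eta> M a (r t)"
proof (induction t)
  case (Suc t)
  have rS: "r (Suc t) = r t @ [(challenger n \<eta> M a (r t), X (challenger n \<eta> M a (r t), length (obs (challenger n \<eta> M a (r t)) (r t))))]"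
    by (simp add: r_def run_Suc)
  consider "length (obs a (r t)) < M" | "M \<le> length (obs a (r t))" "certified n \<eta> M a (r t)"
    | "length (obs a (r t)) = M" "\<not> certified n \<eta> M a (r t)"
    using Suc by linarith
  then show ?case
  proof cases
    case 1
    then show ?thesis by (simp add: rS)
  next
    case 2
    then have c: "challenger n \<eta> M a (r t) = a" by (simp add: challenger_def certified_def)
    have "rival n \<eta> M a (r (Suc t)) c \<longleftrightarrow> rival n \<eta> M a (r t) c" for c
      using 2(1) unfolding rS c rival_def by auto
    then show ?thesis using 2 unfolding certified_def by (auto simp: rS)
  next
    case 3
    then have "rival n \<eta> M a (r t) (challenger n \<eta> M a (r t))"
      unfolding challenger_def certified_def by (auto intro: LeastI_ex)
    then have "challenger n \<eta> M a (r t) \<noteq> a" by (simp add: rival_def)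
    then show ?thesis using 3 by (simp add: rS)
  qed
qed (simp add: r_def)

text \<open>If both bounds hold, the reference lower bound is at most \<theta> a < \<theta> b, which
  is at most the upper bound of b, so b is still a rival at the end.\<close>

lemma certified_wrong:
  assumes a: "a < n" "a \<noteq> b" and \<eta>: "0 < \<eta>" "\<eta> \<le> 1" and M: "0 < M"
  shows "P.prob {X \<in> space T. certified n \<eta> M a (run (\<lambda>g. Sample (challenger n \<eta> M a g)) X (2 * M))} \<le> 2 * \<eta>"
proof -
  let ?r = "run (\<lambda>g. Sample (challenger n \<eta> M a g))"
  note [measurable] = draws_stat_measurable[OF a(1)]
  define E where "E = {X \<in> space T. rad \<eta> (draws a M X) < 1 * (smean (draws a M X) - \<theta> a)}"
  have E: "E \<in> sets T" unfolding E_def by measurable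
  have "{X \<in> space T. certified n \<eta> M a (?r X (2 * M))} \<subseteq> underestimated \<eta> (2 * M) \<union> E"
  proof (intro subsetI)
    fix X assume X: "X \<in> {X \<in> space T. certified n \<eta> M a (?r X (2 * M))}"
    show "X \<in> underestimated \<eta> (2 * M) \<union> E"
    proof (rule ccontr)
      assume neg: "X \<notin> underestimated \<eta> (2 * M) \<union> E"
      have Xs: "X \<in> space T" using X by simp
      have "\<theta> b \<le> ucb \<eta> (obs b (?r X (2 * M)))"
        using neg length_obs_le[of b _ X "2 * M"] by (intro ucb_best_ge[OF Xs, of _ "2 * M"]) auto
      moreover have "lcb \<eta> (draws a M X) \<le> \<theta> a" using neg Xs by (simp add: E_def lcb_def)
      moreover have "take M (obs a (?r X (2 * M))) = draws a M X"
        by (intro take_obs_reference challenger_reference) simp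
      moreover have "\<theta> a < \<theta> b" using best a by simp
      ultimately have "rival n \<eta> M a (?r X (2 * M)) b" using a b unfolding rival_def by auto
      then show False using X by (auto simp: certified_def)
    qed
  qed
  then have "P.prob {X \<in> space T. certified n \<eta> M a (?r X (2 * M))} \<le> P.prob (underestimated \<eta> (2 * M) \<union> E)"
    using E underestimated(1)[OF \<eta>] by (intro P.finite_measure_mono) auto
  also have "\<dots> \<le> P.prob (underestimated \<eta> (2 * M)) + P.prob E"
    using E underestimated(1)[OF \<eta>] by (intro measure_Un_le) auto
  also have "P.prob E \<le> \<eta> / ((real (floor_log M) + 1) * (real (floor_log M) + 2))"
    unfolding E_def by (rule confidence_bound[OF a(1) M \<eta>]) simp
  also have "\<dots> \<le> \<eta>"
  proof -
    have "1 * 1 \<le> (real (floor_log M) + 1) * (real (floor_log M) + 2)" by (intro mult_mono) auto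
    then show ?thesis using \<eta> by (simp add: divide_le_eq mult_le_cancel_left1)
  qed
  also note underestimated(2)[OF \<eta>, of "2 * M"]
  finally show ?thesis by simp
qed

text \<open>If the reference bound exceeds \<theta> b - \<Delta> b / 2, a rival \<open>i\<close> has
  index at least \<theta> i + \<Delta> i / 2, because \<Delta> b \<le> \<Delta> i, so its samples
  are charged to \<open>load\<close>. Small loads leave b more than M samples, and
  \<open>challenger_saturated\<close> then yields certification.\<close>

lemma certified_best:
  assumes \<eta>: "0 < \<eta>" "\<eta> \<le> 1/16" and M: "0 < M"
    and budget: "2 ^ 24 * (\<Sum>i<n. H i * (ln (1 / \<eta>) + LL (1 / \<Delta> i))) \<le> real M"
  shows "P.prob {X \<in> space T. \<not> certified n \<eta> M b (run (\<lambda>g. Sample (challenger n \<eta> M b g)) X (2 * M))} \<le> 1/8"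
proof -
  let ?r = "run (\<lambda>g. Sample (challenger n \<eta> M b g))"
  note [measurable] = draws_stat_measurable[OF b]
  note gb = gap_bounds[OF b] and Hb = H_bounds[OF b]
  define E where "E = {X \<in> space T. real M \<le> (\<Sum>i\<in>{..<n} - {b}. load \<eta> (2 * M) i X)}"
  define F where "F = {X \<in> space T. \<Delta> b / 2 \<le> - 1 * (smean (draws b M X) - \<theta> b) + rad \<eta> (draws b M X)}"
  have E: "E \<in> sets T" unfolding E_def by (rule overload_sets)
  have F: "F \<in> sets T" unfolding F_def by measurable
  have "{X \<in> space T. \<not> certified n \<eta> M b (?r X (2 * M))} \<subseteq> E \<union> F"
  proof (intro subsetI)
    fix X assume X: "X \<in> {X \<in> space T. \<not> certified n \<eta> M b (?r X (2 * M))}"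
    show "X \<in> E \<union> F"
    proof (rule ccontr)
      assume neg: "X \<notin> E \<union> F"
      have Xs: "X \<in> space T" using X by simp
      then have ref: "\<theta> b - \<Delta> b / 2 \<le> lcb \<eta> (draws b M X)" using neg by (simp add: F_def lcb_def)
      have "real (length (obs i (?r X (2 * M)))) \<le> load \<eta> (2 * M) i X" if i: "i \<in> {..<n} - {b}" for i
      proof (rule length_obs_le_loadI[OF Xs])
        show "i \<noteq> b" using i by simp
        fix s g assume s: "s < 2 * M" and g: "g = ?r X s" and l: "challenger n \<eta> M b g = i"
        have "M \<le> length (obs b g)" "rival n \<eta> M b g i"
          using challenger_cases[of n \<eta> M b g] l i by auto
        then have "lcb \<eta> (draws b M X) \<le> ucb \<eta> (obs i g)"
          unfolding rival_def g by (simp add: take_obs_reference)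
        then show "\<theta> i + \<Delta> i / 2 \<le> ucb \<eta> (obs i g)"
          using ref gap_other[of i] gap_best_le[of i] i by (simp add: field_simps)
      qed
      then have "(\<Sum>i\<in>{..<n} - {b}. real (length (obs i (?r X (2 * M))))) \<le> (\<Sum>i\<in>{..<n} - {b}. load \<eta> (2 * M) i X)"
        by (rule sum_mono)
      also have "\<dots> < real M" using neg Xs unfolding E_def by auto
      finally have "real M < length (obs b (?r X (2 * M)))"
        using sum_others[of "challenger n \<eta> M b" "2 * M" X] challenger_less[OF b] by auto
      then show False using challenger_saturated[of b \<eta> M X "2 * M"] X by auto
    qed
  qed
  then have "P.prob {X \<in> space T. \<not> certified n \<eta> M b (?r X (2 * M))} \<le> P.prob (E \<union> F)"
    using E F by (intro P.finite_measure_mono) auto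
  also have "\<dots> \<le> P.prob E + P.prob F" using E F by (intro measure_Un_le) auto
  also have "P.prob E \<le> 1/16" unfolding E_def using budget M by (intro total_load_tail \<eta>) auto
  also have "P.prob F \<le> 1/16"
  proof -
    define Y where "Y = H b * (ln (1 / \<eta>) + LL (1 / \<Delta> b))"
    have pos: "1 \<le> H i * (ln (1 / \<eta>) + LL (1 / \<Delta> i))" if "i < n" for i
    proof -
      have "1 \<le> LL (1 / \<Delta> i)" using gap_bounds[OF that] by (intro LL_ge_1) auto
      then have "1 * 1 \<le> H i * (ln (1 / \<eta>) + LL (1 / \<Delta> i))"
        using H_bounds[OF that] ln_inverse_ge_1[OF \<eta>] by (intro mult_mono) auto
      then show ?thesis by simp
    qed
    have "Y \<le> (\<Sum>i<n. H i * (ln (1 / \<eta>) + LL (1 / \<Delta> i)))"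
      unfolding Y_def using b pos by (intro member_le_sum) (force intro: order_trans[OF zero_le_one])+
    then have "2 ^ 24 * Y \<le> 2 ^ 24 * (\<Sum>i<n. H i * (ln (1 / \<eta>) + LL (1 / \<Delta> i)))" by (rule mult_left_mono) simp
    then have YM: "2 ^ 24 * Y \<le> real M" using budget by (rule order_trans)
    have Y1: "1 \<le> Y" unfolding Y_def by (rule pos[OF b])
    have "8192 * H b * lev \<eta> (floor_log M) \<le> real M"
      using YM Y1 M unfolding Y_def by (intro resolved_threshold[OF gb Hb \<eta>]) auto
    then have "P.prob F \<le> 2 * exp (- (real M / (2048 * H b)))"
      unfolding F_def by (intro separation_bound[OF b gb]) (auto simp: H_def lev_ge_1[OF \<eta>])
    \<comment> \<open>Any exponent of at least 6 will do, since exp 6 \<ge> 2^6; the budget exceeds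
      6 * 2048 * H b by a wide margin.\<close>
    also have "\<dots> \<le> 2 * exp (- 6)"
    proof -
      have "1 \<le> ln (1 / \<eta>) + LL (1 / \<Delta> b)"
        using ln_inverse_ge_1[OF \<eta>] LL_ge_1[of "1 / \<Delta> b"] gb by auto
      then have "H b * 1 \<le> Y" unfolding Y_def using Hb by (intro mult_left_mono) auto
      moreover have "16777216 * Y \<le> real M" using YM by simp
      ultimately have "6 * (2048 * H b) \<le> real M" using Y1 by linarith
      then show ?thesis using Hb by (simp add: pos_le_divide_eq)
    qed
    also have "\<dots> \<le> 1/16"
    proof -
      have "(2::real) ^ 6 \<le> exp 1 ^ 6" using two_le_exp_1 by (intro power_mono) auto
      then have "64 \<le> exp (6::real)" using exp_of_nat_mult[of 6 "1::real"] by simp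
      then show ?thesis by (simp add: exp_minus field_simps)
    qed
    finally show ?thesis .
  qed
  finally show ?thesis by simp
qed

end

section \<open>The policy\<close>

definition budget :: "nat \<Rightarrow> nat \<Rightarrow> nat" where
  "budget n k = n * 2 ^ k"

definition start :: "nat \<Rightarrow> nat \<Rightarrow> nat" where
  "start n k = 4 * n * (2 ^ k - 1)"

text \<open>Inverse of \<open>start\<close>: the policy sees only its history and recovers the round
  from the length, since m div (4 n) + 1 lies between 2^k and 2^(k+1) - 1 during round k.\<close>

definition stage :: "nat \<Rightarrow> nat \<Rightarrow> nat" where
  "stage n m = floor_log (m div (4 * n) + 1)"

text \<open>A wrong candidate passes with probability at most twice the risk; the doubled risks
  telescope over all rounds to at most \<delta>.\<close>

definition risk :: "real \<Rightarrow> nat \<Rightarrow> real" where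
  "risk \<delta> k = \<delta> / (2 * ((real k + 1) * (real k + 2)))"

definition candidate :: "nat \<Rightarrow> nat \<Rightarrow> (nat \<times> real) list \<Rightarrow> nat" where
  "candidate n k r = majority n (take (2 * budget n k) r)"

definition round_arm :: "nat \<Rightarrow> real \<Rightarrow> nat \<Rightarrow> (nat \<times> real) list \<Rightarrow> nat" where
  "round_arm n \<delta> k r = (if length r < 2 * budget n k then leader n (1/16) r
     else challenger n (risk \<delta> k) (budget n k) (candidate n k r) (drop (2 * budget n k) r))"

definition accepted :: "nat \<Rightarrow> real \<Rightarrow> nat \<Rightarrow> (nat \<times> real) list \<Rightarrow> bool" where
  "accepted n \<delta> k r \<longleftrightarrow> certified n (risk \<delta> k) (budget n k) (candidate n k r) (drop (2 * budget n k) r)"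

text \<open>A finished round is judged at the first step after it, when \<open>stage\<close> already
  gives the next index; hence \<open>k - 1\<close>, and \<open>0 < k\<close> excludes the empty
  history.\<close>

definition bai :: "nat \<Rightarrow> real \<Rightarrow> (nat \<times> real) list \<Rightarrow> action" where
  "bai n \<delta> h = (let k = stage n (length h) in
     if 0 < k \<and> length h = start n k \<and> accepted n \<delta> (k - 1) (drop (start n (k - 1)) h)
     then Stop (candidate n (k - 1) (drop (start n (k - 1)) h))
     else Sample (round_arm n \<delta> k (drop (start n k) h)))"

lemma candidate_less: "0 < n \<Longrightarrow> candidate n k r < n"
  unfolding candidate_def by (rule majority_less)

lemma bai_valid: "0 < n \<Longrightarrow> valid_policy n (\<lambda>_. bai n \<delta>)"
  unfolding valid_policy_def bai_def Let_def round_arm_def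
  by (auto split: if_splits simp: candidate_less leader challenger_less)

lemma start_Suc: "start n (Suc k) = start n k + 4 * budget n k"
proof -
  have "1 \<le> (2::nat) ^ k" by simp
  then show ?thesis by (simp add: start_def budget_def algebra_simps)
qed

lemma start_0 [simp]: "start n 0 = 0"
  by (simp add: start_def)

lemma stage_eq:
  assumes "0 < n" "start n k \<le> m" "m < start n k + 4 * budget n k"
  shows "stage n m = k"
proof -
  have p: "1 \<le> (2::nat) ^ k" by simp
  define q where "q = m div (4 * n)"
  have "(2 ^ k - 1) * (4 * n) \<le> m" using assms(2) by (simp add: start_def mult.commute)
  then have lo: "2 ^ k - 1 \<le> q" unfolding q_def using assms(1) by (simp add: less_eq_div_iff_mult_less_eq)
  have "m < start n (Suc k)" using assms(3) by (simp add: start_Suc)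
  then have "m < (2 ^ Suc k - 1) * (4 * n)" by (simp add: start_def mult.commute)
  then have hi: "q < 2 ^ Suc k - 1" unfolding q_def using assms(1) by (simp add: div_less_iff_less_mult)
  have "q + 1 > 0" "2 ^ k \<le> q + 1" "q + 1 < 2 * 2 ^ k" using lo hi p by auto
  then show ?thesis unfolding stage_def q_def[symmetric] by (intro floor_log_eqI)
qed

lemma budget_pos: "0 < n \<Longrightarrow> 0 < budget n k"
  by (simp add: budget_def)

section \<open>Measurability of the policy\<close>

lemma hist_measurableI:
  assumes "\<And>(M :: (nat \<times> nat \<Rightarrow> real) measure) \<alpha> v. (\<And>k. v k \<in> borel_measurable M) \<Longrightarrow>
     (\<lambda>\<omega>. F (map (\<lambda>k. (\<alpha> ! k, v k \<omega>)) [0..<length \<alpha>])) \<in> M \<rightarrow>\<^sub>M N"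
  shows "hist_measurable N F"
  using assms unfolding hist_measurable_def by blast

lemma hist_measurable_length: "hist_measurable (count_space UNIV) (\<lambda>h. f (length h))"
  by (rule hist_measurableI) simp

lemma hist_measurable_drop:
  assumes "hist_measurable N F"
  shows "hist_measurable N (\<lambda>h. F (drop m h))"
proof (rule hist_measurableI)
  fix M :: "(nat \<times> nat \<Rightarrow> real) measure"
    and \<alpha> :: "nat list" and v :: "nat \<Rightarrow> (nat \<times> nat \<Rightarrow> real) \<Rightarrow> real"
  assume v: "\<And>k. v k \<in> borel_measurable M"
  have "drop m (map (\<lambda>k. (\<alpha> ! k, v k \<omega>)) [0..<length \<alpha>])
      = map (\<lambda>k. (drop m \<alpha> ! k, v (m + k) \<omega>)) [0..<length (drop m \<alpha>)]" for \<omega>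
    by (rule nth_equalityI) auto
  then show "(\<lambda>\<omega>. F (drop m (map (\<lambda>k. (\<alpha> ! k, v k \<omega>)) [0..<length \<alpha>]))) \<in> M \<rightarrow>\<^sub>M N"
    using hist_measurableD[OF assms v, of "drop m \<alpha>" "\<lambda>k. m + k"] by simp
qed

lemma hist_measurable_take:
  assumes "hist_measurable N F"
  shows "hist_measurable N (\<lambda>h. F (take m h))"
proof (rule hist_measurableI)
  fix M :: "(nat \<times> nat \<Rightarrow> real) measure"
    and \<alpha> :: "nat list" and v :: "nat \<Rightarrow> (nat \<times> nat \<Rightarrow> real) \<Rightarrow> real"
  assume v: "\<And>k. v k \<in> borel_measurable M"
  have "take m (map (\<lambda>k. (\<alpha> ! k, v k \<omega>)) [0..<length \<alpha>])
      = map (\<lambda>k. (take m \<alpha> ! k, v k \<omega>)) [0..<length (take m \<alpha>)]" for \<omega>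
    by (rule nth_equalityI) auto
  then show "(\<lambda>\<omega>. F (take m (map (\<lambda>k. (\<alpha> ! k, v k \<omega>)) [0..<length \<alpha>]))) \<in> M \<rightarrow>\<^sub>M N"
    using hist_measurableD[OF assms v, of "take m \<alpha>" "\<lambda>k. k"] by simp
qed

text \<open>Lets parameters such as the candidate or the round index depend on the history: having
  countably many values, they can be fixed one at a time.\<close>

lemma hist_measurable_bind:
  fixes G :: "_ \<Rightarrow> 'g :: countable"
  assumes "\<And>a. hist_measurable N (F a)" "hist_measurable (count_space UNIV) G"
  shows "hist_measurable N (\<lambda>h. F (G h) h)"
proof (rule hist_measurableI)
  fix M :: "(nat \<times> nat \<Rightarrow> real) measure"
    and \<alpha> :: "nat list" and v :: "nat \<Rightarrow> (nat \<times> nat \<Rightarrow> real) \<Rightarrow> real"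
  assume v: "\<And>k. v k \<in> borel_measurable M"
  let ?h = "\<lambda>\<omega>. map (\<lambda>k. (\<alpha> ! k, v k \<omega>)) [0..<length \<alpha>]"
  show "(\<lambda>\<omega>. F (G (?h \<omega>)) (?h \<omega>)) \<in> M \<rightarrow>\<^sub>M N"
    by (rule measurable_compose_countable[OF hist_measurableD[OF assms(1) v] hist_measurableD[OF assms(2) v]])
qed

lemma hist_measurable_comp:
  assumes "hist_measurable (count_space UNIV) G" "\<And>x. f x \<in> space N"
  shows "hist_measurable N (\<lambda>h. f (G h))"
proof (rule hist_measurableI)
  fix M :: "(nat \<times> nat \<Rightarrow> real) measure"
    and \<alpha> :: "nat list" and v :: "nat \<Rightarrow> (nat \<times> nat \<Rightarrow> real) \<Rightarrow> real"
  assume "\<And>k. v k \<in> borel_measurable M"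
  then show "(\<lambda>\<omega>. f (G (map (\<lambda>k. (\<alpha> ! k, v k \<omega>)) [0..<length \<alpha>]))) \<in> M \<rightarrow>\<^sub>M N"
    using assms(2) by (intro measurable_compose[OF hist_measurableD[OF assms(1)]]) auto
qed

lemma hist_measurable_If:
  assumes "hist_measurable (count_space UNIV) P" "hist_measurable N F" "hist_measurable N G"
  shows "hist_measurable N (\<lambda>h. if P h then F h else G h)"
proof -
  have "hist_measurable N (\<lambda>h. if a then F h else G h)" for a
    using assms(2,3) by (cases a) auto
  then show ?thesis
    using hist_measurable_bind[of N "\<lambda>a h. if a then F h else G h" P] assms(1) by simp
qed

lemma obs_map:
  "obs i (map (\<lambda>k. (\<alpha> ! k, v k \<omega>)) [0..<length \<alpha>]) = map (\<lambda>k. v k \<omega>) (filter (\<lambda>k. \<alpha> ! k = i) [0..<length \<alpha>])"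
  by (simp add: obs_def filter_map comp_def)

lemma hist_measurable_ucb: "hist_measurable borel (\<lambda>h. ucb \<eta> (obs i h))"
proof (rule hist_measurableI)
  fix M :: "(nat \<times> nat \<Rightarrow> real) measure"
    and \<alpha> :: "nat list" and v :: "nat \<Rightarrow> (nat \<times> nat \<Rightarrow> real) \<Rightarrow> real"
  assume v: "\<And>k. v k \<in> borel_measurable M"
  show "(\<lambda>\<omega>. ucb \<eta> (obs i (map (\<lambda>k. (\<alpha> ! k, v k \<omega>)) [0..<length \<alpha>]))) \<in> borel_measurable M"
    unfolding obs_map ucb_def Let_def take_map length_map map_is_Nil_conv
    by (cases "filter (\<lambda>k. \<alpha> ! k = i) [0..<length \<alpha>] = []")
       (auto intro!: borel_measurable_add smean_measurable rad_measurable v)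
qed

lemma hist_measurable_lcb: "hist_measurable borel (\<lambda>h. lcb \<eta> (take m (obs i h)))"
proof (rule hist_measurableI)
  fix M :: "(nat \<times> nat \<Rightarrow> real) measure"
    and \<alpha> :: "nat list" and v :: "nat \<Rightarrow> (nat \<times> nat \<Rightarrow> real) \<Rightarrow> real"
  assume v: "\<And>k. v k \<in> borel_measurable M"
  show "(\<lambda>\<omega>. lcb \<eta> (take m (obs i (map (\<lambda>k. (\<alpha> ! k, v k \<omega>)) [0..<length \<alpha>])))) \<in> borel_measurable M"
    unfolding obs_map lcb_def take_map
    by (intro borel_measurable_diff smean_measurable rad_measurable v)
qed

lemma hist_measurable_length_obs: "hist_measurable (count_space UNIV) (\<lambda>h. f (length (obs i h)))"
  by (rule hist_measurableI) (simp add: obs_map)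

lemma hist_measurable_le:
  fixes F G :: "_ \<Rightarrow> real"
  assumes "hist_measurable borel F" "hist_measurable borel G"
  shows "hist_measurable (count_space UNIV) (\<lambda>h. F h \<le> G h)"
proof (rule hist_measurableI)
  fix M :: "(nat \<times> nat \<Rightarrow> real) measure"
    and \<alpha> :: "nat list" and v :: "nat \<Rightarrow> (nat \<times> nat \<Rightarrow> real) \<Rightarrow> real"
  assume v: "\<And>k. v k \<in> borel_measurable M"
  show "(\<lambda>\<omega>. F (map (\<lambda>k. (\<alpha> ! k, v k \<omega>)) [0..<length \<alpha>]) \<le> G (map (\<lambda>k. (\<alpha> ! k, v k \<omega>)) [0..<length \<alpha>])) \<in> M \<rightarrow>\<^sub>M count_space UNIV"
    unfolding pred_def
    by (rule borel_measurable_le[OF hist_measurableD[OF assms(1) v] hist_measurableD[OF assms(2) v]])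
qed

lemma hist_measurable_conj:
  assumes "hist_measurable (count_space UNIV) P" "hist_measurable (count_space UNIV) Q"
  shows "hist_measurable (count_space UNIV) (\<lambda>h. P h \<and> Q h)"
proof -
  have "hist_measurable (count_space UNIV) (\<lambda>h. if P h then Q h else False)"
    by (intro hist_measurable_If assms hist_measurable_length[where f = "\<lambda>_. False"])
  moreover have "(\<lambda>h. if P h then Q h else False) = (\<lambda>h. P h \<and> Q h)" by auto
  ultimately show ?thesis by simp
qed

lemma hist_measurable_not:
  "hist_measurable (count_space UNIV) P \<Longrightarrow> hist_measurable (count_space UNIV) (\<lambda>h. \<not> P h)"
  by (rule hist_measurable_comp) auto

lemma
  assumes "\<And>i :: nat. hist_measurable (count_space UNIV) (P i)"
  shows hist_measurable_All: "hist_measurable (count_space UNIV) (\<lambda>h. \<forall>i. P i h)"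
    and hist_measurable_Ex: "hist_measurable (count_space UNIV) (\<lambda>h. \<exists>i. P i h)"
    and hist_measurable_Least: "hist_measurable (count_space UNIV) (\<lambda>h. LEAST i. P i h)"
proof -
  have "Measurable.pred M (\<lambda>\<omega>. P i (map (\<lambda>k. (\<alpha> ! k, v k \<omega>)) [0..<length \<alpha>]))"
    if "\<And>k. v k \<in> borel_measurable M" for M :: "(nat \<times> nat \<Rightarrow> real) measure"
      and \<alpha> :: "nat list" and v :: "nat \<Rightarrow> (nat \<times> nat \<Rightarrow> real) \<Rightarrow> real" and i
    using hist_measurableD[OF assms that] .
  note [measurable] = this
  show "hist_measurable (count_space UNIV) (\<lambda>h. \<forall>i. P i h)"
    by (rule hist_measurableI) measurable
  show "hist_measurable (count_space UNIV) (\<lambda>h. \<exists>i. P i h)"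
    by (rule hist_measurableI) measurable
  show "hist_measurable (count_space UNIV) (\<lambda>h. LEAST i. P i h)"
    by (rule hist_measurableI) measurable
qed

lemma hist_measurable_const: "hist_measurable (count_space UNIV) (\<lambda>_. c)"
  by (rule hist_measurable_length)

lemma hist_measurable_imp:
  assumes "hist_measurable (count_space UNIV) Q"
  shows "hist_measurable (count_space UNIV) (\<lambda>h. P \<longrightarrow> Q h)"
  using assms hist_measurable_const[of True] by (cases P) auto

lemma hist_measurable_leader: "hist_measurable (count_space UNIV) (leader n \<eta>)"
  unfolding leader_def[abs_def]
  by (intro hist_measurable_Least hist_measurable_conj hist_measurable_const hist_measurable_All
      hist_measurable_imp hist_measurable_le hist_measurable_ucb)

lemma hist_measurable_majority: "hist_measurable (count_space UNIV) (majority n)"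
proof -
  have "hist_measurable (count_space UNIV) (\<lambda>g. length g < 2 * length (obs i g))" for i
    by (rule hist_measurableI) (simp add: obs_map)
  then show ?thesis
    unfolding majority_def[abs_def]
    by (intro hist_measurable_If hist_measurable_Ex hist_measurable_Least hist_measurable_conj hist_measurable_const)
qed

lemma hist_measurable_rival: "hist_measurable (count_space UNIV) (\<lambda>g. rival n \<eta> M a g c)"
  unfolding rival_def
  by (intro hist_measurable_conj hist_measurable_const hist_measurable_le hist_measurable_lcb hist_measurable_ucb)

lemma hist_measurable_challenger: "hist_measurable (count_space UNIV) (challenger n \<eta> M a)"
  unfolding challenger_def[abs_def]
  by (intro hist_measurable_If hist_measurable_conj hist_measurable_length_obs hist_measurable_Ex
      hist_measurable_Least hist_measurable_rival hist_measurable_const)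

lemma hist_measurable_certified: "hist_measurable (count_space UNIV) (certified n \<eta> M a)"
  unfolding certified_def[abs_def]
  by (intro hist_measurable_not hist_measurable_Ex hist_measurable_rival)

lemma hist_measurable_candidate: "hist_measurable (count_space UNIV) (candidate n k)"
  unfolding candidate_def[abs_def] by (intro hist_measurable_take hist_measurable_majority)

lemma hist_measurable_round_arm: "hist_measurable (count_space UNIV) (round_arm n \<delta> k)"
proof -
  have "hist_measurable (count_space UNIV)
      (\<lambda>r. challenger n (risk \<delta> k) (budget n k) (candidate n k r) (drop (2 * budget n k) r))"
    by (rule hist_measurable_bind[where F = "\<lambda>a r. challenger n (risk \<delta> k) (budget n k) a (drop (2 * budget n k) r)",
          OF hist_measurable_drop[OF hist_measurable_challenger] hist_measurable_candidate])
  then show ?thesis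
    unfolding round_arm_def[abs_def]
    by (rule hist_measurable_If[OF hist_measurable_length hist_measurable_leader])
qed

lemma hist_measurable_accepted: "hist_measurable (count_space UNIV) (accepted n \<delta> k)"
  unfolding accepted_def[abs_def]
  by (rule hist_measurable_bind[where F = "\<lambda>a r. certified n (risk \<delta> k) (budget n k) a (drop (2 * budget n k) r)",
        OF hist_measurable_drop[OF hist_measurable_certified] hist_measurable_candidate])

lemma hist_measurable_bai: "hist_measurable (count_space UNIV) (bai n \<delta>)"
proof -
  let ?F = "\<lambda>k h. if 0 < k \<and> length h = start n k \<and> accepted n \<delta> (k - 1) (drop (start n (k - 1)) h)
     then Stop (candidate n (k - 1) (drop (start n (k - 1)) h))
     else Sample (round_arm n \<delta> k (drop (start n k) h))"
  have "hist_measurable (count_space UNIV) (?F k)" for k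
  proof (rule hist_measurable_If)
    show "hist_measurable (count_space UNIV) (\<lambda>h. 0 < k \<and> length h = start n k \<and> accepted n \<delta> (k - 1) (drop (start n (k - 1)) h))"
      by (intro hist_measurable_conj hist_measurable_const hist_measurable_length
          hist_measurable_drop[OF hist_measurable_accepted])
    show "hist_measurable (count_space UNIV) (\<lambda>h. Stop (candidate n (k - 1) (drop (start n (k - 1)) h)))"
      by (rule hist_measurable_comp[where f = Stop, OF hist_measurable_drop[OF hist_measurable_candidate]]) simp
    show "hist_measurable (count_space UNIV) (\<lambda>h. Sample (round_arm n \<delta> k (drop (start n k) h)))"
      by (rule hist_measurable_comp[where f = Sample, OF hist_measurable_drop[OF hist_measurable_round_arm]]) simp
  qed
  then have "hist_measurable (count_space UNIV) (\<lambda>h. ?F (stage n (length h)) h)"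
    by (rule hist_measurable_bind[where F = ?F]) (rule hist_measurable_length)
  then show ?thesis unfolding bai_def[abs_def] Let_def .
qed

section \<open>Survival of a round\<close>

lemma length_run_le: "length (run p X t) \<le> t"
  by (induction t) (auto simp: run_Suc split: action.split)

lemma run_extends: "s \<le> t \<Longrightarrow> take (length (run p X s)) (run p X t) = run p X s"
proof (induction rule: dec_induct)
  case (step t)
  have "length (run p X s) \<le> length (run p X t)"
    using arg_cong[OF step.IH, of length] by simp
  then show ?case using step by (auto simp: run_Suc split: action.split)
qed simp

lemma run_stopped:
  assumes "is_stop (p (run p X s))" "s \<le> t"
  shows "run p X t = run p X s"
  using assms(2,1) by (induction rule: dec_induct) (auto simp: run_Suc is_stop_def split: action.splits)

lemma run_full:
  assumes "length (run p X t) = t" "s \<le> t"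
  shows "length (run p X s) = s" "s < t \<Longrightarrow> \<not> is_stop (p (run p X s))"
proof -
  have full: "length (run p X s) = s \<and> (s < t \<longrightarrow> \<not> is_stop (p (run p X s)))" if "s \<le> t" for s
    using that
  proof (induction rule: inc_induct)
    case base
    then show ?case using assms by simp
  next
    case (step s)
    have "\<not> is_stop (p (run p X s))"
    proof
      assume "is_stop (p (run p X s))"
      then have "length (run p X (Suc s)) = length (run p X s)" using run_stopped[of p X s "Suc s"] by simp
      then show False using step length_run_le[of p X s] by simp
    qed
    moreover have "length (run p X (Suc s)) \<le> Suc (length (run p X s))" by (auto simp: run_Suc split: action.split)
    ultimately show ?case using step length_run_le[of p X s] by auto
  qed
  from full[OF assms(2)] show "length (run p X s) = s" "s < t \<Longrightarrow> \<not> is_stop (p (run p X s))" by auto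
qed

lemma run_take:
  assumes "length (run p X t) = t" "s \<le> t"
  shows "run p X s = take s (run p X t)"
  using run_extends[OF assms(2), of p X] run_full(1)[OF assms] by simp

lemma running_full:
  assumes "\<not> is_stop (p (run p X t))"
  shows "length (run p X t) = t"
proof -
  have "length (run p X s) = s" if "s \<le> t" for s
    using that
  proof (induction s)
    case (Suc s)
    have "\<not> is_stop (p (run p X s))"
      using run_stopped[of p X s t] Suc.prems assms by auto
    then show ?case using Suc by (auto simp: run_Suc is_stop_def split: action.splits)
  qed simp
  then show ?thesis by simp
qed

lemma bai_round:
  assumes n: "0 < n" and h: "length h = start n k" and running: "\<not> is_stop (bai n \<delta> h)" and g: "length g < 4 * budget n k"
  shows "bai n \<delta> (h @ g) = Sample (round_arm n \<delta> k g)"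
proof -
  have st: "stage n (length (h @ g)) = k" using n g h by (intro stage_eq) auto
  have st0: "stage n (length h) = k" using n h budget_pos[OF n, of k] by (intro stage_eq) auto
  show ?thesis
  proof (cases "g = []")
    case True
    then show ?thesis using running h st0 by (auto simp: bai_def Let_def is_stop_def)
  next
    case False
    then show ?thesis using h st by (simp add: bai_def Let_def)
  qed
qed

text \<open>From the middle of a round the candidate is determined by \<open>h\<close>, so
  conditionally on \<open>h\<close> the second half is a challenger run for a constant arm.\<close>

lemma bai_mid:
  assumes n: "0 < n" and h: "length h = start n k + 2 * budget n k" and g: "length g < 2 * budget n k"
  shows "bai n \<delta> (h @ g) = Sample (challenger n (risk \<delta> k) (budget n k) (majority n (drop (start n k) h)) g)"
proof -
  have st: "stage n (length (h @ g)) = k" using n g h by (intro stage_eq) auto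
  have "0 < budget n k" by (rule budget_pos[OF n])
  then show ?thesis using h st by (simp add: bai_def Let_def round_arm_def candidate_def)
qed

lemma bai_stop_iff:
  assumes n: "0 < n" and h: "length h = start n (Suc k)"
  shows "is_stop (bai n \<delta> h) \<longleftrightarrow> accepted n \<delta> k (drop (start n k) h)"
    "bai n \<delta> h = Stop i \<Longrightarrow> i = candidate n k (drop (start n k) h)"
proof -
  have "stage n (length h) = Suc k" using n h budget_pos[OF n, of "Suc k"] by (intro stage_eq) auto
  then show "is_stop (bai n \<delta> h) \<longleftrightarrow> accepted n \<delta> k (drop (start n k) h)"
    "bai n \<delta> h = Stop i \<Longrightarrow> i = candidate n k (drop (start n k) h)"
    using h by (auto simp: bai_def Let_def is_stop_def split: if_splits)
qed

lemma bai_stop_time: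
  assumes n: "0 < n" and "is_stop (bai n \<delta> h)"
  obtains k where "length h = start n (Suc k)"
proof -
  have "0 < stage n (length h) \<and> length h = start n (stage n (length h))"
    using assms(2) by (auto simp: bai_def Let_def is_stop_def split: if_splits)
  then show ?thesis using that[of "stage n (length h) - 1"] by auto
qed

lemma ln_inverse_risk:
  assumes "0 < \<delta>" "\<delta> \<le> 1/10"
  shows "ln (1 / risk \<delta> k) \<le> 2 * ln (1 / \<delta>) + 2 * ln (real k + 2)"
proof -
  have "ln (1 / risk \<delta> k) = ln ((2 / \<delta>) * ((real k + 1) * (real k + 2)))"
    by (simp add: risk_def)
  also have "\<dots> \<le> ln ((1 / \<delta> * (1 / \<delta>)) * ((real k + 2) * (real k + 2)))"
  proof (rule ln_mono)
    show "0 < 2 / \<delta> * ((real k + 1) * (real k + 2))" using assms by (intro mult_pos_pos divide_pos_pos) auto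
    show "2 / \<delta> * ((real k + 1) * (real k + 2)) \<le> 1 / \<delta> * (1 / \<delta>) * ((real k + 2) * (real k + 2))"
      using assms by (intro mult_mono) (auto simp: field_simps)
  qed
  also have "\<dots> = 2 * ln (1 / \<delta>) + 2 * ln (real k + 2)"
    using assms by (simp add: ln_mult ln_div)
  finally show ?thesis .
qed

lemma risk_bounds:
  assumes "0 < \<delta>" "\<delta> \<le> 1/10"
  shows "0 < risk \<delta> k" "risk \<delta> k \<le> 1/16"
proof -
  show "0 < risk \<delta> k" using assms by (simp add: risk_def)
  have "2 * (1 * 2) \<le> 2 * ((real k + 1) * (real k + 2))" by (intro mult_mono) auto
  then have "risk \<delta> k \<le> \<delta> / 4" unfolding risk_def using assms by (intro divide_left_mono) auto
  then show "risk \<delta> k \<le> 1/16" using assms by simp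
qed

section \<open>Total hardness against the budget of a round\<close>

context best_arm
begin

definition hardness :: "real \<Rightarrow> real" where
  "hardness \<eta> = (\<Sum>i<n. H i * (ln (1 / \<eta>) + LL (1 / \<Delta> i)))"

lemma hardness_mono: "0 < \<eta> \<Longrightarrow> \<eta> \<le> \<eta>' \<Longrightarrow> hardness \<eta>' \<le> hardness \<eta>"
  unfolding hardness_def
  by (intro sum_mono mult_left_mono add_mono ln_mono) (auto simp: frac_le intro: order_trans[OF zero_le_one H_bounds(1)])

lemma n_le_hardness:
  assumes "0 < \<eta>" "\<eta> \<le> 1/10"
  shows "real n \<le> hardness \<eta>"
proof -
  have "(\<Sum>i<n. (1::real)) \<le> hardness \<eta>"
    unfolding hardness_def
  proof (rule sum_mono)
    fix i assume "i \<in> {..<n}"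
    then have i: "i < n" by simp
    have "1 \<le> LL (1 / \<Delta> i)" using gap_bounds[OF i] by (intro LL_ge_1) auto
    moreover have "0 \<le> ln (1 / \<eta>)" using assms by (intro ln_ge_zero) auto
    ultimately have "1 * 1 \<le> H i * (ln (1 / \<eta>) + LL (1 / \<Delta> i))" using H_bounds[OF i] by (intro mult_mono) auto
    then show "1 \<le> H i * (ln (1 / \<eta>) + LL (1 / \<Delta> i))" by simp
  qed
  then show ?thesis by simp
qed

text \<open>Splitting the confidence over the rounds costs a term \<open>ln k\<close> with \<open>k\<close> about \<open>log 2 (hardness / n)\<close>;
  arm by arm it is absorbed either by the budget share \<open>2 ^ k\<close> of the arm or by its own \<open>LL\<close> term.\<close>

lemma small_budget:
  assumes \<delta>: "0 < \<delta>" "\<delta> \<le> 1/10" and lt: "real (budget n k) < 2 ^ 24 * hardness (risk \<delta> k)"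
  shows "real (budget n k) \<le> 2 ^ 30 * hardness \<delta>"
proof -
  define L where "L = ln (1 / \<delta>)"
  have L0: "0 \<le> L" unfolding L_def using \<delta> by (intro ln_ge_zero) auto
  have arm: "2 ^ 24 * (H i * (ln (1 / risk \<delta> k) + LL (1 / \<Delta> i))) \<le> 2 ^ k / 2 + 2 ^ 29 * (H i * (L + LL (1 / \<Delta> i)))"
    if i: "i < n" for i
  proof -
    note g = gap_bounds[OF i] and H = H_bounds[OF i]
    define l where "l = LL (1 / \<Delta> i)"
    define x where "x = ln (real k + 2)"
    have l1: "1 \<le> l" unfolding l_def using g by (intro LL_ge_1) auto
    have "H i * ln (1 / risk \<delta> k) \<le> H i * (2 * L + 2 * x)"
      using ln_inverse_risk[OF \<delta>, of k] H unfolding L_def x_def by (intro mult_left_mono) auto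
    then have 1: "H i * ln (1 / risk \<delta> k) \<le> 2 * (H i * L) + 2 * (H i * x)" by (simp add: algebra_simps)
    have "33554432 * (H i * x) \<le> 2 ^ k / 2 + 268435456 * (H i * l)"
    proof (cases "33554432 * (H i * x) \<le> 2 ^ k / 2")
      case True
      then show ?thesis using H l1 by (smt (verit) mult_nonneg_nonneg)
    next
      case False
      \<comment> \<open>The failed comparison bounds 2^k by a multiple of H i * ln (k + 2), which is
        the hypothesis of \<open>ln_index_le_LL\<close> with k as index.\<close>
      then have "2 ^ k \<le> (67108864 * H i) * x" by simp
      also have "\<dots> \<le> (2 ^ 60 / (\<Delta> i)\<^sup>2) * x"
      proof (intro mult_right_mono)
        have "67108864 * H i \<le> 67108864 * (2 / (\<Delta> i)\<^sup>2)" using H by (intro mult_left_mono) auto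
        also have "\<dots> = 134217728 / (\<Delta> i)\<^sup>2" by simp
        also have "\<dots> \<le> 2 ^ 60 / (\<Delta> i)\<^sup>2" by (intro divide_right_mono) auto
        finally show "67108864 * H i \<le> 2 ^ 60 / (\<Delta> i)\<^sup>2" .
      qed (simp add: x_def)
      finally have "x \<le> 8 * l" unfolding x_def l_def by (rule ln_index_le_LL[OF g])
      then have "H i * x \<le> H i * (8 * l)" using H by (intro mult_left_mono) auto
      moreover have "0 \<le> (2::real) ^ k / 2" by simp
      ultimately show ?thesis by linarith
    qed
    moreover have "0 \<le> H i * L" "0 \<le> H i * l" using H L0 l1 by auto
    ultimately have "16777216 * (H i * ln (1 / risk \<delta> k)) + 16777216 * (H i * l)
      \<le> 2 ^ k / 2 + (536870912 * (H i * L) + 536870912 * (H i * l))" using 1 by linarith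
    then show ?thesis unfolding l_def by (simp add: algebra_simps)
  qed
  have "real (budget n k) \<le> (\<Sum>i<n. 2 ^ 24 * (H i * (ln (1 / risk \<delta> k) + LL (1 / \<Delta> i))))"
    using lt by (simp add: hardness_def sum_distrib_left)
  also have "\<dots> \<le> (\<Sum>i<n. 2 ^ k / 2 + 2 ^ 29 * (H i * (L + LL (1 / \<Delta> i))))"
    by (intro sum_mono arm) simp
  \<comment> \<open>The shares 2^k / 2 add up to half the budget and are absorbed on the left,
    turning 2^29 into 2^30.\<close>
  also have "\<dots> = real (budget n k) / 2 + 2 ^ 29 * hardness \<delta>"
    by (simp add: sum.distrib sum_distrib_left[symmetric] hardness_def L_def budget_def)
  finally show ?thesis by simp
qed

text \<open>K follows the last insufficient round, not the first sufficient one, because every later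
  round must succeed with good probability. One doubling of the budget turns 2^30 into 2^31.\<close>

lemma sufficient_round:
  assumes \<delta>: "0 < \<delta>" "\<delta> \<le> 1/10"
  obtains K where "\<And>k. K \<le> k \<Longrightarrow> 2 ^ 24 * hardness (risk \<delta> k) \<le> real (budget n k)"
    "real (budget n K) \<le> 2 ^ 31 * hardness \<delta>"
proof -
  define Z where "Z = {k. real (budget n k) < 2 ^ 24 * hardness (risk \<delta> k)}"
  have nh: "real n \<le> hardness \<delta>" by (rule n_le_hardness[OF \<delta>])
  have Z: "real (budget n k) \<le> 2 ^ 30 * hardness \<delta>" if "k \<in> Z" for k
    using small_budget[OF \<delta>] that by (simp add: Z_def)
  obtain m :: nat where m: "2 ^ 30 * hardness \<delta> < real m" using reals_Archimedean2 by blast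
  have "Z \<subseteq> {..m}"
  proof
    fix k assume "k \<in> Z"
    then have "real (budget n k) < real m" using Z m by force
    then have "budget n k < m" by simp
    then have "n * 2 ^ k < m" by (simp add: budget_def)
    moreover have "1 * k \<le> n * 2 ^ k" using two_arms less_exp[of k] by (intro mult_mono) auto
    ultimately show "k \<in> {..m}" by simp
  qed
  then have fin: "finite Z" by (rule finite_subset) simp
  show ?thesis
  proof (cases "Z = {}")
    case True
    show ?thesis
    proof (rule that[of 0])
      show "2 ^ 24 * hardness (risk \<delta> k) \<le> real (budget n k)" for k
      proof -
        have "k \<notin> Z" using True by simp
        then show ?thesis by (simp add: Z_def)
      qed
      show "real (budget n 0) \<le> 2 ^ 31 * hardness \<delta>" using nh by (simp add: budget_def)
    qed
  next
    case False
    show ?thesis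
    proof (rule that[of "Suc (Max Z)"])
      fix k assume "Suc (Max Z) \<le> k"
      then have "k \<notin> Z" using Max_ge[OF fin, of k] by auto
      then show "2 ^ 24 * hardness (risk \<delta> k) \<le> real (budget n k)" by (simp add: Z_def)
    next
      have "real (budget n (Suc (Max Z))) = 2 * real (budget n (Max Z))" by (simp add: budget_def)
      then show "real (budget n (Suc (Max Z))) \<le> 2 ^ 31 * hardness \<delta>"
        using Z[OF Max_in[OF fin False]] by simp
    qed
  qed
qed

section \<open>Survival and wrong acceptance as Markov steps\<close>

definition alive :: "real \<Rightarrow> nat \<Rightarrow> (nat \<times> nat \<Rightarrow> real) set" where
  "alive \<delta> k = {X \<in> space T. \<not> is_stop (bai n \<delta> (run (bai n \<delta>) X (start n k)))}"

text \<open>The length condition singles out stops at the end of round k itself: after an earlier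
  stop the history is frozen and too short.\<close>

definition mistaken :: "real \<Rightarrow> nat \<Rightarrow> (nat \<times> nat \<Rightarrow> real) set" where
  "mistaken \<delta> k = {X \<in> space T. length (run (bai n \<delta>) X (start n (Suc k))) = start n (Suc k)
     \<and> (\<exists>i. i \<noteq> b \<and> bai n \<delta> (run (bai n \<delta>) X (start n (Suc k))) = Stop i)}"

lemma n_pos: "0 < n"
  using two_arms by simp

lemma hist_measurable_action: "hist_measurable (count_space UNIV) (\<lambda>h. f (bai n \<delta> h))"
  by (rule hist_measurable_comp[OF hist_measurable_bai]) simp

lemma alive_sets [measurable]: "alive \<delta> k \<in> sets T"
  unfolding alive_def
  using run_measurable[OF hist_measurable_bai hist_measurable_action[of "\<lambda>a. \<not> is_stop a" \<delta>], where t = "start n k" and \<delta>1 = \<delta> and n1 = n]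
  by (simp add: pred_def)

lemma mistaken_sets [measurable]: "mistaken \<delta> k \<in> sets T"
proof -
  have "hist_measurable (count_space UNIV) (\<lambda>h. length h = start n (Suc k) \<and> (\<exists>i. i \<noteq> b \<and> bai n \<delta> h = Stop i))"
    by (intro hist_measurable_conj hist_measurable_length hist_measurable_action[where f = "\<lambda>a. \<exists>i. i \<noteq> b \<and> a = Stop i"])
  from run_measurable[OF hist_measurable_bai this, of n \<delta> "start n (Suc k)"]
  show ?thesis unfolding mistaken_def by (simp add: pred_def)
qed

lemma alive_length: "X \<in> alive \<delta> k \<Longrightarrow> length (run (bai n \<delta>) X (start n k)) = start n k"
  unfolding alive_def by (auto intro: running_full)

lemma alive_decseq: "X \<in> alive \<delta> (Suc k) \<Longrightarrow> X \<in> alive \<delta> k"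
  using run_full(2)[OF alive_length[of X \<delta> "Suc k"], of "start n k"] budget_pos[OF n_pos, of k]
  by (auto simp: alive_def start_Suc)

lemma markov_bai:
  assumes "hist_measurable (count_space UNIV) G" "hist_measurable (count_space UNIV) R" "0 \<le> q"
    and "\<And>h. G h \<Longrightarrow> P.prob {Y \<in> space T. R (h @ run (\<lambda>g. bai n \<delta> (h @ g)) Y t)} \<le> q"
  shows "P.prob {X \<in> space T. G (run (bai n \<delta>) X s) \<and> R (run (bai n \<delta>) X (s + t))}
    \<le> q * P.prob {X \<in> space T. G (run (bai n \<delta>) X s)}"
  by (rule markov_run[OF hist_measurable_bai]) (use assms in auto)

lemma pred_run_sets:
  assumes "hist_measurable (count_space UNIV) G" "hist_measurable (count_space UNIV) R"
  shows "{X \<in> space T. G (run (bai n \<delta>) X s) \<and> R (run (bai n \<delta>) X t)} \<in> sets T"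
  using run_measurable[OF hist_measurable_bai assms(1), of n \<delta> s] run_measurable[OF hist_measurable_bai assms(2), of n \<delta> t]
  by measurable

lemma run_second_half:
  assumes "length h = start n k + 2 * budget n k"
  shows "run (\<lambda>g. bai n \<delta> (h @ g)) Y (2 * budget n k)
    = run (\<lambda>g. Sample (challenger n (risk \<delta> k) (budget n k) (majority n (drop (start n k) h)) g)) Y (2 * budget n k)"
  using bai_mid[OF n_pos assms] by (intro run_prefix_cong) auto

text \<open>A run outlives round k only if the first half misses b or the second half fails to
  certify b. Each is a Markov step with bound 1/8, the first from the start of the round, the second
  from its middle with candidate b.\<close>

lemma survival:
  assumes \<delta>: "0 < \<delta>" "\<delta> \<le> 1/10" and enough: "2 ^ 24 * hardness (risk \<delta> k) \<le> real (budget n k)"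
  shows "P.prob (alive \<delta> (Suc k)) \<le> 1/4 * P.prob (alive \<delta> k)"
proof -
  let ?p = "bai n \<delta>" and ?s = "start n k" and ?M = "budget n k" and ?\<eta> = "risk \<delta> k"
  note risk = risk_bounds[OF \<delta>, of k]
  have M: "0 < ?M" by (rule budget_pos[OF n_pos])
  define G1 where "G1 h \<longleftrightarrow> length h = ?s \<and> \<not> is_stop (?p h)" for h
  define R1 where "R1 h \<longleftrightarrow> majority n (drop ?s h) \<noteq> b" for h
  define G2 where "G2 h \<longleftrightarrow> length h = ?s + 2 * ?M \<and> majority n (drop ?s h) = b" for h
  define R2 where "R2 h \<longleftrightarrow> \<not> certified n ?\<eta> ?M b (drop (?s + 2 * ?M) h)" for h
  have maj: "hist_measurable (count_space UNIV) (\<lambda>h. f (majority n (drop ?s h)))" for f :: "nat \<Rightarrow> bool"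
    by (rule hist_measurable_comp[OF hist_measurable_drop[OF hist_measurable_majority]]) simp
  have hm: "hist_measurable (count_space UNIV) G1" "hist_measurable (count_space UNIV) R1"
    "hist_measurable (count_space UNIV) G2" "hist_measurable (count_space UNIV) R2"
    unfolding G1_def[abs_def] R1_def[abs_def] G2_def[abs_def] R2_def[abs_def]
    by (intro hist_measurable_conj hist_measurable_length hist_measurable_not hist_measurable_action maj
        hist_measurable_drop[OF hist_measurable_certified])+
  define E1 where "E1 = {X \<in> space T. G1 (run ?p X ?s) \<and> R1 (run ?p X (?s + 2 * ?M))}"
  define E2 where "E2 = {X \<in> space T. G2 (run ?p X (?s + 2 * ?M)) \<and> R2 (run ?p X ((?s + 2 * ?M) + 2 * ?M))}"
  have E: "E1 \<in> sets T" "E2 \<in> sets T" unfolding E1_def E2_def by (intro pred_run_sets hm)+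
  have G1eq: "{X \<in> space T. G1 (run ?p X ?s)} = alive \<delta> k"
    using alive_length[of _ \<delta> k] by (auto simp: G1_def alive_def)
  have "P.prob E1 \<le> 1/8 * P.prob {X \<in> space T. G1 (run ?p X ?s)}"
    unfolding E1_def
  proof (rule markov_bai[OF hm(1,2)])
    fix h assume h: "G1 h"
    have "run (\<lambda>g. ?p (h @ g)) Y (2 * ?M) = run (\<lambda>g. Sample (leader n (1/16) g)) Y (2 * ?M)" for Y
      using bai_round[OF n_pos, of h k \<delta>] h by (intro run_prefix_cong) (auto simp: G1_def round_arm_def)
    moreover have "hardness (1/16) \<le> hardness ?\<eta>" by (rule hardness_mono[OF risk])
    then have "2 ^ 24 * hardness (1/16) \<le> 2 ^ 24 * hardness ?\<eta>" by (rule mult_left_mono) simp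
    then have "2 ^ 24 * hardness (1/16) \<le> real ?M" using enough by (rule order_trans)
    ultimately show "P.prob {Y \<in> space T. R1 (h @ run (\<lambda>g. ?p (h @ g)) Y (2 * ?M))} \<le> 1/8"
      using finder_error[OF M] h by (simp add: R1_def G1_def hardness_def)
  qed simp
  moreover have "P.prob E2 \<le> 1/8 * P.prob {X \<in> space T. G2 (run ?p X (?s + 2 * ?M))}"
    unfolding E2_def
  proof (rule markov_bai[OF hm(3,4)])
    fix h assume h: "G2 h"
    then show "P.prob {Y \<in> space T. R2 (h @ run (\<lambda>g. ?p (h @ g)) Y (2 * ?M))} \<le> 1/8"
      using certified_best[OF risk M] enough run_second_half[of h k \<delta>]
      by (simp add: R2_def G2_def hardness_def)
  qed simp
  \<comment> \<open>A history of full length in mid-round proves that no stop occurred before, so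
    the second step is also relative to \<open>alive\<close>.\<close>
  moreover have "P.prob {X \<in> space T. G2 (run ?p X (?s + 2 * ?M))} \<le> P.prob (alive \<delta> k)"
  proof (rule P.finite_measure_mono)
    show "{X \<in> space T. G2 (run ?p X (?s + 2 * ?M))} \<subseteq> alive \<delta> k"
      using run_full(2)[of ?p _ "?s + 2 * ?M" ?s] M by (auto simp: G2_def alive_def)
  qed simp
  moreover have "P.prob (alive \<delta> (Suc k)) \<le> P.prob (E1 \<union> E2)"
  proof (rule P.finite_measure_mono)
    show "alive \<delta> (Suc k) \<subseteq> E1 \<union> E2"
    proof
      fix X assume X: "X \<in> alive \<delta> (Suc k)"
      define h where "h = run ?p X (start n (Suc k))"
      have len: "length h = start n (Suc k)" unfolding h_def by (rule alive_length[OF X])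
      have half: "run ?p X (?s + 2 * ?M) = take (?s + 2 * ?M) h"
        unfolding h_def by (rule run_take) (use len in \<open>auto simp: h_def start_Suc\<close>)
      have cand: "candidate n k (drop ?s h) = majority n (drop ?s (take (?s + 2 * ?M) h))"
        by (simp add: candidate_def take_drop add.commute)
      have "\<not> accepted n \<delta> k (drop ?s h)"
        using X bai_stop_iff(1)[OF n_pos len] by (simp add: alive_def h_def)
      then have "\<not> certified n ?\<eta> ?M (majority n (drop ?s (take (?s + 2 * ?M) h))) (drop (?s + 2 * ?M) h)"
        unfolding accepted_def cand by (simp add: add.commute)
      moreover have "run ?p X ((?s + 2 * ?M) + 2 * ?M) = h" by (simp add: h_def start_Suc add.commute)
      moreover have "X \<in> space T" using X by (simp add: alive_def)
      moreover have "G1 (run ?p X ?s)"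
        using alive_decseq[OF X] alive_length[of X \<delta> k] by (simp add: G1_def alive_def)
      moreover have "length (take (?s + 2 * ?M) h) = ?s + 2 * ?M" using len by (simp add: start_Suc)
      ultimately show "X \<in> E1 \<union> E2"
        by (cases "majority n (drop ?s (take (?s + 2 * ?M) h)) = b")
           (auto simp: E1_def E2_def half R1_def R2_def G2_def)
    qed
  qed (use E in simp)
  moreover have "P.prob (E1 \<union> E2) \<le> P.prob E1 + P.prob E2" using E by (intro measure_Un_le) auto
  ultimately show ?thesis unfolding G1eq by linarith
qed

text \<open>The Markov step starts in mid-round, where the wrong candidate is already a constant, so
  \<open>certified_wrong\<close> applies to it without a union over arms.\<close>

lemma mistaken_prob:
  assumes \<delta>: "0 < \<delta>" "\<delta> \<le> 1/10"
  shows "P.prob (mistaken \<delta> k) \<le> \<delta> * (1 / ((real k + 1) * (real k + 2)))"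
proof -
  let ?p = "bai n \<delta>" and ?s = "start n k" and ?M = "budget n k" and ?\<eta> = "risk \<delta> k"
  note risk = risk_bounds[OF \<delta>, of k]
  have M: "0 < ?M" by (rule budget_pos[OF n_pos])
  define G where "G h \<longleftrightarrow> length h = ?s + 2 * ?M \<and> majority n (drop ?s h) \<noteq> b" for h
  \<comment> \<open>The candidate is read from the prefix of the history, so R is a property of the
    final history alone and yet the candidate does not change while the second half runs.\<close>
  define R where "R h \<longleftrightarrow> certified n ?\<eta> ?M (majority n (drop ?s (take (?s + 2 * ?M) h))) (drop (?s + 2 * ?M) h)" for h
  have maj: "hist_measurable (count_space UNIV) (\<lambda>h. majority n (drop ?s h))"
    by (rule hist_measurable_drop[OF hist_measurable_majority])
  have hmG: "hist_measurable (count_space UNIV) G"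
    unfolding G_def[abs_def]
    by (intro hist_measurable_conj hist_measurable_length hist_measurable_comp[where f = "\<lambda>a. a \<noteq> b", OF maj]) simp
  have hmR: "hist_measurable (count_space UNIV) R"
    unfolding R_def[abs_def]
    by (rule hist_measurable_bind[where F = "\<lambda>a h. certified n ?\<eta> ?M a (drop (?s + 2 * ?M) h)",
          OF hist_measurable_drop[OF hist_measurable_certified] hist_measurable_take[OF maj]])
  define E where "E = {X \<in> space T. G (run ?p X (?s + 2 * ?M)) \<and> R (run ?p X ((?s + 2 * ?M) + 2 * ?M))}"
  have E: "E \<in> sets T" unfolding E_def by (intro pred_run_sets hmG hmR)
  have "P.prob E \<le> (2 * ?\<eta>) * P.prob {X \<in> space T. G (run ?p X (?s + 2 * ?M))}"
    unfolding E_def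
  proof (rule markov_bai[OF hmG hmR])
    fix h assume h: "G h"
    then show "P.prob {Y \<in> space T. R (h @ run (\<lambda>g. ?p (h @ g)) Y (2 * ?M))} \<le> 2 * ?\<eta>"
      using certified_wrong[of "majority n (drop ?s h)" ?\<eta> ?M] risk M run_second_half[of h k \<delta>] majority_less[OF n_pos]
      by (simp add: R_def G_def)
  qed (use risk in simp)
  also have "\<dots> \<le> (2 * ?\<eta>) * 1" using risk by (intro mult_left_mono) auto
  finally have pE: "P.prob E \<le> 2 * ?\<eta>" by simp
  have "mistaken \<delta> k \<subseteq> E"
  proof
    fix X assume X: "X \<in> mistaken \<delta> k"
    define h where "h = run ?p X (start n (Suc k))"
    obtain i where i: "i \<noteq> b" "?p h = Stop i" and len: "length h = start n (Suc k)" and Xs: "X \<in> space T"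
      using X by (auto simp: mistaken_def h_def)
    have half: "run ?p X (?s + 2 * ?M) = take (?s + 2 * ?M) h"
      unfolding h_def by (rule run_take) (use len in \<open>auto simp: h_def start_Suc\<close>)
    have cand: "candidate n k (drop ?s h) = majority n (drop ?s (take (?s + 2 * ?M) h))"
      by (simp add: candidate_def take_drop add.commute)
    have "accepted n \<delta> k (drop ?s h)" using bai_stop_iff(1)[OF n_pos len, of \<delta>] i by (simp add: is_stop_def)
    then have "certified n ?\<eta> ?M (majority n (drop ?s (take (?s + 2 * ?M) h))) (drop (?s + 2 * ?M) h)"
      unfolding accepted_def cand by (simp add: add.commute)
    moreover have "i = majority n (drop ?s (take (?s + 2 * ?M) h))" unfolding cand[symmetric] by (rule bai_stop_iff(2)[OF n_pos len i(2)])
    moreover have "run ?p X ((?s + 2 * ?M) + 2 * ?M) = h" by (simp add: h_def start_Suc add.commute)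
    moreover have "length (take (?s + 2 * ?M) h) = ?s + 2 * ?M" using len by (simp add: start_Suc)
    ultimately show "X \<in> E"
      using i(1) Xs by (auto simp: E_def half G_def R_def)
  qed
  then have "P.prob (mistaken \<delta> k) \<le> P.prob E" using E by (intro P.finite_measure_mono) auto
  also have "\<dots> \<le> 2 * ?\<eta>" by (rule pE)
  also have "\<dots> = \<delta> * (1 / ((real k + 1) * (real k + 2)))" by (simp add: risk_def)
  finally show ?thesis .
qed

end

section \<open>Output and expected sample complexity\<close>

text \<open>The history is frozen from the first stop on, so a stop seen at any time agrees with the
  one at the least stopping time. The existential form is also what makes the output event a
  countable union.\<close>

lemma output_arm_eq_Some_iff:
  "output_arm (\<lambda>_. p) s X = Some i \<longleftrightarrow> (\<exists>t. p (run p X t) = Stop i)"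
proof -
  have min_stop: "run p X t = run p X (stop_round (\<lambda>_. p) s X)" "is_stop (p (run p X (stop_round (\<lambda>_. p) s X)))"
    if "is_stop (p (run p X t))" for t
  proof -
    show stop: "is_stop (p (run p X (stop_round (\<lambda>_. p) s X)))"
      unfolding stop_round_def hist_seed[of p s] by (rule LeastI[of _ t]) (rule that)
    have "stop_round (\<lambda>_. p) s X \<le> t" unfolding stop_round_def hist_seed[of p s] by (rule Least_le) (rule that)
    with stop show "run p X t = run p X (stop_round (\<lambda>_. p) s X)" by (rule run_stopped)
  qed
  show ?thesis
  proof
    assume "output_arm (\<lambda>_. p) s X = Some i"
    then have "p (run p X (stop_round (\<lambda>_. p) s X)) = Stop i"
      by (auto simp: output_arm_def hist_seed[of p s] split: if_splits action.splits)
    then show "\<exists>t. p (run p X t) = Stop i" ..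
  next
    assume "\<exists>t. p (run p X t) = Stop i"
    then obtain t where t: "p (run p X t) = Stop i" ..
    then have st: "is_stop (p (run p X t))" by (simp add: is_stop_def)
    then have "stops (\<lambda>_. p) s X" unfolding stops_def hist_seed[of p s] ..
    moreover have "p (run p X (stop_round (\<lambda>_. p) s X)) = Stop i" using t min_stop(1)[OF st] by simp
    ultimately show "output_arm (\<lambda>_. p) s X = Some i" by (simp add: output_arm_def hist_seed[of p s])
  qed
qed

lemma sample_complexity_seed: "sample_complexity (\<lambda>_. p) s X = sample_complexity (\<lambda>_. p) 0 X"
  by (simp add: sample_complexity_def stops_def stop_round_def hist_seed[of p s])

lemma start_strict_mono: "0 < n \<Longrightarrow> j < k \<Longrightarrow> start n j < start n k"
  using lift_Suc_mono_less[of "start n" j k] budget_pos[of n] by (simp add: start_Suc)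

lemma start_eq_sum: "start n k = (\<Sum>j<k. 4 * budget n j)"
  by (induction k) (auto simp: start_Suc)

text \<open>Round lengths double up to K; afterwards the survival factor 1/4 turns doubling into
  halving.\<close>

lemma sum_halving: "(\<Sum>k<K + m. if k < K then 2 ^ k else 2 ^ K / 2 ^ (k - K)) \<le> (3 * 2 ^ K :: real)"
proof -
  have "(\<Sum>k<K + m. if k < K then 2 ^ k else 2 ^ K / 2 ^ (k - K)) = (2 ^ K - 1) + 2 ^ K * (2 - 2 / 2 ^ m :: real)"
  proof (induction m)
    case 0
    have "(\<Sum>k<K. (2::real) ^ k) = 2 ^ K - 1" by (induction K) auto
    then show ?case by simp
  next
    case (Suc m)
    then show ?case by (simp add: field_simps)
  qed
  also have "\<dots> \<le> 3 * 2 ^ K" by (simp add: field_simps)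
  finally show ?thesis .
qed

context best_arm
begin

lemma stop_round_cases:
  assumes X: "X \<in> space T" and stop: "stops (\<lambda>_. bai n \<delta>) 0 X"
  obtains k where "stop_round (\<lambda>_. bai n \<delta>) 0 X = start n (Suc k)"
    "length (run (bai n \<delta>) X (start n (Suc k))) = start n (Suc k)"
    "is_stop (bai n \<delta> (run (bai n \<delta>) X (start n (Suc k))))"
    "\<And>j. j \<le> k \<Longrightarrow> X \<in> alive \<delta> j"
proof -
  let ?p = "bai n \<delta>"
  define t where "t = stop_round (\<lambda>_. ?p) 0 X"
  have st: "is_stop (?p (run ?p X t))"
    using stop unfolding stops_def t_def stop_round_def by (rule LeastI_ex)
  have nst: "\<not> is_stop (?p (run ?p X s))" if "s < t" for s
    using that unfolding t_def stop_round_def by (rule not_less_Least)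
  have len: "length (run ?p X t) = t"
  proof (cases t)
    case (Suc s)
    then have ns: "\<not> is_stop (?p (run ?p X s))" by (intro nst) simp
    then show ?thesis using running_full[where p = ?p and X = X and t = s, OF ns] Suc by (auto simp: run_Suc is_stop_def split: action.splits)
  qed simp
  obtain k where k: "t = start n (Suc k)" using bai_stop_time[OF n_pos st] len by metis
  show ?thesis
  proof (rule that[of k])
    show "X \<in> alive \<delta> j" if "j \<le> k" for j
      using nst[of "start n j"] start_strict_mono[OF n_pos, of j "Suc k"] that X k by (simp add: alive_def)
  qed (use k len st in \<open>simp_all add: t_def[symmetric]\<close>)
qed

lemma alive_decay:
  assumes \<delta>: "0 < \<delta>" "\<delta> \<le> 1/10"
    and K: "\<And>k. K \<le> k \<Longrightarrow> 2 ^ 24 * hardness (risk \<delta> k) \<le> real (budget n k)"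
  shows "P.prob (alive \<delta> (K + j)) \<le> 1 / 4 ^ j"
proof (induction j)
  case (Suc j)
  have "P.prob (alive \<delta> (Suc (K + j))) \<le> 1/4 * P.prob (alive \<delta> (K + j))"
    by (intro survival \<delta> K) simp
  then show ?case using Suc by simp
qed simp

lemma expected_rounds:
  assumes \<delta>: "0 < \<delta>" "\<delta> \<le> 1/10"
    and K: "\<And>k. K \<le> k \<Longrightarrow> 2 ^ 24 * hardness (risk \<delta> k) \<le> real (budget n k)"
  shows "(\<Sum>k<m. real (4 * budget n k) * P.prob (alive \<delta> k)) \<le> 12 * real (budget n K)"
proof -
  let ?g = "\<lambda>k. if k < K then 2 ^ k else 2 ^ K / 2 ^ (k - K) :: real"
  have "2 ^ k * P.prob (alive \<delta> k) \<le> ?g k" for k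
  proof (cases "k < K")
    case True
    then show ?thesis by (simp add: mult_left_le)
  next
    case False
    define j where "j = k - K"
    have k: "k = K + j" using False by (simp add: j_def)
    have "2 ^ k * P.prob (alive \<delta> k) \<le> 2 ^ k * (1 / 4 ^ j)"
      unfolding k by (intro mult_left_mono alive_decay[OF \<delta> K]) auto
    also have "\<dots> = 2 ^ K * (2 ^ j / 4 ^ j)" by (simp add: k power_add)
    also have "(2::real) ^ j / 4 ^ j = 1 / 2 ^ j" by (simp add: power_divide[symmetric]) (simp add: power_divide)
    finally show ?thesis using False by (simp add: j_def)
  qed
  note bound = this
  have "(\<Sum>k<m. 2 ^ k * P.prob (alive \<delta> k)) \<le> (\<Sum>k<m. ?g k)" by (intro sum_mono bound)
  also have "\<dots> \<le> (\<Sum>k<K + m. ?g k)" by (intro sum_mono2) auto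
  also have "\<dots> \<le> 3 * 2 ^ K" by (rule sum_halving)
  finally have "(4 * real n) * (\<Sum>k<m. 2 ^ k * P.prob (alive \<delta> k)) \<le> (4 * real n) * (3 * 2 ^ K)"
    by (rule mult_left_mono) simp
  then show ?thesis by (simp add: budget_def sum_distrib_left mult.assoc)
qed

text \<open>Surviving forever implies surviving to round K + j, which has probability at most 1 /
  4^j, for every j.\<close>

lemma AE_stops:
  assumes \<delta>: "0 < \<delta>" "\<delta> \<le> 1/10"
  shows "AE X in T. \<exists>k. X \<notin> alive \<delta> k"
proof -
  obtain K where K: "\<And>k. K \<le> k \<Longrightarrow> 2 ^ 24 * hardness (risk \<delta> k) \<le> real (budget n k)"
    using sufficient_round[OF \<delta>] by metis
  let ?N = "\<Inter>k. alive \<delta> k"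
  have N: "?N \<in> sets T" by (rule sets.countable_INT) (auto simp: alive_sets)
  have le: "P.prob ?N \<le> (1/4) ^ j" for j
  proof -
    have "P.prob ?N \<le> P.prob (alive \<delta> (K + j))" by (intro P.finite_measure_mono) auto
    also have "\<dots> \<le> 1 / 4 ^ j" by (rule alive_decay[OF \<delta> K])
    finally show ?thesis by (simp add: power_divide)
  qed
  have "(\<lambda>j. (1/4 :: real) ^ j) \<longlonglongrightarrow> 0" by (rule LIMSEQ_realpow_zero) auto
  then have "P.prob ?N \<le> 0" by (rule LIMSEQ_le_const) (use le in auto)
  then have "emeasure T ?N = 0" by (simp add: P.emeasure_eq_measure measure_le_0_iff)
  then have "?N \<in> null_sets T" using N by auto
  from AE_not_in[OF this] show ?thesis by auto
qed

lemma stops_if_not_alive: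
  assumes "X \<in> space T" "X \<notin> alive \<delta> k"
  shows "stops (\<lambda>_. bai n \<delta>) 0 X"
  using assms by (auto simp: stops_def alive_def)

lemma output_sets:
  "{X \<in> space T. output_arm (\<lambda>_. bai n \<delta>) s X = Some i} \<in> sets T"
proof -
  have "{X \<in> space T. bai n \<delta> (run (bai n \<delta>) X t) = Stop i} \<in> sets T" for t
    using run_measurable[OF hist_measurable_bai hist_measurable_action[of "\<lambda>a. a = Stop i" \<delta>], of n \<delta> t]
    by (simp add: pred_def)
  then have "(\<Union>t. {X \<in> space T. bai n \<delta> (run (bai n \<delta>) X t) = Stop i}) \<in> sets T" by auto
  also have "(\<Union>t. {X \<in> space T. bai n \<delta> (run (bai n \<delta>) X t) = Stop i})
    = {X \<in> space T. output_arm (\<lambda>_. bai n \<delta>) s X = Some i}"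
    by (auto simp: output_arm_eq_Some_iff)
  finally show ?thesis .
qed

text \<open>Almost every run stops, and a stop with an arm other than b happens at the end of some
  round, hence in some \<open>mistaken\<close>; their probabilities telescope to at most
  \<delta>.\<close>

lemma output_correct:
  assumes \<delta>: "0 < \<delta>" "\<delta> \<le> 1/10"
  shows "1 - \<delta> \<le> P.prob {X \<in> space T. output_arm (\<lambda>_. bai n \<delta>) 0 X = Some b}"
proof -
  let ?C = "{X \<in> space T. output_arm (\<lambda>_. bai n \<delta>) 0 X = Some b}"
  have partial: "(\<Sum>k<m. P.prob (mistaken \<delta> k)) \<le> \<delta>" for m
  proof -
    have "(\<Sum>k<m. P.prob (mistaken \<delta> k)) \<le> (\<Sum>k\<le>m. \<delta> * (1 / ((real k + 1) * (real k + 2))))"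
      using \<delta> by (intro order_trans[OF sum_mono[OF mistaken_prob[OF \<delta>]] sum_mono2]) auto
    also have "\<dots> = \<delta> * (1 - 1 / (real m + 2))" unfolding sum_distrib_left[symmetric] sum_telescope ..
    also have "\<dots> \<le> \<delta>" using \<delta> by (simp add: mult_left_le)
    finally show ?thesis .
  qed
  have summ: "summable (\<lambda>k. P.prob (mistaken \<delta> k))"
    by (rule summableI_nonneg_bounded[OF _ partial]) simp
  have "P.prob (\<Union>k. mistaken \<delta> k) \<le> (\<Sum>k. P.prob (mistaken \<delta> k))"
    by (rule P.finite_measure_subadditive_countably[OF _ summ]) auto
  also have "\<dots> \<le> \<delta>" by (rule suminf_le_const[OF summ partial])
  finally have M: "P.prob (\<Union>k. mistaken \<delta> k) \<le> \<delta>" .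
  have "AE X in T. X \<in> space T - ?C \<longrightarrow> X \<in> (\<Union>k. mistaken \<delta> k)"
    using AE_stops[OF \<delta>]
  proof (rule AE_mp, intro AE_I2 impI)
    fix X assume X: "X \<in> space T" and "\<exists>k. X \<notin> alive \<delta> k" and nC: "X \<in> space T - ?C"
    then have "stops (\<lambda>_. bai n \<delta>) 0 X" using stops_if_not_alive by blast
    then obtain k where k: "length (run (bai n \<delta>) X (start n (Suc k))) = start n (Suc k)"
      "is_stop (bai n \<delta> (run (bai n \<delta>) X (start n (Suc k))))"
      using stop_round_cases[OF X] by metis
    from k(2) obtain i where i: "bai n \<delta> (run (bai n \<delta>) X (start n (Suc k))) = Stop i"
      by (auto simp: is_stop_def split: action.splits)
    have "i \<noteq> b" using nC i by (auto simp: output_arm_eq_Some_iff)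
    then have "X \<in> mistaken \<delta> k" using X k i by (auto simp: mistaken_def)
    then show "X \<in> (\<Union>k. mistaken \<delta> k)" by auto
  qed
  then have "P.prob (space T - ?C) \<le> P.prob (\<Union>k. mistaken \<delta> k)"
    by (rule P.finite_measure_mono_AE) auto
  with M have "1 - P.prob ?C \<le> \<delta>"
    using P.prob_compl[OF output_sets[of \<delta> 0 b]] by linarith
  then show ?thesis by simp
qed

lemma sample_complexity_measurable:
  "(\<lambda>X. sample_complexity (\<lambda>_. bai n \<delta>) 0 X) \<in> borel_measurable T"
proof -
  have [measurable]: "Measurable.pred T (\<lambda>X. is_stop (bai n \<delta> (run (bai n \<delta>) X t)))" for t
    by (rule run_measurable[OF hist_measurable_bai hist_measurable_action])
  show ?thesis unfolding sample_complexity_def stops_def stop_round_def by measurable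
qed

text \<open>A run stopping after round k was alive at the start of each round up to k, so its length
  is the sum of the lengths of the rounds it started. Exchanging sum and integral leaves
  \<open>expected_rounds\<close>.\<close>

lemma expected_sample_complexity:
  assumes \<delta>: "0 < \<delta>" "\<delta> \<le> 1/10"
  shows "(\<integral>\<^sup>+X. sample_complexity (\<lambda>_. bai n \<delta>) 0 X \<partial>T) \<le> ennreal (2 ^ 35 * hardness \<delta>)"
proof -
  obtain K where K: "\<And>k. K \<le> k \<Longrightarrow> 2 ^ 24 * hardness (risk \<delta> k) \<le> real (budget n k)"
    "real (budget n K) \<le> 2 ^ 31 * hardness \<delta>"
    using sufficient_round[OF \<delta>] by metis
  let ?f = "\<lambda>k X. ennreal (real (4 * budget n k)) * indicator (alive \<delta> k) X"
  have "AE X in T. sample_complexity (\<lambda>_. bai n \<delta>) 0 X \<le> (\<Sum>k. ?f k X)"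
    using AE_stops[OF \<delta>]
  proof (rule AE_mp, intro AE_I2 impI)
    fix X assume X: "X \<in> space T" and "\<exists>k. X \<notin> alive \<delta> k"
    then have stop: "stops (\<lambda>_. bai n \<delta>) 0 X" using stops_if_not_alive by blast
    then obtain k where k: "stop_round (\<lambda>_. bai n \<delta>) 0 X = start n (Suc k)" "\<And>j. j \<le> k \<Longrightarrow> X \<in> alive \<delta> j"
      using stop_round_cases[OF X] by metis
    have "sample_complexity (\<lambda>_. bai n \<delta>) 0 X = ennreal (real (\<Sum>j<Suc k. 4 * budget n j))"
      using stop unfolding sample_complexity_def k(1) start_eq_sum by simp
    also have "\<dots> = (\<Sum>j<Suc k. ennreal (real (4 * budget n j)))"
      unfolding of_nat_sum by (rule sum_ennreal[symmetric]) simp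
    also have "\<dots> = (\<Sum>j<Suc k. ?f j X)" by (intro sum.cong refl) (simp add: k(2))
    also have "\<dots> \<le> (\<Sum>j. ?f j X)" by (intro sum_le_suminf) auto
    finally show "sample_complexity (\<lambda>_. bai n \<delta>) 0 X \<le> (\<Sum>k. ?f k X)" .
  qed
  then have "(\<integral>\<^sup>+X. sample_complexity (\<lambda>_. bai n \<delta>) 0 X \<partial>T) \<le> (\<integral>\<^sup>+X. (\<Sum>k. ?f k X) \<partial>T)"
    by (rule nn_integral_mono_AE)
  also have "\<dots> = (\<Sum>k. \<integral>\<^sup>+X. ?f k X \<partial>T)" by (intro nn_integral_suminf) simp
  also have "\<dots> = (\<Sum>k. ennreal (real (4 * budget n k) * P.prob (alive \<delta> k)))"
  proof (rule arg_cong[where f = suminf], rule ext)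
    fix k
    have "(\<integral>\<^sup>+X. ?f k X \<partial>T) = ennreal (real (4 * budget n k)) * ennreal (P.prob (alive \<delta> k))"
      unfolding nn_integral_cmult_indicator[OF alive_sets] P.emeasure_eq_measure ..
    also have "\<dots> = ennreal (real (4 * budget n k) * P.prob (alive \<delta> k))"
      by (rule ennreal_mult[symmetric]) simp_all
    finally show "(\<integral>\<^sup>+X. ?f k X \<partial>T) = ennreal (real (4 * budget n k) * P.prob (alive \<delta> k))" .
  qed
  also have "\<dots> \<le> ennreal (12 * real (budget n K))"
  proof (rule suminf_le_const)
    fix m
    have "(\<Sum>k<m. ennreal (real (4 * budget n k) * P.prob (alive \<delta> k)))
        = ennreal (\<Sum>k<m. real (4 * budget n k) * P.prob (alive \<delta> k))"
      by (rule sum_ennreal) simp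
    also have "\<dots> \<le> ennreal (12 * real (budget n K))"
      by (intro ennreal_leI expected_rounds[OF \<delta> K(1)])
    finally show "(\<Sum>k<m. ennreal (real (4 * budget n k) * P.prob (alive \<delta> k))) \<le> ennreal (12 * real (budget n K))" .
  qed simp
  \<comment> \<open>The final constant: 12 * 2^31 \<le> 2^35.\<close>
  also have "\<dots> \<le> ennreal (2 ^ 35 * hardness \<delta>)"
  proof (rule ennreal_leI)
    have "0 \<le> hardness \<delta>" using n_le_hardness[OF \<delta>] by linarith
    then show "12 * real (budget n K) \<le> 2 ^ 35 * hardness \<delta>" using K(2) by simp
  qed
  finally show ?thesis .
qed

end

section \<open>Transfer to the bandit space\<close>

lemma bandit_instance_best_arm:
  assumes n: "2 \<le> n" and inst: "bandit_instance n D b"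
  shows "best_arm n D b"
proof (intro best_arm.intro arms.intro best_arm_axioms.intro)
  note inst' = inst[unfolded bandit_instance_def]
  show "2 \<le> n" "b < n" using n inst' by simp_all
  fix i assume i: "i < n"
  from inst'[THEN conjunct2, THEN conjunct1, rule_format, OF i]
  show "prob_space (D i)" "sets (D i) = sets borel" "AE x in D i. 0 \<le> x \<and> x \<le> 1"
    by simp_all
  show "arm_mean (D i) < arm_mean (D b)" if "i \<noteq> b"
    using inst'[THEN conjunct2, THEN conjunct2, rule_format, OF i that] .
qed

context arms
begin

lemma bandit_space_eq: "bandit_space n D = uniform_measure lborel {0..1} \<Otimes>\<^sub>M T"
  by (simp add: bandit_space_def reward_table_def)

lemma prob_space_seed: "prob_space (uniform_measure lborel {0..1 :: real})"
  by (rule prob_space_uniform_measure) auto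

text \<open>The policy is deterministic, so its output and cost are functions of the table alone;
  this marginal carries the results on tables over to the space with a seed.\<close>

lemma distr_bandit_space_snd: "distr (bandit_space n D) T snd = T"
proof (rule measure_eqI)
  interpret S: prob_space "uniform_measure lborel {0..1 :: real}" by (rule prob_space_seed)
  fix A assume "A \<in> sets (distr (bandit_space n D) T snd)"
  then have A: "A \<in> sets T" by simp
  have "emeasure (distr (bandit_space n D) T snd) A = emeasure (bandit_space n D) (snd -` A \<inter> space (bandit_space n D))"
    unfolding bandit_space_eq by (rule emeasure_distr[OF measurable_snd A])
  also have "snd -` A \<inter> space (bandit_space n D) = space (uniform_measure lborel {0..1 :: real}) \<times> A"
    using sets.sets_into_space[OF A] by (auto simp: bandit_space_eq space_pair_measure)
  also have "emeasure (bandit_space n D) \<dots> = emeasure T A"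
    unfolding bandit_space_eq by (subst P.emeasure_pair_measure_Times) (use A S.emeasure_space_1 in auto)
  finally show "emeasure (distr (bandit_space n D) T snd) A = emeasure T A" .
qed simp

lemma measurable_bandit_space_snd: "snd \<in> bandit_space n D \<rightarrow>\<^sub>M T"
  unfolding bandit_space_eq by (rule measurable_snd)

end

theorem theorem1p2:
  shows "\<exists>C>0. \<forall>n\<ge>2. \<forall>\<delta>::real. 0 < \<delta> \<and> \<delta> \<le> 1/10 \<longrightarrow>
    (\<exists>pol. valid_policy n pol \<and>
      (\<forall>D b. bandit_instance n D b \<longrightarrow>
        {\<omega> \<in> space (bandit_space n D). output_arm pol (fst \<omega>) (snd \<omega>) = Some b}
          \<in> sets (bandit_space n D) \<and>
        measure (bandit_space n D)
          {\<omega> \<in> space (bandit_space n D). output_arm pol (fst \<omega>) (snd \<omega>) = Some b} \<ge> 1 - \<delta> \<and>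
        (\<lambda>\<omega>. sample_complexity pol (fst \<omega>) (snd \<omega>)) \<in> borel_measurable (bandit_space n D) \<and>
        (\<integral>\<^sup>+ \<omega>. sample_complexity pol (fst \<omega>) (snd \<omega>) \<partial>bandit_space n D)
          \<le> ennreal (C * (\<Sum>i<n.
               (arm_var (D i) / (gap n D b i)\<^sup>2 + 1 / gap n D b i)
               * (ln (1 / \<delta>) + LL (1 / gap n D b i))))))"
proof (rule exI[of _ "2 ^ 35"], intro conjI allI impI)
  fix n :: nat and \<delta> :: real
  assume n: "2 \<le> n" and "0 < \<delta> \<and> \<delta> \<le> 1/10"
  then have \<delta>: "0 < \<delta>" "\<delta> \<le> 1/10" by auto
  let ?pol = "\<lambda>_ :: real. bai n \<delta>"
  show "\<exists>pol. valid_policy n pol \<and>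
      (\<forall>D b. bandit_instance n D b \<longrightarrow>
        {\<omega> \<in> space (bandit_space n D). output_arm pol (fst \<omega>) (snd \<omega>) = Some b}
          \<in> sets (bandit_space n D) \<and>
        measure (bandit_space n D)
          {\<omega> \<in> space (bandit_space n D). output_arm pol (fst \<omega>) (snd \<omega>) = Some b} \<ge> 1 - \<delta> \<and>
        (\<lambda>\<omega>. sample_complexity pol (fst \<omega>) (snd \<omega>)) \<in> borel_measurable (bandit_space n D) \<and>
        (\<integral>\<^sup>+ \<omega>. sample_complexity pol (fst \<omega>) (snd \<omega>) \<partial>bandit_space n D)
          \<le> ennreal (2 ^ 35 * (\<Sum>i<n.
               (arm_var (D i) / (gap n D b i)\<^sup>2 + 1 / gap n D b i)
               * (ln (1 / \<delta>) + LL (1 / gap n D b i)))))"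
  proof (rule exI[of _ ?pol], intro conjI allI impI)
    show "valid_policy n ?pol" by (rule bai_valid) (use n in simp)
  next
    fix D b assume "bandit_instance n D b"
    then interpret best_arm n D b by (rule bandit_instance_best_arm[OF n])
    let ?W = "bandit_space n D"
    let ?C = "{X \<in> space T. output_arm ?pol 0 X = Some b}"
    note snd = measurable_bandit_space_snd
    have C: "{\<omega> \<in> space ?W. output_arm ?pol (fst \<omega>) (snd \<omega>) = Some b} = snd -` ?C \<inter> space ?W"
      using measurable_space[OF snd] by (auto simp: output_arm_eq_Some_iff)
    show "{\<omega> \<in> space ?W. output_arm ?pol (fst \<omega>) (snd \<omega>) = Some b} \<in> sets ?W"
      unfolding C by (rule measurable_sets[OF snd output_sets])
    show "measure ?W {\<omega> \<in> space ?W. output_arm ?pol (fst \<omega>) (snd \<omega>) = Some b} \<ge> 1 - \<delta>"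
      using output_correct[OF \<delta>] measure_distr[OF snd output_sets[of \<delta> 0 b]]
      unfolding C distr_bandit_space_snd by simp
    show "(\<lambda>\<omega>. sample_complexity ?pol (fst \<omega>) (snd \<omega>)) \<in> borel_measurable ?W"
      unfolding sample_complexity_seed[of _ "fst _"]
      by (rule measurable_compose[OF snd sample_complexity_measurable])
    have "(\<integral>\<^sup>+ \<omega>. sample_complexity ?pol (fst \<omega>) (snd \<omega>) \<partial>?W) = (\<integral>\<^sup>+ \<omega>. sample_complexity ?pol 0 (snd \<omega>) \<partial>?W)"
      by (intro nn_integral_cong) (rule sample_complexity_seed)
    also have "\<dots> = (\<integral>\<^sup>+ X. sample_complexity ?pol 0 X \<partial>distr ?W T snd)"
      by (rule nn_integral_distr[symmetric, OF snd]) (simp add: sample_complexity_measurable)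
    also have "\<dots> \<le> ennreal (2 ^ 35 * hardness \<delta>)"
      unfolding distr_bandit_space_snd by (rule expected_sample_complexity[OF \<delta>])
    finally show "(\<integral>\<^sup>+ \<omega>. sample_complexity ?pol (fst \<omega>) (snd \<omega>) \<partial>?W)
          \<le> ennreal (2 ^ 35 * (\<Sum>i<n.
               (arm_var (D i) / (gap n D b i)\<^sup>2 + 1 / gap n D b i)
               * (ln (1 / \<delta>) + LL (1 / gap n D b i))))"
      unfolding hardness_def H_def .
  qed
qed simp

end
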